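(* Let $G=(V,E)$ be an undirected (connected) multigraph and let $D$ be a divisor on $G$. Let $r=\#V-1$, the length of a minimal free resolution of the homogeneous toppling ideal of $G$. Then the highest nonzero Betti number, $\beta_r$, is the number of minimal recurrent configurations on $G$. Moreover, $$\beta_{r,D}\neq 0$$ if and only if $D$ is minimally alive (in which case $\deg(D)=\#E$).
   Context: **Graphs and divisors.** An undirected multigraph is a finite vertex set $V$ with a symmetric weight function $\mathrm{wt}:V\times V\to\mathbb{N}$ (loops are allowed); $\mathrm{wt}(u,v)$ is thought of as the number of edges joining $u$ and $v$, edges in $\#E$ are counted with multiplicity, and $\deg(v)=\sum_{u\in V}\mathrm{wt}(v,u)$. The Laplacian is $\Delta:\mathbb{Z}V\to\mathbb{Z}V$, $\Delta(v)=\deg(v)\,v-\sum_{u\in V}\mathrm{wt}(v,u)\,u$; $\mathcal{L}=\mathrm{im}(\Delta)$. Divisors are elements $D=\sum_v D_v v$ of $\mathbb{Z}V$, with $\deg(D)=\sum_v D_v$. $D\sim D'$ if $D-D'\in\mathcal{L}$; $\mathrm{Cl}(G)=\mathbb{Z}V/\mathcal{L}$; $|D|$ is the set of divisors $E\sim D$ with all coefficients nonnegative. **Alive divisors.** A divisor $D$ is unstable if $D_v\ge\deg(v)$ for some $v\in V$, and stable otherwise. $D$ is alive if there is no stable divisor in $|D|$. $D$ is minimally alive if $D$ is alive and, for all $v\in V$, $D-v$ is not alive. **Recurrent configurations.** Fix a sink $s\in V$ and let $\widetilde V=V\setminus\{s\}$. A configuration is an element $c\in\mathbb{Z}\widetilde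 V$; it is stable if $c_v<\deg(v)$ for all $v\in\widetilde V$. Firing $v\in\widetilde V$ replaces $c$ by $c-\deg(v)v+\sum_{u\in\widetilde V}\mathrm{wt}(v,u)u$, and is legal if $c_v\ge\deg(v)$; $c\to\tilde c$ means $\tilde c$ results from a finite (possibly empty) sequence of legal firings. $c$ is recurrent if it is nonnegative, stable, and for each configuration $a$ there is a nonnegative configuration $b$ with $a+b\to c$. A recurrent $c$ is minimal if $c-v$ is not recurrent for every $v\in\widetilde V$. **Betti numbers.** Identify $V$ with $\{1,\dots,n+1\}$ and let $S=\mathbb{C}[x_1,\dots,x_{n+1}]$, graded by $\mathrm{Cl}(G)$ by giving $x^D$ degree the class of $D$. The homogeneous toppling ideal is $I=\mathrm{Span}_{\mathbb{C}}\{x^u-x^v:u,v\in\mathbb{N}^{n+1},\ u-v\in\mathcal{L}\}$. In a minimal $\mathrm{Cl}(G)$-graded free resolution $0\leftarrow I\leftarrow F_1\leftarrow F_2\leftarrow\cdots\leftarrow F_r\leftarrow0$ (indexed so that $F_1$ corresponds to minimal generators of $I$), write $F_i=\bigoplus_{D\in\mathrm{Cl}(G)}S(-D)^{\beta_{i,D}}$, where $S(D)_F=S_{D+F}$. The $\beta_{i,D}$ are the Betti numbers and $\beta_i=\sum_{D\in\mathrm{Cl}(G)}\beta_{i,D}$. For a divisor $D$, $\beta_{i,D}$ means $\beta_{i,[D]}$.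
   Formalization: The equivalence "β_{r,D} ≠ 0 iff D is minimally alive" is stated only for graphs without loops, since it fails whenever G has a loop (loops raise deg(v) but leave the ideal unchanged); #V ≥ 2 is assumed, since β_0 is undefined when #V = 1. *)

theory Defs
  imports Complex_Main "HOL-Library.Poly_Mapping"
begin

section \<open>Multigraphs and divisors\<close>

text \<open>
  The vertex set is the finite type \<open>'v\<close>.  A multigraph is given by its weight function
  \<open>wt\<close>.  A loop contributes \<open>wt v v\<close> (once) to the degree of \<open>v\<close> and to the number of edges.
\<close>

definition multigraph :: "('v::finite \<Rightarrow> 'v \<Rightarrow> nat) \<Rightarrow> bool" where
  "multigraph wt \<longleftrightarrow> (\<forall>u v. wt u v = wt v u)"

definition connected_multigraph :: "('v::finite \<Rightarrow> 'v \<Rightarrow> nat) \<Rightarrow> bool" where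
  "connected_multigraph wt \<longleftrightarrow> multigraph wt \<and> (\<forall>u v. (\<lambda>x y. wt x y > 0)\<^sup>*\<^sup>* u v)"

definition vdeg :: "('v::finite \<Rightarrow> 'v \<Rightarrow> nat) \<Rightarrow> 'v \<Rightarrow> nat" where
  "vdeg wt v = (\<Sum>u\<in>UNIV. wt v u)"

text \<open>The first sum runs over ordered pairs and meets every non-loop edge twice.\<close>

definition num_edges :: "('v::finite \<Rightarrow> 'v \<Rightarrow> nat) \<Rightarrow> nat" where
  "num_edges wt = (\<Sum>(u, v) \<in> {(u, v). u \<noteq> v}. wt u v) div 2 + (\<Sum>v\<in>UNIV. wt v v)"

type_synonym 'v divisor = "'v \<Rightarrow> int"

definition laplacian :: "('v::finite \<Rightarrow> 'v \<Rightarrow> nat) \<Rightarrow> 'v divisor \<Rightarrow> 'v divisor" where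
  "laplacian wt f =
     (\<lambda>u. \<Sum>v\<in>UNIV. f v * ((if u = v then int (vdeg wt v) else 0) - int (wt v u)))"

definition lattice_L :: "('v::finite \<Rightarrow> 'v \<Rightarrow> nat) \<Rightarrow> 'v divisor set" where
  "lattice_L wt = range (laplacian wt)"

definition lin_equiv :: "('v::finite \<Rightarrow> 'v \<Rightarrow> nat) \<Rightarrow> 'v divisor \<Rightarrow> 'v divisor \<Rightarrow> bool" where
  "lin_equiv wt D E \<longleftrightarrow> (\<lambda>v. D v - E v) \<in> lattice_L wt"

definition div_class :: "('v::finite \<Rightarrow> 'v \<Rightarrow> nat) \<Rightarrow> 'v divisor \<Rightarrow> 'v divisor set" where
  "div_class wt D = {E. lin_equiv wt E D}"

definition class_group :: "('v::finite \<Rightarrow> 'v \<Rightarrow> nat) \<Rightarrow> 'v divisor set set" where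
  "class_group wt = range (div_class wt)"

definition div_degree :: "'v::finite divisor \<Rightarrow> int" where
  "div_degree D = (\<Sum>v\<in>UNIV. D v)"

definition linear_system :: "('v::finite \<Rightarrow> 'v \<Rightarrow> nat) \<Rightarrow> 'v divisor \<Rightarrow> 'v divisor set" where
  "linear_system wt D = {E. lin_equiv wt E D \<and> (\<forall>v. E v \<ge> 0)}"

definition unstable_div :: "('v::finite \<Rightarrow> 'v \<Rightarrow> nat) \<Rightarrow> 'v divisor \<Rightarrow> bool" where
  "unstable_div wt D \<longleftrightarrow> (\<exists>v. D v \<ge> int (vdeg wt v))"

definition alive :: "('v::finite \<Rightarrow> 'v \<Rightarrow> nat) \<Rightarrow> 'v divisor \<Rightarrow> bool" where
  "alive wt D \<longleftrightarrow> \<not> (\<exists>E \<in> linear_system wt D. \<not> unstable_div wt E)"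

definition minimally_alive :: "('v::finite \<Rightarrow> 'v \<Rightarrow> nat) \<Rightarrow> 'v divisor \<Rightarrow> bool" where
  "minimally_alive wt D \<longleftrightarrow> alive wt D \<and> (\<forall>v. \<not> alive wt (D(v := D v - 1)))"


section \<open>Sandpile configurations\<close>

text \<open>
  A configuration with respect to the sink \<open>s\<close> is an integer function on the non-sink vertices,
  encoded as a function on all vertices that vanishes at \<open>s\<close>.
\<close>

definition configs :: "'v \<Rightarrow> ('v \<Rightarrow> int) set" where
  "configs s = {c. c s = 0}"

definition stable_config :: "('v::finite \<Rightarrow> 'v \<Rightarrow> nat) \<Rightarrow> 'v \<Rightarrow> ('v \<Rightarrow> int) \<Rightarrow> bool" where
  "stable_config wt s c \<longleftrightarrow> (\<forall>v. v \<noteq> s \<longrightarrow> c v < int (vdeg wt v))"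

definition fire :: "('v::finite \<Rightarrow> 'v \<Rightarrow> nat) \<Rightarrow> 'v \<Rightarrow> 'v \<Rightarrow> ('v \<Rightarrow> int) \<Rightarrow> ('v \<Rightarrow> int)" where
  "fire wt s v c =
     (\<lambda>u. if u = s then 0
          else c u - (if u = v then int (vdeg wt v) else 0) + int (wt v u))"

definition legal_fire ::
    "('v::finite \<Rightarrow> 'v \<Rightarrow> nat) \<Rightarrow> 'v \<Rightarrow> ('v \<Rightarrow> int) \<Rightarrow> ('v \<Rightarrow> int) \<Rightarrow> bool" where
  "legal_fire wt s c c' \<longleftrightarrow> (\<exists>v. v \<noteq> s \<and> c v \<ge> int (vdeg wt v) \<and> c' = fire wt s v c)"

definition recurrent :: "('v::finite \<Rightarrow> 'v \<Rightarrow> nat) \<Rightarrow> 'v \<Rightarrow> ('v \<Rightarrow> int) \<Rightarrow> bool" where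
  "recurrent wt s c \<longleftrightarrow>
     c \<in> configs s \<and> (\<forall>v. c v \<ge> 0) \<and> stable_config wt s c \<and>
     (\<forall>a \<in> configs s. \<exists>b \<in> configs s.
        (\<forall>v. b v \<ge> 0) \<and> (legal_fire wt s)\<^sup>*\<^sup>* (\<lambda>v. a v + b v) c)"

definition minimal_recurrent :: "('v::finite \<Rightarrow> 'v \<Rightarrow> nat) \<Rightarrow> 'v \<Rightarrow> ('v \<Rightarrow> int) \<Rightarrow> bool" where
  "minimal_recurrent wt s c \<longleftrightarrow>
     recurrent wt s c \<and> (\<forall>v. v \<noteq> s \<longrightarrow> \<not> recurrent wt s (c(v := c v - 1)))"


section \<open>The homogeneous toppling ideal\<close>

text \<open>
  \<open>S = \<complex>[x\<^sub>v | v \<in> V]\<close> is the monoid algebra over \<open>\<complex>\<close> of exponent vectors; the ring structure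
  (convolution product) is the one of \<open>HOL-Library.Poly_Mapping\<close>.
\<close>

type_synonym 'v mpoly = "('v \<Rightarrow>\<^sub>0 nat) \<Rightarrow>\<^sub>0 complex"

definition monomial :: "('v \<Rightarrow>\<^sub>0 nat) \<Rightarrow> 'v mpoly" where
  "monomial u = Poly_Mapping.single u 1"

definition scalar_mult :: "complex \<Rightarrow> 'v mpoly \<Rightarrow> 'v mpoly" where
  "scalar_mult c p = Poly_Mapping.single 0 c * p"

lemma module_scalar_mult: "module scalar_mult"
  by unfold_locales
     (simp_all add: scalar_mult_def single_add distrib_left distrib_right
        mult.assoc [symmetric] mult_single single_one)

definition exponent_div :: "('v \<Rightarrow>\<^sub>0 nat) \<Rightarrow> 'v divisor" where
  "exponent_div u = (\<lambda>v. int (Poly_Mapping.lookup u v))"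

text \<open>\<open>p\<close> lies in the graded piece of \<open>S\<close> of degree the class of \<open>D\<close>.\<close>

definition homogeneous ::
    "('v::finite \<Rightarrow> 'v \<Rightarrow> nat) \<Rightarrow> 'v divisor \<Rightarrow> 'v mpoly \<Rightarrow> bool" where
  "homogeneous wt D p \<longleftrightarrow> (\<forall>u \<in> Poly_Mapping.keys p. lin_equiv wt (exponent_div u) D)"

definition toppling_ideal :: "('v::finite \<Rightarrow> 'v \<Rightarrow> nat) \<Rightarrow> 'v mpoly set" where
  "toppling_ideal wt =
     module.span scalar_mult
       {monomial u - monomial v | u v.
          (\<lambda>w. exponent_div u w - exponent_div v w) \<in> lattice_L wt}"

text \<open>The ideal generated by the variables: polynomials with zero constant term.\<close>

definition irrelevant_ideal :: "'v mpoly set" where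
  "irrelevant_ideal = {p. Poly_Mapping.lookup p 0 = 0}"


section \<open>Minimal graded free resolutions and Betti numbers\<close>

text \<open>
  A sequence \<open>0 \<leftarrow> I \<leftarrow> F\<^sub>1 \<leftarrow> F\<^sub>2 \<leftarrow> \<dots>\<close> of graded free modules of finite rank with chosen
  homogeneous bases.  For \<open>i \<ge> 1\<close> the module \<open>F\<^sub>i\<close> is the direct sum of the \<open>S(-D)\<close>, where \<open>D\<close> is
  the class of \<open>gdeg i k\<close> and \<open>k < rnk i\<close> (the values of \<open>rnk\<close> and \<open>gdeg\<close> at \<open>i = 0\<close> are unused).
  The map from \<open>F\<^sub>1\<close> to \<open>I\<close> sends the \<open>k\<close>-th basis vector to \<open>gens k\<close>, and the map from
  \<open>F\<^sub>i\<^sub>+\<^sub>1\<close> to \<open>F\<^sub>i\<close> sends the \<open>k\<close>-th basis vector to the one with \<open>j\<close>-th coordinate \<open>dmat i j k\<close>.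
\<close>

record 'v free_complex =
  rnk :: "nat \<Rightarrow> nat"
  gdeg :: "nat \<Rightarrow> nat \<Rightarrow> 'v divisor"
  gens :: "nat \<Rightarrow> 'v mpoly"
  dmat :: "nat \<Rightarrow> nat \<Rightarrow> nat \<Rightarrow> 'v mpoly"

definition free_module :: "nat \<Rightarrow> (nat \<Rightarrow> 'v mpoly) set" where
  "free_module n = {f. \<forall>k \<ge> n. f k = 0}"

definition augmentation :: "'v free_complex \<Rightarrow> (nat \<Rightarrow> 'v mpoly) \<Rightarrow> 'v mpoly" where
  "augmentation R f = (\<Sum>k < rnk R 1. f k * gens R k)"

definition differential ::
    "'v free_complex \<Rightarrow> nat \<Rightarrow> (nat \<Rightarrow> 'v mpoly) \<Rightarrow> (nat \<Rightarrow> 'v mpoly)" where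
  "differential R i f =
     (\<lambda>j. if j < rnk R i then \<Sum>k < rnk R (Suc i). f k * dmat R i j k else 0)"

text \<open>All maps preserve the grading by the class group.\<close>

definition graded_complex :: "('v::finite \<Rightarrow> 'v \<Rightarrow> nat) \<Rightarrow> 'v free_complex \<Rightarrow> bool" where
  "graded_complex wt R \<longleftrightarrow>
     (\<forall>k < rnk R 1. homogeneous wt (gdeg R 1 k) (gens R k)) \<and>
     (\<forall>i \<ge> 1. \<forall>j < rnk R i. \<forall>k < rnk R (Suc i).
        homogeneous wt (\<lambda>v. gdeg R (Suc i) k v - gdeg R i j v) (dmat R i j k))"

definition resolves :: "'v free_complex \<Rightarrow> 'v mpoly set \<Rightarrow> bool" where
  "resolves R I \<longleftrightarrow>
     augmentation R ` free_module (rnk R 1) = I \<and>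
     {f \<in> free_module (rnk R 1). augmentation R f = 0}
       = differential R 1 ` free_module (rnk R 2) \<and>
     (\<forall>i \<ge> 1. {f \<in> free_module (rnk R (Suc i)). differential R i f = (\<lambda>_. 0)}
       = differential R (Suc i) ` free_module (rnk R (Suc (Suc i)))) \<and>
     (\<exists>N. \<forall>i > N. rnk R i = 0)"

text \<open>
  Minimality: the image of \<open>F\<^sub>i\<^sub>+\<^sub>1\<close> is contained in \<open>\<mm> F\<^sub>i\<close> for all \<open>i \<ge> 1\<close>, where \<open>\<mm>\<close> is the
  ideal generated by the variables.
\<close>

definition minimal_graded_free_resolution ::
    "('v::finite \<Rightarrow> 'v \<Rightarrow> nat) \<Rightarrow> 'v mpoly set \<Rightarrow> 'v free_complex \<Rightarrow> bool" where
  "minimal_graded_free_resolution wt I R \<longleftrightarrow>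
     graded_complex wt R \<and> resolves R I \<and>
     (\<forall>i \<ge> 1. \<forall>j < rnk R i. \<forall>k < rnk R (Suc i). dmat R i j k \<in> irrelevant_ideal)"

text \<open>
  The Betti numbers read off from the complex \<open>R\<close>: the number of summands \<open>S(-C)\<close> of \<open>F\<^sub>i\<close>, and
  the sum of these over all classes.  The class group is infinite, so the sum is taken over the
  (finite) support.
\<close>

definition betti ::
    "('v::finite \<Rightarrow> 'v \<Rightarrow> nat) \<Rightarrow> 'v free_complex \<Rightarrow> nat \<Rightarrow> 'v divisor set \<Rightarrow> nat" where
  "betti wt R i C = card {k. k < rnk R i \<and> div_class wt (gdeg R i k) = C}"

definition total_betti ::
    "('v::finite \<Rightarrow> 'v \<Rightarrow> nat) \<Rightarrow> 'v free_complex \<Rightarrow> nat \<Rightarrow> nat" where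
  "total_betti wt R i =
     (\<Sum>C \<in> {C \<in> class_group wt. betti wt R i C \<noteq> 0}. betti wt R i C)"

end

theory Submission
  imports Defs
begin

text \<open>
Let \<open>n + 1\<close> be the number of vertices, \<open>S\<close> the polynomial ring, \<open>I\<close> the toppling ideal and \<open>\<one>\<close> the
divisor with all coefficients \<open>1\<close>.  A divisor is winnable if it is linearly equivalent to an
effective one, and \<open>N\<close> is extreme if \<open>N\<close> is not winnable but every \<open>N + v\<close> is.  Both sides of the
theorem are statements about extreme divisors: \<open>\<beta>\<^sub>n\<^sub>,\<^sub>D\<close> is \<open>1\<close> if \<open>D - \<one>\<close> is extreme and \<open>0\<close>
otherwise (\<open>top_betti\<close>), minimal recurrent configurations correspond to classes of extreme
divisors (\<open>bij_minimal_recurrent_extreme\<close>), and without loops \<open>D\<close> is minimally alive exactly if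
\<open>D - \<one>\<close> is extreme (\<open>minimally_alive_loopless\<close>).

The algebraic half is the balancing of Tor, carried out on elements.  Index the Koszul complex of
the variables cohomologically: a cochain of degree \<open>q\<close> assigns a value to each \<open>q\<close>-element vertex
set, and \<open>\<delta>\<close> multiplies by variables.  On a free module it is exact except at the full vertex set,
where only constant terms survive (\<open>koszul_exact\<close>).  So the cohomology of \<open>F\<^sub>n\<close> is \<open>F\<^sub>n\<close> modulo the
variables, a vector space with one basis element for each summand of \<open>F\<^sub>n\<close>.  As the maps of a
minimal resolution vanish modulo the variables, a staircase of cochains \<open>c\<^sub>i\<close> with values in \<open>F\<^sub>i\<close>
and \<open>\<delta> c\<^sub>i = d c\<^sub>i\<^sub>+\<^sub>1\<close> identifies this space with the first Koszul cohomology of \<open>S/I\<close> (\<open>chain_down\<close>, \<open>chain_up\<close>, \<open>chain_trivial_iff\<close>), and it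
respects the grading.  The latter cohomology is visible by hand.  A homogeneous polynomial lies in
\<open>I\<close> iff its coefficients sum to \<open>0\<close>, because \<open>I\<close> identifies all monomials of a class.  So a cocycle
of degree \<open>D\<close> is a family of polynomials \<open>p\<^sub>v\<close> of degree \<open>D - \<one> + v\<close> with a common coefficient
sum, and it is a coboundary iff a polynomial of degree \<open>D - \<one>\<close> with that sum exists.  A nonzero sum
is possible iff every \<open>D - \<one> + v\<close> is winnable, and then the cocycle is not a coboundary iff
\<open>D - \<one>\<close> is not winnable: the cohomology is a line if \<open>D - \<one>\<close> is extreme and zero otherwise.  The same
staircase begun one step lower shows that \<open>F\<^sub>n\<^sub>+\<^sub>1\<close> vanishes, since a variable is not a zero divisor
on \<open>S/I\<close>.

The combinatorial half fixes a sink \<open>s\<close>.  Every divisor is equivalent to a unique \<open>p + k s\<close> with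
\<open>p\<close> superstable, and it is winnable iff \<open>k \<ge> 0\<close>.  Burning the graph from the sink orders the
vertices so that \<open>p - s\<close> is at most the divisor of the order, which has degree \<open>g - 1\<close>, where \<open>g\<close> is
the genus of the graph without its loops.  Hence \<open>p\<close> has degree at most \<open>g\<close>, and extreme means
unwinnable of degree \<open>g - 1\<close>, or equivalent to the divisor of an order (\<open>extreme_iff\<close>,
\<open>extreme_order\<close>).  Reversing the order shows that \<open>N \<mapsto> K - N\<close> preserves extreme divisors, where \<open>K\<close> is the canonical
divisor.  A configuration is recurrent iff its complement in the maximal stable configuration is
superstable, so minimal recurrent configurations are complements of superstable ones of degree \<open>g\<close>,
one for each extreme class.  Finally \<open>D\<close> is not alive iff both \<open>D\<close> and its complement in the maximal
stable divisor are winnable; thus a minimally alive \<open>D\<close> has an extreme complement, which gives its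
degree, and without loops this complement is \<open>K - (D - \<one>)\<close>.
\<close>

section \<open>Linear equivalence\<close>

lemma lin_equiv_iff: "lin_equiv wt D E \<longleftrightarrow> (\<exists>f. \<forall>v. D v - E v = laplacian wt f v)"
  by (auto simp: lin_equiv_def lattice_L_def fun_eq_iff image_iff)

lemma laplacian_add: "laplacian wt (\<lambda>v. f v + g v) u = laplacian wt f u + laplacian wt g u"
  by (simp add: laplacian_def distrib_right sum.distrib)

lemma laplacian_scale: "laplacian wt (\<lambda>v. c * f v) u = c * laplacian wt f u"
  by (simp add: laplacian_def sum_distrib_left mult.assoc)

lemma laplacian_uminus: "laplacian wt (\<lambda>v. - f v) u = - laplacian wt f u"
  by (simp add: laplacian_def sum_negf)

lemma laplacian_diff: "laplacian wt (\<lambda>v. f v - g v) u = laplacian wt f u - laplacian wt g u"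
  by (simp add: laplacian_def left_diff_distrib sum_subtractf)

lemma lin_equiv_refl [simp]: "lin_equiv wt D D"
  using laplacian_scale[of wt 0] by (auto simp: lin_equiv_iff)

lemma lin_equiv_sym: "lin_equiv wt D E \<Longrightarrow> lin_equiv wt E D"
  by (metis (mono_tags, lifting) laplacian_uminus lin_equiv_iff minus_diff_eq)

lemma lin_equiv_add:
  assumes "lin_equiv wt D E" "lin_equiv wt D' E'"
  shows "lin_equiv wt (\<lambda>v. D v + D' v) (\<lambda>v. E v + E' v)"
proof -
  from assms obtain f g where "\<forall>v. D v - E v = laplacian wt f v" "\<forall>v. D' v - E' v = laplacian wt g v"
    by (auto simp: lin_equiv_iff)
  then have "\<forall>v. (D v + D' v) - (E v + E' v) = laplacian wt (\<lambda>v. f v + g v) v"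
    by (simp add: laplacian_add algebra_simps)
  then show ?thesis unfolding lin_equiv_iff by blast
qed

lemma lin_equiv_uminus:
  assumes "lin_equiv wt D E"
  shows "lin_equiv wt (\<lambda>v. - D v) (\<lambda>v. - E v)"
proof -
  from assms obtain f where "\<forall>v. D v - E v = laplacian wt f v" by (auto simp: lin_equiv_iff)
  then have "\<forall>v. - D v - - E v = laplacian wt (\<lambda>v. - f v) v"
    by (simp add: laplacian_uminus) (metis minus_diff_eq uminus_add_conv_diff)
  then show ?thesis unfolding lin_equiv_iff by blast
qed

lemma lin_equiv_diff:
  assumes "lin_equiv wt D E" "lin_equiv wt D' E'"
  shows "lin_equiv wt (\<lambda>v. D v - D' v) (\<lambda>v. E v - E' v)"
  using lin_equiv_add[OF assms(1) lin_equiv_uminus[OF assms(2)]] by simp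

lemma lin_equiv_trans:
  assumes "lin_equiv wt A B" "lin_equiv wt B C"
  shows "lin_equiv wt A C"
proof -
  have "lin_equiv wt (\<lambda>v. A v + B v - B v) (\<lambda>v. B v + C v - B v)"
    using lin_equiv_diff[OF lin_equiv_add[OF assms] lin_equiv_refl[of wt B]] .
  then show ?thesis by simp
qed

lemma div_class_eq_iff: "div_class wt D = div_class wt E \<longleftrightarrow> lin_equiv wt D E"
  unfolding div_class_def by (auto intro: lin_equiv_trans lin_equiv_sym)

definition winnable :: "('v::finite \<Rightarrow> 'v \<Rightarrow> nat) \<Rightarrow> 'v divisor \<Rightarrow> bool" where
  "winnable wt D \<longleftrightarrow> (\<exists>E. lin_equiv wt E D \<and> (\<forall>v. 0 \<le> E v))"

lemma winnable_cong: "lin_equiv wt D E \<Longrightarrow> winnable wt D \<longleftrightarrow> winnable wt E"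
  unfolding winnable_def by (meson lin_equiv_sym lin_equiv_trans)

lemma winnable_mono:
  assumes "winnable wt D" "\<And>v. D v \<le> E v"
  shows "winnable wt E"
proof -
  from assms(1) obtain F where F: "lin_equiv wt F D" "\<forall>v. 0 \<le> F v" by (auto simp: winnable_def)
  have "lin_equiv wt (\<lambda>v. F v + (E v - D v)) (\<lambda>v. D v + (E v - D v))"
    by (rule lin_equiv_add[OF F(1) lin_equiv_refl])
  then show ?thesis using F(2) assms(2) unfolding winnable_def
    by (intro exI[of _ "\<lambda>v. F v + (E v - D v)"]) simp
qed

definition extreme :: "('v::finite \<Rightarrow> 'v \<Rightarrow> nat) \<Rightarrow> 'v divisor \<Rightarrow> bool" where
  "extreme wt N \<longleftrightarrow> \<not> winnable wt N \<and> (\<forall>v. winnable wt (N(v := N v + 1)))"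

lemma lin_equiv_upd_add:
  assumes "lin_equiv wt D E"
  shows "lin_equiv wt (D(v := D v + k)) (E(v := E v + k))"
proof -
  have *: "F(v := F v + k) = (\<lambda>u. F u + (if u = v then k else 0))" for F :: "'a \<Rightarrow> int" by auto
  show ?thesis unfolding * by (rule lin_equiv_add[OF assms lin_equiv_refl])
qed

lemma extreme_cong: "lin_equiv wt D E \<Longrightarrow> extreme wt D \<longleftrightarrow> extreme wt E"
  unfolding extreme_def using winnable_cong lin_equiv_upd_add by blast

text \<open>
Also known as a parking function: no nonempty set of non-sink vertices can be fired as a block
without creating a debt.  The value at the sink is normalised to \<open>0\<close>.
\<close>
definition superstable :: "('v::finite \<Rightarrow> 'v \<Rightarrow> nat) \<Rightarrow> 'v \<Rightarrow> ('v \<Rightarrow> int) \<Rightarrow> bool" where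
  "superstable wt s p \<longleftrightarrow> p s = 0 \<and> (\<forall>v. 0 \<le> p v) \<and>
     (\<forall>A. A \<noteq> {} \<longrightarrow> s \<notin> A \<longrightarrow> (\<exists>v\<in>A. p v < int (\<Sum>w\<in>-A. wt v w)))"

text \<open>
The divisor of an order of the vertices: each vertex counts its edges to earlier vertices, minus
one.  These are the indegrees, minus one, of the acyclic orientation that the order defines.
\<close>
definition order_div :: "('v::finite \<Rightarrow> 'v \<Rightarrow> nat) \<Rightarrow> ('v \<Rightarrow> nat) \<Rightarrow> 'v divisor" where
  "order_div wt \<rho> v = int (\<Sum>w | \<rho> w < \<rho> v. wt v w) - 1"

text \<open>
For the graph without its loops, which is the graph that the Laplacian sees.
\<close>
definition genus_minus_one :: "('v::finite \<Rightarrow> 'v \<Rightarrow> nat) \<Rightarrow> int" where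
  "genus_minus_one wt = int ((\<Sum>(u, v) \<in> {(u, v). u \<noteq> v}. wt u v) div 2) - int (card (UNIV :: 'v set))"

definition max_stable :: "('v::finite \<Rightarrow> 'v \<Rightarrow> nat) \<Rightarrow> 'v divisor" where
  "max_stable wt v = int (vdeg wt v) - 1"

section \<open>Firing scripts\<close>

locale chip_firing =
  fixes wt :: "'v::finite \<Rightarrow> 'v \<Rightarrow> nat"
  assumes conn: "connected_multigraph wt"
begin

lemma wt_sym: "wt u v = wt v u"
  using conn by (simp add: connected_multigraph_def multigraph_def)

lemma laplacian_eq: "laplacian wt f u = int (vdeg wt u) * f u - (\<Sum>w\<in>UNIV. int (wt u w) * f w)"
proof -
  have "laplacian wt f u = (\<Sum>v\<in>UNIV. f v * (if u = v then int (vdeg wt v) else 0)) -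
      (\<Sum>v\<in>UNIV. f v * int (wt v u))"
    by (simp add: laplacian_def right_diff_distrib sum_subtractf)
  also have "(\<Sum>v\<in>UNIV. f v * (if u = v then int (vdeg wt v) else 0)) = int (vdeg wt u) * f u"
    by (subst sum.cong[OF refl, of _ _ "\<lambda>v. if u = v then int (vdeg wt v) * f v else 0"]) auto
  also have "(\<Sum>v\<in>UNIV. f v * int (wt v u)) = (\<Sum>w\<in>UNIV. int (wt u w) * f w)"
    by (rule sum.cong) (auto simp: wt_sym mult.commute)
  finally show ?thesis .
qed

lemma laplacian_eq_diff: "laplacian wt f u = (\<Sum>w\<in>UNIV. int (wt u w) * (f u - f w))"
  by (simp add: laplacian_eq vdeg_def right_diff_distrib sum_subtractf sum_distrib_right)

text \<open>
The Laplacian is symmetric because the weight function is.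
\<close>
lemma laplacian_adjoint:
  "(\<Sum>v\<in>UNIV. f v * laplacian wt g v) = (\<Sum>v\<in>UNIV. laplacian wt f v * g v)"
proof -
  have "(\<Sum>v\<in>UNIV. f v * (\<Sum>w\<in>UNIV. int (wt v w) * g w)) =
    (\<Sum>v\<in>UNIV. \<Sum>w\<in>UNIV. f v * int (wt v w) * g w)"
    by (simp add: sum_distrib_left mult.assoc)
  also have "\<dots> = (\<Sum>w\<in>UNIV. \<Sum>v\<in>UNIV. f v * int (wt v w) * g w)" by (rule sum.swap)
  also have "\<dots> = (\<Sum>v\<in>UNIV. (\<Sum>w\<in>UNIV. int (wt v w) * f w) * g v)"
    unfolding sum_distrib_right
  proof (intro sum.cong refl)
    fix v w show "f w * int (wt w v) * g v = int (wt v w) * f w * g v" using wt_sym[of v w] by simp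
  qed
  finally show ?thesis
    by (simp add: laplacian_eq algebra_simps sum_subtractf)
qed

lemma laplacian_degree: "(\<Sum>v\<in>UNIV. laplacian wt f v) = 0"
  using laplacian_adjoint[of "\<lambda>_. 1" f] by (simp add: laplacian_eq_diff)

lemma div_degree_cong: "lin_equiv wt D E \<Longrightarrow> div_degree D = div_degree E"
  using laplacian_degree by (auto simp: lin_equiv_iff div_degree_def simp flip: sum_subtractf)
    (metis (no_types, lifting) eq_iff_diff_eq_0 sum.cong sum_subtractf)

text \<open>
A script whose firing gives a chip to every non-sink vertex.  It serves twice: it makes arbitrary
divisors effective off the sink, and paired with the Laplacian it bounds the length of firing
scripts.  It decays geometrically with the distance from the sink, so fast that one neighbour nearer
to the sink outweighs the whole degree of a vertex.
\<close>
lemma positive_potential: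
  obtains g :: "'v \<Rightarrow> int" where "\<And>v. v \<noteq> s \<Longrightarrow> laplacian wt g v \<le> -1" "\<And>v. 0 \<le> g v" "\<And>v. g v \<le> g s"
proof -
  define E where "E = (\<lambda>x y. wt x y > 0)"
  have reach: "\<exists>n. (E ^^ n) s v" for v
    using conn unfolding connected_multigraph_def E_def[symmetric] by (meson rtranclp_imp_relpowp)
  define d where "d v = (LEAST n. (E ^^ n) s v)" for v
  have d: "(E ^^ d v) s v" for v unfolding d_def using reach by (rule LeastI_ex)
  have parent: "\<exists>w. wt v w > 0 \<and> d w < d v" if "v \<noteq> s" for v
  proof -
    from d[of v] that obtain n where n: "d v = Suc n" by (cases "d v") auto
    with d[of v] obtain w where "(E ^^ n) s w" "E w v" by (auto elim: relpowp_Suc_E)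
    then have "d w \<le> n" "wt v w > 0" unfolding d_def by (auto intro: Least_le simp: E_def wt_sym)
    then show ?thesis using n by auto
  qed
  define L where "L = Max (range d)"
  have dL: "d v \<le> L" for v unfolding L_def by (intro Max_ge) auto
  define B :: int where "B = 1 + (\<Sum>v\<in>UNIV. int (vdeg wt v))"
  have B: "int (vdeg wt v) + 1 \<le> B" for v
    using member_le_sum[of v UNIV "\<lambda>v. int (vdeg wt v)"] by (simp add: B_def)
  have B1: "B \<ge> 1" unfolding B_def by (simp add: sum_nonneg)
  define g where "g v = B ^ (L - d v)" for v
  have g1: "g v \<ge> 1" for v using B1 by (simp add: g_def one_le_power)
  show thesis
  proof
    show "0 \<le> g v" for v using g1[of v] by simp
    have "d s = 0" unfolding d_def by (rule Least_eq_0) simp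
    then show "g v \<le> g s" for v unfolding g_def using B1 by (intro power_increasing) auto
    fix v assume "v \<noteq> s"
    then obtain w where w: "wt v w > 0" "d w < d v" using parent by blast
    have "B * g v = B ^ (Suc (L - d v))" by (simp add: g_def)
    also have "\<dots> \<le> g w" unfolding g_def using B1 w(2) dL[of v] by (intro power_increasing) auto
    also have "\<dots> \<le> int (wt v w) * g w" using w(1) g1[of w] by (simp add: mult_le_cancel_right1)
    also have "\<dots> \<le> (\<Sum>w\<in>UNIV. int (wt v w) * g w)"
      using g1 by (intro member_le_sum) (auto intro!: mult_nonneg_nonneg simp: order_trans[OF _ g1])
    finally have "laplacian wt g v \<le> (int (vdeg wt v) - B) * g v"
      by (simp add: laplacian_eq algebra_simps)
    also have "\<dots> \<le> (-1) * g v" using B[of v] g1[of v] by (intro mult_right_mono) auto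
    finally show "laplacian wt g v \<le> -1" using g1[of v] by simp
  qed
qed

text \<open>
Pairing the Laplacian of \<open>f\<close> with the potential \<open>g\<close> gives, by symmetry, at least the total of \<open>f\<close>.
On the other hand the pairing is bounded, since the fired divisor has a fixed degree, is effective
off the sink, and \<open>g\<close> is largest at the sink.
\<close>
lemma firing_bound:
  obtains B :: int where "\<And>f. \<lbrakk>f s = 0; \<And>v. 0 \<le> f v; \<And>v. v \<noteq> s \<Longrightarrow> 0 \<le> N v - laplacian wt f v\<rbrakk>
     \<Longrightarrow> (\<Sum>v\<in>UNIV. f v) \<le> B"
proof -
  obtain g :: "'v \<Rightarrow> int" where g: "\<And>v. v \<noteq> s \<Longrightarrow> laplacian wt g v \<le> -1" "\<And>v. 0 \<le> g v" "\<And>v. g v \<le> g s"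
    using positive_potential[of s] by blast
  show thesis
  proof
    fix f :: "'v \<Rightarrow> int"
    assume f: "f s = 0" "\<And>v. 0 \<le> f v" "\<And>v. v \<noteq> s \<Longrightarrow> 0 \<le> N v - laplacian wt f v"
    have "(\<Sum>v\<in>UNIV. f v) \<le> (\<Sum>v\<in>UNIV. - (f v * laplacian wt g v))"
    proof (rule sum_mono)
      fix v show "f v \<le> - (f v * laplacian wt g v)"
        using mult_left_mono[OF g(1)[of v] f(2)[of v]] f(1) by (cases "v = s") auto
    qed
    also have "\<dots> = (\<Sum>v\<in>UNIV. (N v - laplacian wt f v) * g v) - (\<Sum>v\<in>UNIV. N v * g v)"
      by (simp add: sum_negf laplacian_adjoint left_diff_distrib sum_subtractf)
    also have "(\<Sum>v\<in>UNIV. (N v - laplacian wt f v) * g v) \<le> (\<Sum>v\<in>UNIV. (N v - laplacian wt f v) * g s)"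
    proof (rule sum_mono)
      fix v show "(N v - laplacian wt f v) * g v \<le> (N v - laplacian wt f v) * g s"
        using mult_left_mono[OF g(3)[of v] f(3)[of v]] by (cases "v = s") auto
    qed
    also have "\<dots> = div_degree N * g s"
      using laplacian_degree by (simp add: div_degree_def sum_subtractf flip: sum_distrib_right)
    finally show "(\<Sum>v\<in>UNIV. f v) \<le> div_degree N * g s - (\<Sum>v\<in>UNIV. N v * g v)" by simp
  qed
qed

text \<open>
Firing a set once costs each of its vertices the number of its edges that leave the set.
\<close>
lemma laplacian_indicator_in:
  assumes "v \<in> A" shows "laplacian wt (\<lambda>u. if u \<in> A then 1 else 0) v = int (\<Sum>w\<in>-A. wt v w)"
proof -
  have "laplacian wt (\<lambda>u. if u \<in> A then 1 else 0) v = (\<Sum>w\<in>UNIV. if w \<in> -A then int (wt v w) else 0)"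
    using assms unfolding laplacian_eq_diff by (intro sum.cong) auto
  also have "\<dots> = (\<Sum>w\<in>-A. int (wt v w))" by (subst sum.If_cases) (auto simp: Compl_eq)
  finally show ?thesis by simp
qed

lemma laplacian_indicator_out:
  assumes "v \<notin> A" shows "laplacian wt (\<lambda>u. if u \<in> A then 1 else 0) v \<le> 0"
  using assms unfolding laplacian_eq_diff by (intro sum_nonpos) auto

text \<open>
In place of a termination argument for firing sequences: among the scripts with a given property
that keep the non-sink vertices out of debt there is a longest one.
\<close>
lemma maximal_firing:
  assumes P: "P f0" and Pprop: "\<And>f. P f \<Longrightarrow> f s = 0 \<and> (\<forall>v. 0 \<le> f v) \<and> (\<forall>v. v \<noteq> s \<longrightarrow> 0 \<le> N v - laplacian wt f v)"
  obtains f where "P f" "\<And>f'. P f' \<Longrightarrow> (\<Sum>v\<in>UNIV. f' v) \<le> (\<Sum>v\<in>UNIV. f v)"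
proof -
  obtain B where B: "\<And>f. \<lbrakk>f s = 0; \<And>v. 0 \<le> f v; \<And>v. v \<noteq> s \<Longrightarrow> 0 \<le> N v - laplacian wt f v\<rbrakk>
     \<Longrightarrow> (\<Sum>v\<in>UNIV. f v) \<le> B" using firing_bound by blast
  define m where "m f = nat (\<Sum>v\<in>UNIV. f v)" for f :: "'v \<Rightarrow> int"
  have "\<forall>f. P f \<longrightarrow> m f < nat B + 1"
    using B Pprop unfolding m_def by (metis add.commute le_imp_less_Suc nat_mono plus_1_eq_Suc)
  with P obtain f where f: "P f" "\<forall>f'. P f' \<longrightarrow> m f' \<le> m f"
    using ex_has_greatest_nat[of P f0 m] by blast
  show thesis
  proof
    show "P f" by fact
    fix f' assume "P f'"
    then have "m f' \<le> m f" "0 \<le> (\<Sum>v\<in>UNIV. f v)" using f Pprop[OF f(1)] by (auto intro: sum_nonneg)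
    then show "(\<Sum>v\<in>UNIV. f' v) \<le> (\<Sum>v\<in>UNIV. f v)" by (simp add: m_def)
  qed
qed

lemma lin_equiv_fire: "lin_equiv wt (\<lambda>v. N v - laplacian wt f v) N"
  unfolding lin_equiv_iff by (intro exI[of _ "\<lambda>v. - f v"]) (simp add: laplacian_uminus)

section \<open>Superstable representatives\<close>

text \<open>
Use the potential to make \<open>N\<close> effective off the sink, then take a longest script that keeps it
so.  A block that could still be fired would lengthen the script.
\<close>
lemma superstable_exists:
  obtains p k where "superstable wt s p" "lin_equiv wt (p(s := k)) N"
proof -
  obtain g :: "'v \<Rightarrow> int" where g: "\<And>v. v \<noteq> s \<Longrightarrow> laplacian wt g v \<le> -1" "\<And>v. 0 \<le> g v" "\<And>v. g v \<le> g s"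
    using positive_potential[of s] by blast
  define m where "m = (\<Sum>v\<in>UNIV. \<bar>N v\<bar>)"
  define N' where "N' v = N v - laplacian wt (\<lambda>u. m * g u) v" for v
  have N'N: "lin_equiv wt N' N" unfolding N'_def[abs_def] by (rule lin_equiv_fire)
  have N'0: "0 \<le> N' v" if "v \<noteq> s" for v
  proof -
    have "\<bar>N v\<bar> \<le> m" unfolding m_def by (rule member_le_sum) auto
    moreover have "m * laplacian wt g v \<le> m * (-1)"
      using g(1)[OF that] by (intro mult_left_mono) (auto simp: m_def sum_nonneg)
    ultimately show ?thesis by (simp add: N'_def laplacian_scale)
  qed
  define P where "P f \<longleftrightarrow> f s = 0 \<and> (\<forall>v. 0 \<le> f v) \<and> (\<forall>v. v \<noteq> s \<longrightarrow> 0 \<le> N' v - laplacian wt f v)" for f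
  have "P (\<lambda>_. 0)" using N'0 by (simp add: P_def laplacian_eq_diff)
  moreover have Pf: "f s = 0 \<and> (\<forall>v. 0 \<le> f v) \<and> (\<forall>v. v \<noteq> s \<longrightarrow> 0 \<le> N' v - laplacian wt f v)" if "P f" for f
    using that unfolding P_def .
  ultimately obtain f where f: "P f" "\<And>f'. P f' \<Longrightarrow> (\<Sum>v\<in>UNIV. f' v) \<le> (\<Sum>v\<in>UNIV. f v)"
    using maximal_firing[of P "\<lambda>_. 0" s N', OF _ Pf] by blast
  define M where "M v = N' v - laplacian wt f v" for v
  show thesis
  proof
    have "lin_equiv wt M N" unfolding M_def[abs_def] by (rule lin_equiv_trans[OF lin_equiv_fire N'N])
    then show "lin_equiv wt ((M(s := 0))(s := M s)) N" by simp
    show "superstable wt s (M(s := 0))" unfolding superstable_def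
    proof (intro conjI allI impI)
      show "0 \<le> (M(s := 0)) v" for v using f(1) by (simp add: P_def M_def)
      fix A assume A: "A \<noteq> {}" "s \<notin> A"
      show "\<exists>v\<in>A. (M(s := 0)) v < int (\<Sum>w\<in>-A. wt v w)"
      proof (rule ccontr)
        assume neg: "\<not> ?thesis"
        have ge: "int (\<Sum>w\<in>-A. wt v w) \<le> M v" if "v \<in> A" for v
        proof -
          have "v \<noteq> s" using A(2) that by blast
          then show ?thesis using neg that by (metis fun_upd_other not_less)
        qed
        define f' where "f' v = f v + (if v \<in> A then 1 else 0)" for v
        have "P f'" unfolding P_def
        proof (intro conjI allI impI)
          show "f' s = 0" "0 \<le> f' v" for v using f(1) A(2) by (auto simp: P_def f'_def)
          fix v assume v: "v \<noteq> s"
          have "N' v - laplacian wt f' v = M v - laplacian wt (\<lambda>u. if u \<in> A then 1 else 0) v"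
            unfolding f'_def by (simp add: laplacian_add M_def)
          then show "0 \<le> N' v - laplacian wt f' v"
            using ge[of v] laplacian_indicator_in[of v A] laplacian_indicator_out[of v A] f(1) v
            by (cases "v \<in> A") (auto simp: P_def M_def)
        qed
        then have "(\<Sum>v\<in>UNIV. f' v) \<le> (\<Sum>v\<in>UNIV. f v)" by (rule f(2))
        then have "(\<Sum>v\<in>UNIV. if v \<in> A then 1::int else 0) \<le> 0" by (simp add: f'_def sum.distrib)
        then have "card A = 0" by (simp add: sum.If_cases)
        then show False using A(1) by simp
      qed
    qed simp
  qed
qed

text \<open>
The vertices where \<open>f\<close> is maximal send a chip along every edge that leaves them.  If the sink were
not among them, some vertex would go into debt by superstability.
\<close>
lemma superstable_sink_fires_most:
  assumes p: "superstable wt s p" and nn: "\<And>v. v \<noteq> s \<Longrightarrow> 0 \<le> p v - laplacian wt f v"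
  shows "f v \<le> f s"
proof (rule ccontr)
  assume "\<not> f v \<le> f s"
  define A where "A = {u. f u = Max (range f)}"
  have mx: "f u \<le> Max (range f)" for u by (intro Max_ge) auto
  have "Max (range f) \<in> range f" by (intro Max_in) auto
  then have "A \<noteq> {}" unfolding A_def by (metis (mono_tags, lifting) empty_iff mem_Collect_eq rangeE)
  moreover have "s \<notin> A" using \<open>\<not> f v \<le> f s\<close> mx[of v] by (auto simp: A_def)
  ultimately obtain u where u: "u \<in> A" "p u < int (\<Sum>w\<in>-A. wt u w)"
    using p unfolding superstable_def by blast
  have "(\<Sum>w\<in>-A. int (wt u w)) \<le> (\<Sum>w\<in>-A. int (wt u w) * (f u - f w))"
  proof (rule sum_mono)
    fix w assume "w \<in> -A"
    then have "f w \<noteq> f u" "f w \<le> f u" using u(1) mx[of w] by (auto simp: A_def)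
    then have "f w < f u" by simp
    then show "int (wt u w) \<le> int (wt u w) * (f u - f w)" by (simp add: mult_le_cancel_left1)
  qed
  also have "\<dots> \<le> laplacian wt f u" unfolding laplacian_eq_diff
    using u(1) mx by (intro sum_mono2) (auto simp: A_def)
  finally have "p u < laplacian wt f u" using u(2) by simp
  then show False using nn[of u] u(1) \<open>s \<notin> A\<close> by (cases "u = s") auto
qed

text \<open>
The script that joins the two divisors and its negative both attain their maximum at the sink, so
the script is constant.
\<close>
lemma superstable_unique:
  assumes p: "superstable wt s p" and q: "superstable wt s q"
    and eq: "lin_equiv wt (p(s := k)) (q(s := l))"
  shows "p = q \<and> k = l"
proof -
  from eq obtain f where f: "\<forall>v. (p(s := k)) v - (q(s := l)) v = laplacian wt f v" by (auto simp: lin_equiv_iff)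
  have 1: "f v \<le> f s" for v
  proof (rule superstable_sink_fires_most[OF p])
    fix v assume "v \<noteq> s" then show "0 \<le> p v - laplacian wt f v"
      using f q by (simp add: superstable_def flip: f[rule_format, of v])
  qed
  have 2: "- f v \<le> - f s" for v
  proof (rule superstable_sink_fires_most[OF q, of "\<lambda>v. - f v"])
    fix v assume "v \<noteq> s" then show "0 \<le> q v - laplacian wt (\<lambda>v. - f v) v"
      using f p by (simp add: superstable_def laplacian_uminus flip: f[rule_format, of v])
  qed
  have d: "int (wt v w) * (f v - f w) = 0" for v w using 1[of v] 2[of v] 1[of w] 2[of w] by simp
  then have "laplacian wt f v = 0" for v unfolding laplacian_eq_diff d by simp
  with f have "(p(s := k)) v = (q(s := l)) v" for v by simp
  then have "p v = q v" if "v \<noteq> s" for v using that by (metis fun_upd_other)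
  moreover have "p s = q s" using p q by (simp add: superstable_def)
  moreover have "k = l" using \<open>(p(s := k)) s = (q(s := l)) s\<close> by simp
  ultimately show ?thesis by (metis ext)
qed

text \<open>
A script that removes the debt of \<open>p + k s\<close> fires the sink most, so the sink can only lose chips.
\<close>
lemma winnable_superstable:
  assumes p: "superstable wt s p"
  shows "winnable wt (p(s := k)) \<longleftrightarrow> 0 \<le> k"
proof
  assume "0 \<le> k" then show "winnable wt (p(s := k))"
    using p unfolding winnable_def superstable_def by (intro exI[of _ "p(s := k)"]) auto
next
  assume "winnable wt (p(s := k))"
  then obtain E where E: "lin_equiv wt (p(s := k)) E" "\<forall>v. 0 \<le> E v" using lin_equiv_sym by (auto simp: winnable_def)
  then obtain f where f: "\<forall>v. (p(s := k)) v - E v = laplacian wt f v" by (auto simp: lin_equiv_iff)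
  have "f v \<le> f s" for v
  proof (rule superstable_sink_fires_most[OF p])
    fix v assume "v \<noteq> s" then show "0 \<le> p v - laplacian wt f v" using E(2) by (simp flip: f[rule_format, of v])
  qed
  then have "0 \<le> laplacian wt f s" unfolding laplacian_eq_diff by (intro sum_nonneg) auto
  moreover have "k - E s = laplacian wt f s" using f[rule_format, of s] by simp
  ultimately show "0 \<le> k" using E(2)[rule_format, of s] by linarith
qed

section \<open>Orders of the vertices\<close>

text \<open>
After firing \<open>f\<close>, look at the earliest vertex where \<open>f\<close> is maximal.  It has sent a chip along each
edge to an earlier vertex, and it held one chip fewer than the number of these edges.
\<close>
lemma order_div_unwinnable:
  assumes "inj \<rho>" shows "\<not> winnable wt (order_div wt \<rho>)"
proof
  assume "winnable wt (order_div wt \<rho>)"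
  then obtain E where E: "lin_equiv wt (order_div wt \<rho>) E" "\<forall>v. 0 \<le> E v"
    using lin_equiv_sym by (auto simp: winnable_def)
  then obtain f where f: "\<forall>v. order_div wt \<rho> v - E v = laplacian wt f v" by (auto simp: lin_equiv_iff)
  define A where "A = {u. f u = Max (range f)}"
  have mx: "f u \<le> Max (range f)" for u by (intro Max_ge) auto
  have "Max (range f) \<in> range f" by (intro Max_in) auto
  then have "A \<noteq> {}" unfolding A_def by (metis (mono_tags, lifting) empty_iff mem_Collect_eq rangeE)
  then obtain u where u: "u \<in> A" "\<And>w. w \<in> A \<Longrightarrow> \<rho> u \<le> \<rho> w"
    using ex_has_least_nat[of "\<lambda>u. u \<in> A" _ \<rho>] by blast
  have "(\<Sum>w | \<rho> w < \<rho> u. int (wt u w)) \<le> (\<Sum>w | \<rho> w < \<rho> u. int (wt u w) * (f u - f w))"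
  proof (rule sum_mono)
    fix w assume "w \<in> {w. \<rho> w < \<rho> u}"
    then have "w \<notin> A" using u(2)[of w] by auto
    then have "f w \<noteq> f u" "f w \<le> f u" using u(1) mx[of w] by (auto simp: A_def)
    then have "f w < f u" by simp
    then show "int (wt u w) \<le> int (wt u w) * (f u - f w)" by (simp add: mult_le_cancel_left1)
  qed
  also have "\<dots> \<le> laplacian wt f u" unfolding laplacian_eq_diff
    using u(1) mx by (intro sum_mono2) (auto simp: A_def)
  finally show False using f[rule_format, of u] E(2)[rule_format, of u] by (simp add: order_div_def)
qed

text \<open>
Each edge that is not a loop is counted once, at its later end.
\<close>
lemma sum_order:
  fixes \<rho> :: "'v \<Rightarrow> nat"
  assumes "inj \<rho>"
  shows "(\<Sum>v\<in>UNIV. \<Sum>w | \<rho> w < \<rho> v. wt v w) = (\<Sum>(u, v) \<in> {(u, v). u \<noteq> v}. wt u v) div 2"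
proof -
  define X where "X = (\<Sum>v\<in>UNIV. \<Sum>w | \<rho> w < \<rho> v. wt v w)"
  have X1: "X = (\<Sum>(v,w)\<in>{(v,w). \<rho> w < \<rho> v}. wt v w)"
    unfolding X_def by (subst sum.Sigma) (auto intro: sum.cong)
  have X2: "X = (\<Sum>(v,w)\<in>{(v,w). \<rho> v < \<rho> w}. wt v w)"
    unfolding X1 by (rule sum.reindex_bij_witness[of _ prod.swap prod.swap]) (auto simp: wt_sym)
  have ne: "u \<noteq> v \<longleftrightarrow> \<rho> v < \<rho> u \<or> \<rho> u < \<rho> v" for u v
    using assms by (metis injD less_irrefl linorder_neqE_nat)
  have U: "{(u, v). u \<noteq> v} = {(v,w). \<rho> w < \<rho> v} \<union> {(v,w). \<rho> v < \<rho> w}"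
    by (auto simp: ne)
  have "(\<Sum>(u, v) \<in> {(u, v). u \<noteq> v}. wt u v) =
      (\<Sum>(v,w)\<in>{(v,w). \<rho> w < \<rho> v}. wt v w) + (\<Sum>(v,w)\<in>{(v,w). \<rho> v < \<rho> w}. wt v w)"
    unfolding U by (rule sum.union_disjoint) auto
  then have "(\<Sum>(u, v) \<in> {(u, v). u \<noteq> v}. wt u v) = X + X"
    using X1 X2 by simp
  then show ?thesis unfolding X_def by simp
qed

lemma order_div_degree:
  assumes "inj \<rho>" shows "div_degree (order_div wt \<rho>) = genus_minus_one wt"
proof -
  have "div_degree (order_div wt \<rho>) = int (\<Sum>v\<in>UNIV. \<Sum>w | \<rho> w < \<rho> v. wt v w) - int (card (UNIV :: 'v set))"
    by (simp add: div_degree_def order_div_def sum_subtractf)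
  then show ?thesis by (simp only: sum_order[OF assms] genus_minus_one_def)
qed

text \<open>
Dhar's burning algorithm.  The fire starts at the sink; superstability of \<open>p\<close>, applied to the set
of unburnt vertices, yields a vertex with more burnt edges than chips, which burns next.
\<close>
lemma superstable_order:
  assumes p: "superstable wt s p"
  obtains \<rho> where "inj \<rho>" "\<And>v. (p(s := -1)) v \<le> order_div wt \<rho> v" 
proof -
  have "\<exists>B \<rho>. s \<in> B \<and> card B = Suc n \<and> inj_on \<rho> B \<and> \<rho> ` B \<subseteq> {..n} \<and>
     (\<forall>v\<in>B. (p(s := -1)) v \<le> int (\<Sum>w | w \<in> B \<and> \<rho> w < \<rho> v. wt v w) - 1)"
    if "n < card (UNIV :: 'v set)" for n using that
  proof (induction n)
    case 0
    show ?case by (intro exI[of _ "{s}"] exI[of _ "\<lambda>_. 0"]) auto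
  next
    case (Suc n)
    then obtain B and \<rho> :: "'v \<Rightarrow> nat" where B: "s \<in> B" "card B = Suc n" "inj_on \<rho> B" "\<rho> ` B \<subseteq> {..n}"
      "\<And>v. v\<in>B \<Longrightarrow> (p(s := -1)) v \<le> int (\<Sum>w | w \<in> B \<and> \<rho> w < \<rho> v. wt v w) - 1" by auto
    have "-B \<noteq> {}" using B(2) Suc.prems by (metis compl_bot_eq double_compl less_irrefl)
    then obtain v where v: "v \<notin> B" "p v < int (\<Sum>w\<in>B. wt v w)"
      using p B(1) unfolding superstable_def by (metis ComplD ComplI double_compl)
    define \<rho>' where "\<rho>' = \<rho>(v := Suc n)"
    have lt: "\<rho> u \<le> n" if "u \<in> B" for u using that B(4) by auto
    have "(p(s := -1)) u \<le> int (\<Sum>w | w \<in> insert v B \<and> \<rho>' w < \<rho>' u. wt u w) - 1" if u: "u \<in> insert v B" for u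
    proof (cases "u = v")
      case True
      then have "{w. w \<in> insert v B \<and> \<rho>' w < \<rho>' u} = B" using lt v(1) by (auto simp: \<rho>'_def less_Suc_eq_le)
      then show ?thesis using True v B(1) by auto
    next
      case False
      then have "{w. w \<in> insert v B \<and> \<rho>' w < \<rho>' u} = {w. w \<in> B \<and> \<rho> w < \<rho> u}"
        using lt[of u] v(1) u by (auto simp: \<rho>'_def)
      then show ?thesis using B(5)[of u] u False by simp
    qed
    moreover have "inj_on \<rho>' (insert v B)"
    proof -
      have "inj_on \<rho>' B" using B(3) by (rule inj_on_cong[THEN iffD1, rotated]) (use v(1) in \<open>auto simp: \<rho>'_def\<close>)
      moreover have "\<rho>' v \<notin> \<rho>' ` B" 
      proof
        assume "\<rho>' v \<in> \<rho>' ` B"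
        then obtain u where "u \<in> B" "\<rho>' u = Suc n" by (auto simp: \<rho>'_def)
        then show False using lt[of u] v(1) by (auto simp: \<rho>'_def split: if_splits)
      qed
      ultimately show ?thesis using v(1) by simp
    qed
    moreover have "\<rho>' ` insert v B \<subseteq> {..Suc n}" using lt by (auto simp: \<rho>'_def intro: le_SucI)
    moreover have "card (insert v B) = Suc (Suc n)" using B(2) v(1) by simp
    ultimately show ?case using B(1) by (intro exI[of _ "insert v B"] exI[of _ \<rho>']) auto
  qed
  from this[of "card (UNIV :: 'v set) - 1"] obtain B and \<rho> :: "'v \<Rightarrow> nat" where B: "card B = card (UNIV :: 'v set)" "inj_on \<rho> B"
     "\<forall>v\<in>B. (p(s := -1)) v \<le> int (\<Sum>w | w \<in> B \<and> \<rho> w < \<rho> v. wt v w) - 1"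
    by (auto simp: card_gt_0_iff)
  have "B = UNIV" using B(1) by (simp add: card_subset_eq)
  then show thesis using B by (intro that[of \<rho>]) (auto simp: order_div_def)
qed

lemma div_degree_upd: "div_degree (D(v := k)) = div_degree D - D v + k"
  by (simp add: div_degree_def sum.remove[of UNIV v])

lemma superstable_degree:
  assumes p: "superstable wt s p" shows "div_degree p \<le> genus_minus_one wt + 1"
proof -
  obtain \<rho> where \<rho>: "inj \<rho>" "\<And>v. (p(s := -1)) v \<le> order_div wt \<rho> v" using superstable_order[OF p] by blast
  have "div_degree (p(s := -1)) \<le> div_degree (order_div wt \<rho>)"
    unfolding div_degree_def by (intro sum_mono \<rho>(2))
  then show ?thesis using p by (simp add: order_div_degree[OF \<rho>(1)] div_degree_upd superstable_def)
qed

text \<open>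
The order divisor of the burning order dominates \<open>p - s\<close> and has the same degree.
\<close>
lemma superstable_full_degree:
  assumes p: "superstable wt s p" and deg: "div_degree p = genus_minus_one wt + 1"
  obtains \<rho> where "inj \<rho>" "p(s := -1) = order_div wt \<rho>" 
proof -
  obtain \<rho> where \<rho>: "inj \<rho>" "\<And>v. (p(s := -1)) v \<le> order_div wt \<rho> v" using superstable_order[OF p] by blast
  have "(\<Sum>v\<in>UNIV. order_div wt \<rho> v - (p(s := -1)) v) = 0"
    using deg p order_div_degree[OF \<rho>(1)] div_degree_upd[of p s "-1"]
    by (simp add: sum_subtractf div_degree_def superstable_def)
  then have "\<forall>v\<in>UNIV. order_div wt \<rho> v - (p(s := -1)) v = 0"
    using \<rho>(2) by (subst (asm) sum_nonneg_eq_0_iff) auto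
  then show thesis using that \<rho>(1) by (metis UNIV_I eq_iff_diff_eq_0 ext)
qed

text \<open>
Of a set that avoids the sink take the earliest vertex: all its edges to earlier vertices leave the
set.
\<close>
lemma superstable_below_order:
  assumes q0: "q s = 0" and nn: "\<And>v. 0 \<le> q v"
    and le: "\<And>v. (q(s := -1)) v \<le> order_div wt \<rho> v"
  shows "superstable wt s q" unfolding superstable_def
proof (intro conjI allI impI)
  fix A assume A: "A \<noteq> {}" "s \<notin> A"
  then obtain u where u: "u \<in> A" "\<And>w. w \<in> A \<Longrightarrow> \<rho> u \<le> \<rho> w"
    using ex_has_least_nat[of "\<lambda>u. u \<in> A" _ \<rho>] by blast
  have "q u < int (\<Sum>w | \<rho> w < \<rho> u. wt u w)" using le[of u] u(1) A(2) by (cases "u = s") (auto simp: order_div_def)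
  also have "\<dots> \<le> int (\<Sum>w\<in>-A. wt u w)" unfolding of_nat_le_iff
    using u(2) by (intro sum_mono2) (auto simp: not_le[symmetric])
  finally show "\<exists>v\<in>A. q v < int (\<Sum>w\<in>-A. wt v w)" using u(1) by blast
qed (use q0 nn in auto)

text \<open>
If \<open>p\<close> is maximal, it agrees off the sink with the divisor of its burning order, since a vertex below
that bound could receive another chip.
\<close>
lemma superstable_maximal_iff:
  assumes p: "superstable wt s p"
  shows "div_degree p = genus_minus_one wt + 1 \<longleftrightarrow> (\<forall>v. v \<noteq> s \<longrightarrow> \<not> superstable wt s (p(v := p v + 1)))"
proof
  assume "div_degree p = genus_minus_one wt + 1"
  then show "\<forall>v. v \<noteq> s \<longrightarrow> \<not> superstable wt s (p(v := p v + 1))"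
    using superstable_degree[of s "p(v := p v + 1)" for v] by (auto simp: div_degree_upd)
next
  assume max: "\<forall>v. v \<noteq> s \<longrightarrow> \<not> superstable wt s (p(v := p v + 1))"
  obtain \<rho> where \<rho>: "inj \<rho>" "\<And>v. (p(s := -1)) v \<le> order_div wt \<rho> v" using superstable_order[OF p] by blast
  have eq: "p v = order_div wt \<rho> v" if "v \<noteq> s" for v
  proof (rule ccontr)
    assume "p v \<noteq> order_div wt \<rho> v"
    then have "p v + 1 \<le> order_div wt \<rho> v" using \<rho>(2)[of v] that by simp
    then have le: "((p(v := p v + 1))(s := -1)) u \<le> order_div wt \<rho> u" for u
      using \<rho>(2)[of u] that by (cases "u = v") auto
    have "(p(v := p v + 1)) s = 0" "0 \<le> (p(v := p v + 1)) u" for u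
      using p that by (auto simp: superstable_def add_nonneg_nonneg)
    then have "superstable wt s (p(v := p v + 1))" by (rule superstable_below_order) (rule le)
    then show False using max that by blast
  qed
  \<comment> \<open>Off the sink \<open>order_div wt \<rho>\<close> now equals \<open>p \<ge> 0\<close>; were it nonnegative at \<open>s\<close> too, it would be effective.\<close>
  have "order_div wt \<rho> s < 0"
  proof (rule ccontr)
    assume "\<not> order_div wt \<rho> s < 0"
    then have "\<forall>v. 0 \<le> order_div wt \<rho> v" using eq p by (metis not_less superstable_def)
    then show False using order_div_unwinnable[OF \<rho>(1)] lin_equiv_refl unfolding winnable_def by blast
  qed
  then have "order_div wt \<rho> s = -1" by (simp add: order_div_def del: of_nat_sum)
  then have "order_div wt \<rho> = p(s := -1)" using eq by auto
  then have "div_degree (p(s := -1)) = genus_minus_one wt" using order_div_degree[OF \<rho>(1)] by simp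
  then show "div_degree p = genus_minus_one wt + 1" using p by (simp add: div_degree_upd superstable_def)
qed

section \<open>Extreme divisors\<close>

lemma unwinnable_iff_superstable:
  assumes "superstable wt s p" "lin_equiv wt (p(s := k)) N"
  shows "\<not> winnable wt N \<longleftrightarrow> k < 0"
  using winnable_cong[OF assms(2)] winnable_superstable[OF assms(1)] by auto

text \<open>
The bound on the degree of \<open>p\<close> in \<open>p + k s\<close> forces \<open>k \<ge> 0\<close>.
\<close>
lemma winnable_large_degree:
  assumes "genus_minus_one wt < div_degree N" shows "winnable wt N"
proof -
  obtain s :: 'v where True by simp
  obtain p k where p: "superstable wt s p" "lin_equiv wt (p(s := k)) N" by (rule superstable_exists)
  have "div_degree N = div_degree p + k" using div_degree_cong[OF p(2)] p(1)
    by (simp add: div_degree_upd superstable_def)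
  then have "0 \<le> k" using superstable_degree[OF p(1)] assms by simp
  then have "\<not> k < 0" by simp
  then show ?thesis using unwinnable_iff_superstable[OF p] by blast
qed

text \<open>
Write \<open>N\<close> as \<open>p + k s\<close>.  If \<open>N\<close> is extreme, adding a chip at the sink shows \<open>k = -1\<close>, and adding
one at another vertex shows that \<open>p\<close> is maximal, hence of the largest degree.  Conversely, one more
chip raises the degree above that of any unwinnable divisor.
\<close>
lemma extreme_iff: "extreme wt N \<longleftrightarrow> \<not> winnable wt N \<and> div_degree N = genus_minus_one wt"
proof (intro iffI conjI)
  assume N: "extreme wt N"
  then show "\<not> winnable wt N" by (simp add: extreme_def)
  obtain s :: 'v where True by simp
  obtain p k where p: "superstable wt s p" "lin_equiv wt (p(s := k)) N" by (rule superstable_exists)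
  have "k < 0" using unwinnable_iff_superstable[OF p] N by (simp add: extreme_def)
  moreover have "lin_equiv wt (p(s := k + 1)) (N(s := N s + 1))" using lin_equiv_upd_add[OF p(2), of s 1] by simp
  from unwinnable_iff_superstable[OF p(1) this] have "0 \<le> k + 1" using N by (auto simp: extreme_def)
  ultimately have k: "k = -1" by simp
  have "\<not> superstable wt s (p(v := p v + 1))" if "v \<noteq> s" for v
  proof
    assume q: "superstable wt s (p(v := p v + 1))"
    have "lin_equiv wt ((p(v := p v + 1))(s := k)) (N(v := N v + 1))"
      using lin_equiv_upd_add[OF p(2), of v 1] that by (simp add: fun_upd_twist)
    from unwinnable_iff_superstable[OF q this] show False using k N by (simp add: extreme_def)
  qed
  then have "div_degree p = genus_minus_one wt + 1" using superstable_maximal_iff[OF p(1)] by blast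
  then show "div_degree N = genus_minus_one wt" using div_degree_cong[OF p(2)] p(1) k
    by (simp add: div_degree_upd superstable_def)
next
  assume N: "\<not> winnable wt N \<and> div_degree N = genus_minus_one wt"
  moreover have "winnable wt (N(v := N v + 1))" for v
    by (rule winnable_large_degree) (simp add: div_degree_upd N)
  ultimately show "extreme wt N" unfolding extreme_def by blast
qed

lemma extreme_iff_superstable:
  assumes "superstable wt s p" "lin_equiv wt (p(s := k)) N"
  shows "extreme wt N \<longleftrightarrow> k = -1 \<and> div_degree p = genus_minus_one wt + 1"
proof -
  have "div_degree N = div_degree p + k" using div_degree_cong[OF assms(2)] assms(1)
    by (simp add: div_degree_upd superstable_def)
  moreover have "div_degree p \<le> genus_minus_one wt + 1" using superstable_degree[OF assms(1)] .
  ultimately have "k < 0 \<and> div_degree N = genus_minus_one wt \<longleftrightarrow> k = -1 \<and> div_degree p = genus_minus_one wt + 1" by auto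
  then show ?thesis unfolding extreme_iff unwinnable_iff_superstable[OF assms] .
qed

lemma extreme_order:
  assumes "extreme wt N" obtains \<rho> where "inj \<rho>" "lin_equiv wt (order_div wt \<rho>) N"
proof -
  obtain s :: 'v where True by simp
  obtain p k where p: "superstable wt s p" "lin_equiv wt (p(s := k)) N" by (rule superstable_exists)
  have k: "k = -1" "div_degree p = genus_minus_one wt + 1" using extreme_iff_superstable[OF p] assms by auto
  obtain \<rho> where "inj \<rho>" "p(s := -1) = order_div wt \<rho>" by (rule superstable_full_degree[OF p(1) k(2)])
  then show thesis using that[of \<rho>] p(2) k(1) by simp
qed

lemma order_div_extreme: "inj \<rho> \<Longrightarrow> extreme wt (order_div wt \<rho>)"
  by (simp add: extreme_iff order_div_unwinnable order_div_degree)

text \<open>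
The canonical divisor of the graph without its loops.
\<close>
definition canonical :: "'v divisor" where
  "canonical v = int (vdeg wt v) - int (wt v v) - 2"

text \<open>
Each edge at \<open>v\<close> that is not a loop leads to an earlier vertex in exactly one of the two orders.
\<close>
lemma order_div_reverse:
  assumes "inj \<rho>"
  obtains \<rho>' where "inj \<rho>'" "\<And>v. order_div wt \<rho>' v = canonical v - order_div wt \<rho> v"
proof
  define m where "m = Max (range \<rho>)"
  have m: "\<rho> v \<le> m" for v unfolding m_def by (intro Max_ge) auto
  define \<rho>' where "\<rho>' v = m - \<rho> v" for v
  show "inj \<rho>'" using assms m unfolding \<rho>'_def inj_def by (metis diff_diff_cancel)
  fix v
  have "\<rho>' w < \<rho>' v \<longleftrightarrow> \<rho> v < \<rho> w" for w using m[of v] m[of w] unfolding \<rho>'_def by arith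
  then have "{w. \<rho>' w < \<rho>' v} = {w. \<rho> v < \<rho> w}" by simp
  moreover have "vdeg wt v = (\<Sum>w | \<rho> w < \<rho> v. wt v w) + (\<Sum>w | \<rho> v < \<rho> w. wt v w) + wt v v"
  proof -
    have U: "UNIV = insert v ({w. \<rho> w < \<rho> v} \<union> {w. \<rho> v < \<rho> w})"
      using assms by (auto simp: inj_def) (metis linorder_neqE_nat)
    show ?thesis unfolding vdeg_def by (subst U, subst sum.insert, simp, simp, subst sum.union_disjoint) auto
  qed
  ultimately show "order_div wt \<rho>' v = canonical v - order_div wt \<rho> v"
    by (simp add: order_div_def canonical_def)
qed

lemma extreme_canonical_imp:
  assumes "extreme wt N" shows "extreme wt (\<lambda>v. canonical v - N v)"
proof -
  obtain \<rho> where \<rho>: "inj \<rho>" "lin_equiv wt (order_div wt \<rho>) N" by (rule extreme_order[OF assms])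
  obtain \<rho>' where \<rho>': "inj \<rho>'" "\<And>v. order_div wt \<rho>' v = canonical v - order_div wt \<rho> v"
    using order_div_reverse[OF \<rho>(1)] by blast
  have "lin_equiv wt (order_div wt \<rho>') (\<lambda>v. canonical v - N v)"
    unfolding \<rho>'(2)[abs_def] by (rule lin_equiv_diff[OF lin_equiv_refl \<rho>(2)])
  then show ?thesis using order_div_extreme[OF \<rho>'(1)] extreme_cong by blast
qed

lemma extreme_canonical: "extreme wt (\<lambda>v. canonical v - N v) \<longleftrightarrow> extreme wt N"
  using extreme_canonical_imp[of N] extreme_canonical_imp[of "\<lambda>v. canonical v - N v"] by auto

section \<open>Alive divisors\<close>

text \<open>
If the script \<open>f\<close> reduces an effective \<open>E\<close> to a divisor below the degrees, then legal firings alone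
do: a vertex with at least as many chips as its degree must occur in \<open>f\<close>, so firing it shortens
\<open>f\<close> and preserves effectiveness.
\<close>
lemma stable_effective_aux:
  assumes "\<And>v. 0 \<le> f v" "\<And>v. 0 \<le> E v" "\<And>v. E v - laplacian wt f v < int (vdeg wt v)"
  shows "\<exists>G. lin_equiv wt G E \<and> (\<forall>v. 0 \<le> G v) \<and> (\<forall>v. G v < int (vdeg wt v))"
  using assms
proof (induction "nat (\<Sum>v\<in>UNIV. f v)" arbitrary: f E rule: less_induct)
  case less
  show ?case
  proof (cases "\<forall>v. E v < int (vdeg wt v)")
    case True then show ?thesis using less.prems(2) lin_equiv_refl by blast
  next
    case False
    then obtain v where v: "int (vdeg wt v) \<le> E v" by (auto simp: not_less)
    have "f v \<noteq> 0"
    proof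
      assume "f v = 0"
      then have "laplacian wt f v \<le> 0" unfolding laplacian_eq_diff using less.prems(1) by (intro sum_nonpos) (auto simp: mult_nonneg_nonpos)
      then show False using v less.prems(3)[of v] by simp
    qed
    define i where "i u = (if u \<in> {v} then 1 else 0 :: int)" for u
    define f' where "f' u = f u - i u" for u
    define E' where "E' u = E u - laplacian wt i u" for u
    have eq: "E' u - laplacian wt f' u = E u - laplacian wt f u" for u
      by (simp add: E'_def f'_def[abs_def] laplacian_diff)
    have f'0: "0 \<le> f' u" for u using less.prems(1)[of u] \<open>f v \<noteq> 0\<close> by (auto simp: f'_def i_def)
    have "0 \<le> E' u" for u
    proof (cases "u = v")
      case True
      have "(\<Sum>w\<in>-{v}. wt v w) \<le> vdeg wt v" unfolding vdeg_def by (intro sum_mono2) auto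
      then have "int (\<Sum>w\<in>-{v}. wt v w) \<le> E v" using v by linarith
      then show ?thesis using True laplacian_indicator_in[of v "{v}"]
        by (simp add: E'_def i_def[abs_def] del: of_nat_sum)
    next
      case False
      then show ?thesis using less.prems(2)[of u] laplacian_indicator_out[of u "{v}"] by (simp add: E'_def i_def[abs_def])
    qed
    moreover have "(\<Sum>v\<in>UNIV. f' v) = (\<Sum>v\<in>UNIV. f v) - 1" by (simp add: f'_def i_def sum_subtractf)
    then have "nat (\<Sum>v\<in>UNIV. f' v) < nat (\<Sum>v\<in>UNIV. f v)"
      using sum_nonneg[of UNIV f'] f'0 by simp
    ultimately obtain G where G: "lin_equiv wt G E'" "\<forall>v. 0 \<le> G v" "\<forall>v. G v < int (vdeg wt v)"
      using less.hyps[of f' E'] f'0 less.prems(3) by (auto simp: eq)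
    have "lin_equiv wt E' E" unfolding E'_def[abs_def] by (rule lin_equiv_fire)
    then show ?thesis using G lin_equiv_trans by blast
  qed
qed

text \<open>
One effective representative of \<open>D\<close> and another one, possibly in debt, below the degrees suffice:
firing leads from the first to a divisor that has both properties.
\<close>
lemma not_alive_iff:
  "\<not> alive wt D \<longleftrightarrow> winnable wt D \<and> winnable wt (\<lambda>v. max_stable wt v - D v)"
proof
  assume "\<not> alive wt D"
  then obtain E where "E \<in> linear_system wt D" "\<not> unstable_div wt E" by (auto simp: alive_def)
  then have E: "lin_equiv wt E D" "\<forall>v. 0 \<le> E v" "\<forall>v. E v < int (vdeg wt v)"
    by (auto simp: linear_system_def unstable_div_def not_le)
  have "lin_equiv wt (\<lambda>v. max_stable wt v - E v) (\<lambda>v. max_stable wt v - D v)"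
    by (rule lin_equiv_diff[OF lin_equiv_refl E(1)])
  moreover have "\<forall>v. 0 \<le> max_stable wt v - E v" using E(3) by (auto simp: max_stable_def zle_diff1_eq)
  ultimately show "winnable wt D \<and> winnable wt (\<lambda>v. max_stable wt v - D v)"
    using E(1,2) unfolding winnable_def by blast
next
  assume "winnable wt D \<and> winnable wt (\<lambda>v. max_stable wt v - D v)"
  then obtain E F where E: "lin_equiv wt E D" "\<forall>v. 0 \<le> E v"
    and F: "lin_equiv wt F (\<lambda>v. max_stable wt v - D v)" "\<forall>v. 0 \<le> F v" unfolding winnable_def by blast
  have "lin_equiv wt (\<lambda>v. E v + F v) (\<lambda>v. D v + (max_stable wt v - D v))" by (rule lin_equiv_add[OF E(1) F(1)])
  then obtain f where f: "\<forall>v. E v + F v - max_stable wt v = laplacian wt f v" by (auto simp: lin_equiv_iff)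
  define m where "m = Min (range f)"
  have m: "m \<le> f v" for v unfolding m_def by (intro Min_le) auto
  have lm: "laplacian wt (\<lambda>v. f v - m) v = laplacian wt f v" for v by (simp add: laplacian_eq_diff)
  have "E v - laplacian wt (\<lambda>v. f v - m) v < int (vdeg wt v)" for v
    using F(2)[rule_format, of v] by (simp add: lm max_stable_def flip: f[rule_format, of v])
  then obtain G where G: "lin_equiv wt G E" "\<forall>v. 0 \<le> G v" "\<forall>v. G v < int (vdeg wt v)"
    using stable_effective_aux[of "\<lambda>v. f v - m" E] m E(2) by auto
  have "G \<in> linear_system wt D" using G(2) lin_equiv_trans[OF G(1) E(1)] by (simp add: linear_system_def)
  then show "\<not> alive wt D" using G(3) unfolding alive_def unstable_div_def by (force simp: not_le)
qed

text \<open>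
A divisor with empty linear system is alive for lack of representatives; hence the condition that
each \<open>D - v\<close> is winnable.
\<close>
lemma minimally_alive_iff:
  "minimally_alive wt D \<longleftrightarrow> extreme wt (\<lambda>v. max_stable wt v - D v) \<and> (\<forall>v. winnable wt (D(v := D v - 1)))"
proof -
  have eq: "(\<lambda>u. max_stable wt u - (D(v := D v - 1)) u) = (\<lambda>v. max_stable wt v - D v)(v := (max_stable wt v - D v) + 1)" for v by auto
  have "winnable wt (D(v := D v - 1)) \<Longrightarrow> winnable wt D" for v by (erule winnable_mono) auto
  moreover have "\<not> alive wt (D(v := D v - 1)) \<longleftrightarrow> winnable wt (D(v := D v - 1)) \<and>
      winnable wt ((\<lambda>v. max_stable wt v - D v)(v := (max_stable wt v - D v) + 1))" for v
    unfolding not_alive_iff eq ..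
  ultimately show ?thesis
    using not_alive_iff[of D] unfolding minimally_alive_def extreme_def by blast
qed

text \<open>
Adding an order divisor and that of the reversed order gives the canonical divisor.
\<close>
lemma max_stable_degree: "div_degree (max_stable wt) = genus_minus_one wt + int (num_edges wt)"
proof -
  obtain \<rho> :: "'v \<Rightarrow> nat" where \<rho>: "inj \<rho>"
    using finite_imp_inj_to_nat_seg[of "UNIV :: 'v set"] by auto
  obtain \<rho>' where \<rho>': "inj \<rho>'" "\<And>v. order_div wt \<rho>' v = canonical v - order_div wt \<rho> v"
    using order_div_reverse[OF \<rho>] by blast
  have "max_stable wt v = order_div wt \<rho>' v + order_div wt \<rho> v + int (wt v v) + 1" for v
    by (simp add: \<rho>'(2) max_stable_def canonical_def)
  then have "div_degree (max_stable wt) = div_degree (order_div wt \<rho>') + div_degree (order_div wt \<rho>) +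
      int (\<Sum>v\<in>UNIV. wt v v) + int (card (UNIV :: 'v set))"
    by (simp add: div_degree_def sum.distrib)
  then show ?thesis by (simp add: order_div_degree[OF \<rho>] order_div_degree[OF \<rho>'(1)] genus_minus_one_def num_edges_def)
qed

lemma minimally_alive_degree:
  assumes "minimally_alive wt D" shows "div_degree D = int (num_edges wt)"
proof -
  have "div_degree (\<lambda>v. max_stable wt v - D v) = genus_minus_one wt"
    using assms by (simp add: minimally_alive_iff extreme_iff)
  then have "div_degree (max_stable wt) - div_degree D = genus_minus_one wt" by (simp add: div_degree_def sum_subtractf)
  then show ?thesis using max_stable_degree by simp
qed

text \<open>
Without loops the complement of \<open>D\<close> is \<open>K - (D - \<one>)\<close>, and extreme divisors are stable under
\<open>N \<mapsto> K - N\<close>.  Each \<open>D - v\<close> is then winnable because it dominates \<open>D - \<one> + u\<close> for any vertex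
\<open>u \<noteq> v\<close>; this is where a second vertex is used.
\<close>
lemma minimally_alive_loopless:
  assumes "card (UNIV :: 'v set) \<ge> 2" "\<forall>v. wt v v = 0"
  shows "minimally_alive wt D \<longleftrightarrow> extreme wt (\<lambda>v. D v - 1)"
proof -
  have eq: "(\<lambda>v. max_stable wt v - D v) = (\<lambda>v. canonical v - (D v - 1))"
    using assms(2) by (auto simp: max_stable_def canonical_def)
  have "winnable wt (D(v := D v - 1))" if N: "extreme wt (\<lambda>v. D v - 1)" for v
  proof -
    obtain u where u: "u \<noteq> v" using assms(1)
      by (metis UNIV_eq_I card_1_singleton_iff insertCI not_less_eq_eq numeral_2_eq_2 One_nat_def is_singletonI order_refl singletonD)
    have "winnable wt ((\<lambda>v. D v - 1)(u := D u - 1 + 1))" using N by (simp add: extreme_def)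
    then show ?thesis by (rule winnable_mono) (use u in auto)
  qed
  then show ?thesis unfolding minimally_alive_iff eq extreme_canonical by blast
qed

section \<open>Recurrent configurations\<close>

text \<open>
A set is forbidden if all its vertices have fewer chips than edges into the set (a loop at the vertex
counted once).
\<close>
definition no_forbidden :: "'v \<Rightarrow> ('v \<Rightarrow> int) \<Rightarrow> bool" where
  "no_forbidden s c \<longleftrightarrow> (\<forall>A. A \<noteq> {} \<longrightarrow> s \<notin> A \<longrightarrow> (\<exists>v\<in>A. int (\<Sum>w\<in>A. wt v w) \<le> c v))"

text \<open>
If the fired vertex \<open>v\<close> lies in \<open>A\<close>, a witness for \<open>A - {v}\<close> receives the missing chips from \<open>v\<close>,
and if \<open>A\<close> is just \<open>{v}\<close>, then \<open>v\<close> keeps at least its loops.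
\<close>
lemma legal_fire_no_forbidden:
  assumes "legal_fire wt s c c'" "no_forbidden s c" shows "no_forbidden s c'"
  unfolding no_forbidden_def
proof (intro allI impI)
  fix A assume A: "A \<noteq> {}" "s \<notin> A"
  obtain v where v: "v \<noteq> s" "int (vdeg wt v) \<le> c v" "c' = fire wt s v c"
    using assms(1) by (auto simp: legal_fire_def)
  show "\<exists>u\<in>A. int (\<Sum>w\<in>A. wt u w) \<le> c' u"
  proof (cases "A - {v} = {}")
    case True
    then have "A = {v}" using A by auto
    then show ?thesis using v by (auto simp: fire_def)
  next
    case False
    then obtain u where u: "u \<in> A" "u \<noteq> v" "int (\<Sum>w\<in>A-{v}. wt u w) \<le> c u"
      using assms(2) A(2) unfolding no_forbidden_def by (metis DiffE insertCI Diff_iff)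
    have "(\<Sum>w\<in>A. wt u w) \<le> (\<Sum>w\<in>A-{v}. wt u w) + wt u v"
      by (cases "v \<in> A") (auto simp: sum.remove)
    then have "int (\<Sum>w\<in>A. wt u w) \<le> c u + int (wt v u)" using u(3) wt_sym[of v u] by linarith
    then have "int (\<Sum>w\<in>A. wt u w) \<le> c' u" using u(1,2) v A(2)
      by (auto simp: fire_def simp del: of_nat_sum)
    then show ?thesis using u(1) by blast
  qed
qed

text \<open>
The edges of a vertex of \<open>A\<close> split into those that stay in \<open>A\<close> and those that leave it, so the two
conditions on \<open>A\<close> are complementary in the maximal stable configuration.
\<close>
lemma superstable_iff_no_forbidden:
  assumes "c s = 0"
  shows "superstable wt s (\<lambda>v. if v = s then 0 else max_stable wt v - c v) \<longleftrightarrow>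
    stable_config wt s c \<and> no_forbidden s c"
proof -
  have split: "vdeg wt v = (\<Sum>w\<in>A. wt v w) + (\<Sum>w\<in>-A. wt v w)" for v A
    unfolding vdeg_def using sum.subset_diff[of A UNIV "wt v"] by (simp add: Compl_eq_Diff_UNIV)
  have "(max_stable wt v - c v < int (\<Sum>w\<in>-A. wt v w)) \<longleftrightarrow> int (\<Sum>w\<in>A. wt v w) \<le> c v" for v A
    unfolding max_stable_def split[of v A] by auto
  then have *: "(\<exists>v\<in>A. (if v = s then 0 else max_stable wt v - c v) < int (\<Sum>w\<in>-A. wt v w)) \<longleftrightarrow>
     (\<exists>v\<in>A. int (\<Sum>w\<in>A. wt v w) \<le> c v)" if "s \<notin> A" for A
    using that by (intro bex_cong refl) (auto simp del: of_nat_sum)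
  have sets: "(\<forall>A. A \<noteq> {} \<longrightarrow> s \<notin> A \<longrightarrow> (\<exists>v\<in>A. (if v = s then 0 else max_stable wt v - c v) < int (\<Sum>w\<in>-A. wt v w)))
      \<longleftrightarrow> no_forbidden s c"
    unfolding no_forbidden_def by (intro all_cong1 imp_cong refl) (rule *)
  have "(0 \<le> (if v = s then 0 else max_stable wt v - c v)) \<longleftrightarrow> (v \<noteq> s \<longrightarrow> c v < int (vdeg wt v))" for v
    by (auto simp: max_stable_def)
  then have "(\<forall>v. 0 \<le> (if v = s then 0 else max_stable wt v - c v)) \<longleftrightarrow> stable_config wt s c"
    unfolding stable_config_def by (intro all_cong1)
  then show ?thesis unfolding superstable_def sets by simp
qed

lemma legal_fire_rtranclp_no_forbidden:
  "(legal_fire wt s)\<^sup>*\<^sup>* c c' \<Longrightarrow> no_forbidden s c \<Longrightarrow> no_forbidden s c'"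
  by (induction rule: rtranclp_induct) (auto intro: legal_fire_no_forbidden)

text \<open>
A recurrent configuration is reached from one whose non-sink vertices all have as many chips as edges.  Such a configuration has no forbidden sets, and none arises by firing.
\<close>
lemma recurrent_imp:
  assumes "recurrent wt s c" shows "no_forbidden s c"
proof -
  define a where "a v = (if v = s then 0 else int (vdeg wt v))" for v
  have "a \<in> configs s" by (simp add: a_def configs_def)
  then obtain b where b: "\<forall>v. 0 \<le> b v" "(legal_fire wt s)\<^sup>*\<^sup>* (\<lambda>v. a v + b v) c"
    using assms unfolding recurrent_def by blast
  have "no_forbidden s (\<lambda>v. a v + b v)" unfolding no_forbidden_def
  proof (intro allI impI)
    fix A assume A: "A \<noteq> {}" "s \<notin> A"
    then obtain v where "v \<in> A" by blast
    moreover have "(\<Sum>w\<in>A. wt v w) \<le> vdeg wt v" unfolding vdeg_def by (intro sum_mono2) auto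
    moreover have "a v = int (vdeg wt v)" "0 \<le> b v" using A(2) b(1) \<open>v \<in> A\<close> by (auto simp: a_def)
    ultimately show "\<exists>v\<in>A. int (\<Sum>w\<in>A. wt v w) \<le> a v + b v"
      by (intro bexI[of _ v]) linarith+
  qed
  then show ?thesis using legal_fire_rtranclp_no_forbidden[OF b(2)] by blast
qed

text \<open>
Take a longest script among those that are realised by legal firings from \<open>x\<close>.
\<close>
lemma stabilisation:
  assumes x: "x s = 0" "\<And>v. 0 \<le> x v"
  obtains y f where "(legal_fire wt s)\<^sup>*\<^sup>* x y" "y s = 0" "\<And>v. 0 \<le> y v" "stable_config wt s y"
    "\<And>v. v \<noteq> s \<Longrightarrow> y v = x v - laplacian wt f v"
proof -
  define P where "P f \<longleftrightarrow> f s = 0 \<and> (\<forall>v. 0 \<le> f v) \<and> (\<exists>y. (legal_fire wt s)\<^sup>*\<^sup>* x y \<and> y s = 0 \<and> (\<forall>v. 0 \<le> y v) \<and>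
     (\<forall>v. v \<noteq> s \<longrightarrow> y v = x v - laplacian wt f v))" for f
  have "P (\<lambda>_. 0)" using x unfolding P_def by (auto simp: laplacian_eq_diff intro!: exI[of _ x])
  moreover have Pf: "f s = 0 \<and> (\<forall>v. 0 \<le> f v) \<and> (\<forall>v. v \<noteq> s \<longrightarrow> 0 \<le> x v - laplacian wt f v)" if "P f" for f
    using that unfolding P_def by metis
  ultimately obtain f where f: "P f" "\<And>f'. P f' \<Longrightarrow> (\<Sum>v\<in>UNIV. f' v) \<le> (\<Sum>v\<in>UNIV. f v)"
    using maximal_firing[of P "\<lambda>_. 0" s x, OF _ Pf] by blast
  from f(1) obtain y where y: "f s = 0" "\<And>v. 0 \<le> f v" "(legal_fire wt s)\<^sup>*\<^sup>* x y" "y s = 0" "\<And>v. 0 \<le> y v"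
    "\<And>v. v \<noteq> s \<Longrightarrow> y v = x v - laplacian wt f v" unfolding P_def by blast
  have "stable_config wt s y"
  proof (rule ccontr)
    assume "\<not> stable_config wt s y"
    then obtain v where v: "v \<noteq> s" "int (vdeg wt v) \<le> y v" by (auto simp: stable_config_def not_less)
    define f' where "f' u = f u + (if u = v then 1 else 0)" for u
    define z where "z = fire wt s v y"
    have "legal_fire wt s y z" using v by (auto simp: legal_fire_def z_def)
    moreover have "z s = 0" by (simp add: z_def fire_def)
    moreover have "0 \<le> z u" for u using y(5)[of u] v by (auto simp: z_def fire_def)
    moreover have "z u = x u - laplacian wt f' u" if "u \<noteq> s" for u
    proof -
      have "laplacian wt (\<lambda>u. if u = v then 1 else 0) u = (if u = v then int (vdeg wt v) else 0) - int (wt v u)"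
      proof -
        have "(\<Sum>w\<in>UNIV. int (wt u w) * (if w = v then 1 else 0)) = (\<Sum>w\<in>UNIV. if w = v then int (wt u w) else 0)"
          by (intro sum.cong) auto
        then show ?thesis by (simp add: laplacian_eq wt_sym[of v u])
      qed
      then show ?thesis using that y(6)[OF that] unfolding f'_def laplacian_add by (simp add: z_def fire_def)
    qed
    ultimately have "P f'" unfolding P_def using y(1-3) v(1)
      by (intro conjI exI[of _ z]) (auto simp: f'_def)
    then have "(\<Sum>v\<in>UNIV. f' v) \<le> (\<Sum>v\<in>UNIV. f v)" by (rule f(2))
    then show False by (simp add: f'_def sum.distrib)
  qed
  then show thesis using that y by blast
qed

text \<open>
For the converse add a large multiple of the firing of the potential to \<open>c\<close>, which exceeds any given
\<open>a\<close>, and stabilise.  The result has no forbidden set, and its complement is equivalent to that of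
\<open>c\<close> up to chips at the sink, so by uniqueness of superstable representatives it is \<open>c\<close>.
\<close>
lemma recurrent_iff:
  assumes c0: "c s = 0"
  shows "recurrent wt s c \<longleftrightarrow> superstable wt s (\<lambda>v. if v = s then 0 else max_stable wt v - c v)"
    (is "_ \<longleftrightarrow> superstable wt s ?p")
proof
  assume "recurrent wt s c"
  then show "superstable wt s ?p"
    using recurrent_imp unfolding superstable_iff_no_forbidden[of c s, OF c0] recurrent_def by blast
next
  assume p: "superstable wt s ?p"
  then have c: "stable_config wt s c" "no_forbidden s c" using superstable_iff_no_forbidden[of c s, OF c0] by auto
  have cnn: "0 \<le> c v" for v
  proof (cases "v = s")
    case False
    then have "int (\<Sum>w\<in>{v}. wt v w) \<le> c v" using c(2) unfolding no_forbidden_def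
      by (metis insert_not_empty singletonD)
    then show ?thesis by simp
  qed (use c0 in simp)
  obtain g :: "'v \<Rightarrow> int" where g: "\<And>v. v \<noteq> s \<Longrightarrow> laplacian wt g v \<le> -1" "\<And>v. 0 \<le> g v" "\<And>v. g v \<le> g s"
    using positive_potential[of s] by blast
  have "\<exists>b\<in>configs s. (\<forall>v. 0 \<le> b v) \<and> (legal_fire wt s)\<^sup>*\<^sup>* (\<lambda>v. a v + b v) c" if a: "a \<in> configs s" for a
  proof -
    define m where "m = (\<Sum>v\<in>UNIV. \<bar>a v\<bar> + int (vdeg wt v))"
    have m: "\<bar>a v\<bar> + int (vdeg wt v) \<le> m" for v unfolding m_def by (rule member_le_sum) auto
    then have m0: "0 \<le> m" by (meson abs_ge_zero add_nonneg_nonneg of_nat_0_le_iff order_trans)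
    define x where "x v = (if v = s then 0 else c v - laplacian wt (\<lambda>u. m * g u) v)" for v
    have x: "\<bar>a v\<bar> + int (vdeg wt v) \<le> x v" if "v \<noteq> s" for v
      using m[of v] mult_left_mono[OF g(1)[OF that] m0] cnn[of v] that by (simp add: x_def laplacian_scale)
    have x0: "x s = 0" by (simp add: x_def)
    have xnn: "0 \<le> x v" for v using x[of v] x0 by (cases "v = s") auto
    obtain y f where y: "(legal_fire wt s)\<^sup>*\<^sup>* x y" "y s = 0" "\<And>v. 0 \<le> y v" "stable_config wt s y"
      "\<And>v. v \<noteq> s \<Longrightarrow> y v = x v - laplacian wt f v" using stabilisation[of x s, OF x0 xnn] by blast
    have "no_forbidden s x" unfolding no_forbidden_def
    proof (intro allI impI)
      fix A assume A: "A \<noteq> {}" "s \<notin> A"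
      then obtain v where "v \<in> A" by blast
      moreover have "(\<Sum>w\<in>A. wt v w) \<le> vdeg wt v" unfolding vdeg_def by (intro sum_mono2) auto
      moreover have "int (vdeg wt v) \<le> x v" using A(2) x[of v] \<open>v \<in> A\<close> by (cases "v = s") auto
      ultimately show "\<exists>v\<in>A. int (\<Sum>w\<in>A. wt v w) \<le> x v"
        by (intro bexI[of _ v]) linarith+
    qed
    then have "no_forbidden s y" using legal_fire_rtranclp_no_forbidden[OF y(1)] by blast
    then have q: "superstable wt s (\<lambda>v. if v = s then 0 else max_stable wt v - y v)" (is "superstable wt s ?q")
      using superstable_iff_no_forbidden[of y s, OF y(2)] y(4) by blast
    define h where "h v = m * g v + f v" for v
    have h: "?q v - ?p v = laplacian wt h v" if "v \<noteq> s" for v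
      using that y(5)[OF that] by (simp add: h_def[abs_def] laplacian_add x_def)
    have "lin_equiv wt (?q(s := laplacian wt h s)) (?p(s := 0))" unfolding lin_equiv_iff
    proof (intro exI[of _ h] allI)
      fix v show "(?q(s := laplacian wt h s)) v - (?p(s := 0)) v = laplacian wt h v"
        using h[of v] by (cases "v = s") auto
    qed
    then have "?q = ?p" using superstable_unique[OF q p] by blast
    then have "y v = c v" for v using fun_cong[of ?q ?p v] y(2) c0 by (cases "v = s") auto
    then have "y = c" by auto
    moreover have "(\<lambda>v. x v - a v) \<in> configs s" using a x0 by (simp add: configs_def)
    moreover have "0 \<le> x v - a v" for v using x[of v] x0 a by (cases "v = s") (auto simp: configs_def)
    ultimately show ?thesis using y(1) by (intro bexI[of _ "\<lambda>v. x v - a v"]) auto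
  qed
  moreover have "c \<in> configs s" using c0 by (simp add: configs_def)
  ultimately show "recurrent wt s c" unfolding recurrent_def using cnn c(1) by (intro conjI ballI allI) assumption+
qed

lemma minimal_recurrent_iff:
  "minimal_recurrent wt s c \<longleftrightarrow> c s = 0 \<and>
     superstable wt s (\<lambda>v. if v = s then 0 else max_stable wt v - c v) \<and>
     div_degree (\<lambda>v. if v = s then 0 else max_stable wt v - c v) = genus_minus_one wt + 1"
proof (cases "c s = 0")
  case False
  then show ?thesis by (simp add: minimal_recurrent_def recurrent_def configs_def)
next
  case c0: True
  define p where "p v = (if v = s then 0 else max_stable wt v - c v)" for v
  have rec: "recurrent wt s c \<longleftrightarrow> superstable wt s p"
    unfolding p_def[abs_def] by (rule recurrent_iff[of c s, OF c0])
  have rec': "recurrent wt s (c(v := c v - 1)) \<longleftrightarrow> superstable wt s (p(v := p v + 1))" if "v \<noteq> s" for v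
  proof -
    have "(c(v := c v - 1)) s = 0" using c0 that by simp
    moreover have "(\<lambda>u. if u = s then 0 else max_stable wt u - (c(v := c v - 1)) u) = p(v := p v + 1)"
      using that by (auto simp: p_def)
    ultimately show ?thesis using recurrent_iff[of "c(v := c v - 1)" s] by simp
  qed
  have "minimal_recurrent wt s c \<longleftrightarrow>
      superstable wt s p \<and> (\<forall>v. v \<noteq> s \<longrightarrow> \<not> superstable wt s (p(v := p v + 1)))"
    unfolding minimal_recurrent_def rec using rec' by simp
  also have "\<dots> \<longleftrightarrow> superstable wt s p \<and> div_degree p = genus_minus_one wt + 1"
    using superstable_maximal_iff[of s p] by (cases "superstable wt s p") simp_all
  finally show ?thesis using c0 by (simp add: p_def[abs_def])
qed

text \<open>
The complement \<open>p\<close> of a minimal recurrent configuration is superstable of the largest degree, and the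
\<open>p - s\<close> for such \<open>p\<close> represent the extreme classes, each exactly once.
\<close>
lemma bij_minimal_recurrent_extreme:
  "bij_betw (\<lambda>c. div_class wt ((\<lambda>v. if v = s then 0 else max_stable wt v - c v)(s := - 1)))
     {c. minimal_recurrent wt s c} (div_class wt ` {N. extreme wt N})"
proof -
  let ?p = "\<lambda>c v. if v = s then 0 else max_stable wt v - c v"
  show ?thesis
  proof (rule bij_betw_imageI)
    show "inj_on (\<lambda>c. div_class wt ((?p c)(s := - 1))) {c. minimal_recurrent wt s c}"
    proof (rule inj_onI)
      fix c d assume c: "c \<in> {c. minimal_recurrent wt s c}" and d: "d \<in> {c. minimal_recurrent wt s c}"
        and eq: "div_class wt ((?p c)(s := - 1)) = div_class wt ((?p d)(s := - 1))"
      have "superstable wt s (?p c)" "superstable wt s (?p d)" using c d unfolding minimal_recurrent_iff mem_Collect_eq by blast+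
      moreover have "lin_equiv wt ((?p c)(s := - 1)) ((?p d)(s := - 1))" using eq unfolding div_class_eq_iff .
      ultimately have "?p c = ?p d" by (rule superstable_unique[THEN conjunct1])
      then have "c v = d v" for v using c d fun_cong[of "?p c" "?p d" v]
        by (cases "v = s") (auto simp: minimal_recurrent_iff)
      then show "c = d" by auto
    qed
    show "(\<lambda>c. div_class wt ((?p c)(s := - 1))) ` {c. minimal_recurrent wt s c} = div_class wt ` {N. extreme wt N}"
    proof (intro subset_antisym image_subsetI; elim CollectE)
      fix c assume c: "minimal_recurrent wt s c"
      then have p: "superstable wt s (?p c)" "div_degree (?p c) = genus_minus_one wt + 1" unfolding minimal_recurrent_iff by blast+
      have "extreme wt ((?p c)(s := -1))"
        unfolding extreme_iff_superstable[OF p(1) lin_equiv_refl] using p(2) by blast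
      then show "div_class wt ((?p c)(s := - 1)) \<in> div_class wt ` {N. extreme wt N}" by (intro imageI CollectI)
    next
      fix N assume N: "extreme wt N"
      obtain p k where p: "superstable wt s p" "lin_equiv wt (p(s := k)) N" by (rule superstable_exists)
      have k: "k = -1" "div_degree p = genus_minus_one wt + 1" using extreme_iff_superstable[OF p] N by auto
      define c where "c v = (if v = s then 0 else max_stable wt v - p v)" for v
      have pc: "?p c = p" using p(1) by (auto simp: c_def superstable_def)
      have "minimal_recurrent wt s c" unfolding minimal_recurrent_iff pc using p k by (simp add: c_def)
      moreover have "div_class wt N = div_class wt ((?p c)(s := -1))"
        unfolding pc div_class_eq_iff using p(2) k(1) lin_equiv_sym by blast
      ultimately show "div_class wt N \<in> (\<lambda>c. div_class wt ((?p c)(s := - 1))) ` {c. minimal_recurrent wt s c}"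
        by (intro image_eqI[of _ _ c] CollectI)
    qed
  qed
qed

lemma extreme_exists: "\<exists>N. extreme wt N"
  using finite_imp_inj_to_nat_seg[of "UNIV :: 'v set"] order_div_extreme by auto

end

section \<open>Graded polynomials\<close>

abbreviation lookup where "lookup \<equiv> Poly_Mapping.lookup"
abbreviation keys where "keys \<equiv> Poly_Mapping.keys"

lemma lin_equiv_transfer:
  assumes "lin_equiv wt A B" "\<And>v. A v - B v = A' v - B' v" shows "lin_equiv wt A' B'"
  using assms unfolding lin_equiv_iff by simp

lemma exponent_div_zero: "exponent_div 0 = (\<lambda>_. 0)"
  by (simp add: exponent_div_def)

lemma exponent_div_add: "exponent_div (a + b) = (\<lambda>v. exponent_div a v + exponent_div b v)"
  by (simp add: exponent_div_def lookup_add)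

lemma homogeneous_zero [simp]: "homogeneous wt D 0"
  by (simp add: homogeneous_def)

lemma homogeneous_add:
  assumes "homogeneous wt D p" "homogeneous wt D q" shows "homogeneous wt D (p + q)"
  using assms keys_add[of p q] unfolding homogeneous_def by blast

lemma homogeneous_diff:
  assumes "homogeneous wt D p" "homogeneous wt D q" shows "homogeneous wt D (p - q)"
  using assms unfolding homogeneous_def by (auto simp: in_keys_iff lookup_minus)

lemma homogeneous_sum:
  "(\<And>i. i \<in> A \<Longrightarrow> homogeneous wt D (p i)) \<Longrightarrow> homogeneous wt D (sum p A)"
  by (induction A rule: infinite_finite_induct) (auto intro: homogeneous_add)

lemma homogeneous_mult:
  assumes "homogeneous wt A p" "homogeneous wt B q" and D: "\<And>v. A v + B v = D v"
  shows "homogeneous wt D (p * q)"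
  unfolding homogeneous_def
proof
  fix u assume "u \<in> keys (p * q)"
  then obtain a b where ab: "u = a + b" "a \<in> keys p" "b \<in> keys q" using keys_mult[of p q] by blast
  then have "lin_equiv wt (exponent_div a) A" "lin_equiv wt (exponent_div b) B"
    using assms(1,2) by (auto simp: homogeneous_def)
  then have "lin_equiv wt (\<lambda>v. exponent_div a v + exponent_div b v) (\<lambda>v. A v + B v)" by (rule lin_equiv_add)
  then show "lin_equiv wt (exponent_div u) D" by (simp add: ab(1) exponent_div_add D)
qed

text \<open>
The part of degree \<open>D\<close> for the grading by the class group.
\<close>
definition graded_part :: "('v::finite \<Rightarrow> 'v \<Rightarrow> nat) \<Rightarrow> 'v divisor \<Rightarrow> 'v mpoly \<Rightarrow> 'v mpoly" where
  "graded_part wt D p =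
    Abs_poly_mapping (\<lambda>u. if lin_equiv wt (exponent_div u) D then lookup p u else 0)"

lemma lookup_graded_part:
  "lookup (graded_part wt D p) u = (if lin_equiv wt (exponent_div u) D then lookup p u else 0)"
proof -
  have "finite {u. (if lin_equiv wt (exponent_div u) D then lookup p u else 0) \<noteq> 0}"
    by (rule finite_subset[OF _ finite_keys[of p]]) (auto simp: in_keys_iff)
  then show ?thesis unfolding graded_part_def by simp
qed

lemma homogeneous_graded_part: "homogeneous wt D (graded_part wt D p)"
  by (auto simp: homogeneous_def in_keys_iff lookup_graded_part split: if_splits)

lemma graded_part_homogeneous: "homogeneous wt D p \<Longrightarrow> graded_part wt D p = p"
  by (rule poly_mapping_eqI) (auto simp: homogeneous_def in_keys_iff lookup_graded_part)

lemma graded_part_add: "graded_part wt D (p + q) = graded_part wt D p + graded_part wt D q"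
  by (rule poly_mapping_eqI) (simp add: lookup_graded_part lookup_add)

lemma graded_part_zero [simp]: "graded_part wt D 0 = 0"
  by (rule poly_mapping_eqI) (simp add: lookup_graded_part)

lemma graded_part_sum: "graded_part wt D (sum p A) = (\<Sum>i\<in>A. graded_part wt D (p i))"
  by (induction A rule: infinite_finite_induct) (auto simp: graded_part_add)

lemma graded_part_mult:
  assumes "homogeneous wt B q" and D: "\<And>v. A v + B v = D v"
  shows "graded_part wt D (p * q) = graded_part wt A p * q"
proof -
  define r where "r = p - graded_part wt A p"
  have "lookup (r * q) u = 0" if "lin_equiv wt (exponent_div u) D" for u
  proof (rule ccontr)
    assume "lookup (r * q) u \<noteq> 0"
    then have "u \<in> keys (r * q)" by (simp add: in_keys_iff)
    then obtain a b where ab: "u = a + b" "a \<in> keys r" "b \<in> keys q" using keys_mult[of r q] by blast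
    then have "lin_equiv wt (exponent_div b) B" using assms(1) by (auto simp: homogeneous_def)
    from lin_equiv_diff[OF that this] have "lin_equiv wt (exponent_div a) A"
      by (rule lin_equiv_transfer) (simp add: ab(1) exponent_div_add flip: D)
    then show False using ab(2) by (auto simp: r_def in_keys_iff lookup_minus lookup_graded_part)
  qed
  then have "graded_part wt D (r * q) = 0" by (intro poly_mapping_eqI) (simp add: lookup_graded_part)
  moreover have "p * q = graded_part wt A p * q + r * q" by (simp add: r_def algebra_simps)
  moreover have "graded_part wt D (graded_part wt A p * q) = graded_part wt A p * q"
    by (rule graded_part_homogeneous, rule homogeneous_mult[OF homogeneous_graded_part assms(1) D])
  ultimately show ?thesis by (simp add: graded_part_add)
qed

section \<open>The Koszul complex\<close>

definition var_exp :: "'v \<Rightarrow> ('v \<Rightarrow>\<^sub>0 nat)" where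
  "var_exp v = Poly_Mapping.single v 1"

definition var_mult :: "complex \<Rightarrow> 'v \<Rightarrow> 'v mpoly \<Rightarrow> 'v mpoly" where
  "var_mult a v p = Poly_Mapping.single (var_exp v) a * p"

lemma lookup_var_exp: "lookup (var_exp v) w = (if w = v then 1 else 0)"
  by (simp add: var_exp_def lookup_single when_def)

lemma exponent_div_var_exp: "exponent_div (var_exp v) = (\<lambda>w. if w = v then 1 else 0)"
  by (auto simp: exponent_div_def lookup_var_exp)

lemma lookup_single_mult:
  fixes p :: "'v mpoly"
  shows "lookup (Poly_Mapping.single t a * p) (t + w) = a * lookup p w"
proof -
  have "lookup (Poly_Mapping.single t a * p) (t + w) =
     (\<Sum>l. (a * (\<Sum>q. (lookup p q when t + w = l + q))) when t = l)"
    by (simp add: lookup_mult lookup_single when_mult)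
  also have "\<dots> = a * (\<Sum>q. (lookup p q when w = q))" by (simp add: Sum_any_when_equal')
  finally show ?thesis by (simp add: Sum_any_when_equal')
qed

lemma var_exp_decomp: "lookup u v > 0 \<Longrightarrow> u = var_exp v + (u - var_exp v)"
  by (rule poly_mapping_eqI) (simp add: lookup_add lookup_minus lookup_var_exp)

lemma lookup_var_mult:
  "lookup (var_mult a v p) u = (if lookup u v > 0 then a * lookup p (u - var_exp v) else 0)"
proof (cases "lookup u v > 0")
  case True
  then show ?thesis unfolding var_mult_def using lookup_single_mult[of "var_exp v" a p "u - var_exp v"]
    by (simp flip: var_exp_decomp)
next
  case False
  have "u \<notin> keys (Poly_Mapping.single (var_exp v) a * p)"
  proof
    assume "u \<in> keys (Poly_Mapping.single (var_exp v) a * p)"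
    then obtain b where "u = var_exp v + b" using keys_mult[of "Poly_Mapping.single (var_exp v) a" p]
      by (auto split: if_splits)
    then show False using False by (simp add: lookup_add lookup_var_exp)
  qed
  then show ?thesis using False by (simp add: var_mult_def in_keys_iff)
qed

lemma var_mult_zero [simp]: "var_mult a v 0 = 0"
  by (simp add: var_mult_def)

lemma var_mult_add: "var_mult a v (p + q) = var_mult a v p + var_mult a v q"
  by (simp add: var_mult_def distrib_left)

lemma var_mult_sum: "var_mult a v (sum p A) = (\<Sum>i\<in>A. var_mult a v (p i))"
  by (simp add: var_mult_def sum_distrib_left)

lemma var_mult_mult: "var_mult a v (p * q) = var_mult a v p * q"
  by (simp add: var_mult_def mult.assoc)

lemma var_mult_var_mult: "var_mult a v (var_mult b u p) = Poly_Mapping.single (var_exp v + var_exp u) (a * b) * p"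
  by (simp add: var_mult_def mult_single flip: mult.assoc)

lemma homogeneous_var_mult:
  assumes "homogeneous wt A p" and "\<And>w. A w + (if w = v then 1 else 0) = D w"
  shows "homogeneous wt D (var_mult a v p)"
  unfolding var_mult_def
  by (rule homogeneous_mult[OF _ assms(1), of "\<lambda>w. if w = v then 1 else 0"])
     (use assms(2) in \<open>auto simp: homogeneous_def exponent_div_var_exp add.commute\<close>)

definition vertex_index :: "'v::finite \<Rightarrow> nat" where
  "vertex_index = (SOME f. inj f)"

lemma inj_vertex_index: "inj (vertex_index :: 'v::finite \<Rightarrow> nat)"
proof -
  have "\<exists>f :: 'v \<Rightarrow> nat. inj f" using finite_imp_inj_to_nat_seg[of "UNIV :: 'v set"] by auto
  then show ?thesis unfolding vertex_index_def by (rule someI_ex)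
qed

text \<open>
The sign of wedging with \<open>v\<close> in the exterior algebra on the vertices, ordered by an arbitrary
numbering.
\<close>
definition wedge_sign :: "'v::finite \<Rightarrow> 'v set \<Rightarrow> complex" where
  "wedge_sign v \<sigma> = (-1) ^ card {u \<in> \<sigma>. vertex_index u < vertex_index v}"

lemma wedge_sign_square [simp]: "wedge_sign v \<sigma> * wedge_sign v \<sigma> = 1"
  unfolding wedge_sign_def by (simp flip: power_add power_mult_distrib)

lemma wedge_sign_insert:
  assumes "w \<notin> \<sigma>"
  shows "wedge_sign v (insert w \<sigma>) = (if vertex_index w < vertex_index v then - wedge_sign v \<sigma> else wedge_sign v \<sigma>)"
proof -
  have "{u \<in> insert w \<sigma>. vertex_index u < vertex_index v} =
    (if vertex_index w < vertex_index v then insert w {u \<in> \<sigma>. vertex_index u < vertex_index v}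
     else {u \<in> \<sigma>. vertex_index u < vertex_index v})" by auto
  then show ?thesis using assms by (simp add: wedge_sign_def)
qed

lemma vertex_index_cases: "u \<noteq> v \<Longrightarrow> vertex_index u < vertex_index v \<longleftrightarrow> \<not> vertex_index v < vertex_index u"
  using inj_vertex_index by (metis injD linorder_neqE_nat not_less_iff_gr_or_eq)

lemma wedge_sign_swap:
  assumes "u \<in> \<sigma>" "v \<in> \<sigma>" "u \<noteq> v"
  shows "wedge_sign u \<sigma> * wedge_sign v (\<sigma> - {u}) = - (wedge_sign v \<sigma> * wedge_sign u (\<sigma> - {v}))"
proof -
  define \<tau> where "\<tau> = \<sigma> - {u,v}"
  have \<tau>: "u \<notin> \<tau>" "v \<notin> \<tau>" "\<sigma> - {u} = insert v \<tau>" "\<sigma> - {v} = insert u \<tau>" and \<sigma>: "\<sigma> = insert u (insert v \<tau>)"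
    using assms by (auto simp: \<tau>_def)
  show ?thesis unfolding \<tau>(3,4) unfolding \<sigma>
    using \<tau>(1,2) assms(3) vertex_index_cases[OF assms(3)] by (simp add: wedge_sign_insert)
qed

text \<open>
Wedging with \<open>v\<close> anticommutes with the contraction of another vertex \<open>w\<close>.
\<close>
lemma wedge_sign_exchange:
  assumes "v \<in> \<sigma>" "w \<notin> \<sigma>"
  shows "wedge_sign v \<sigma> * wedge_sign w (insert w (\<sigma> - {v})) =
    - (wedge_sign w (insert w \<sigma>) * wedge_sign v (insert w \<sigma>))"
proof -
  define \<tau> where "\<tau> = \<sigma> - {v}"
  have \<tau>: "v \<notin> \<tau>" "w \<notin> \<tau>" "v \<noteq> w" and \<sigma>: "\<sigma> = insert v \<tau>" using assms by (auto simp: \<tau>_def)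
  show ?thesis unfolding \<tau>_def[symmetric] unfolding \<sigma>
    using \<tau> vertex_index_cases[OF \<tau>(3)] by (simp add: wedge_sign_insert)
qed

text \<open>
The Koszul differential in its cohomological form, multiplication by the element \<open>\<Sum> x\<^sub>v v\<close> of the
exterior algebra.
\<close>
definition koszul :: "('v::finite set \<Rightarrow> 'v mpoly) \<Rightarrow> 'v set \<Rightarrow> 'v mpoly" where
  "koszul c \<sigma> = (\<Sum>v\<in>\<sigma>. var_mult (wedge_sign v \<sigma>) v (c (\<sigma> - {v})))"

lemma koszul_koszul: "koszul (koszul c) \<sigma> = 0"
proof -
  define T where "T v u = var_mult (wedge_sign v \<sigma>) v (var_mult (wedge_sign u (\<sigma> - {v})) u (c (\<sigma> - {v} - {u})))" for v u
  define P where "P = {(v,u). v \<in> \<sigma> \<and> u \<in> \<sigma> \<and> u \<noteq> v}"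
  have X: "koszul (koszul c) \<sigma> = (\<Sum>(v,u)\<in>P. T v u)"
    unfolding koszul_def var_mult_sum T_def P_def by (subst sum.Sigma) (auto intro: sum.cong)
  have T: "T u v = - T v u" if "(v,u) \<in> P" for v u
  proof -
    have "wedge_sign u \<sigma> * wedge_sign v (\<sigma> - {u}) = - (wedge_sign v \<sigma> * wedge_sign u (\<sigma> - {v}))"
      using that by (intro wedge_sign_swap) (auto simp: P_def)
    moreover have "\<sigma> - {v} - {u} = \<sigma> - {u} - {v}" by auto
    ultimately show ?thesis unfolding T_def var_mult_var_mult by (simp add: add.commute single_uminus)
  qed
  have "(\<Sum>(v,u)\<in>P. T v u) = (\<Sum>(v,u)\<in>P. T u v)"
    by (rule sum.reindex_bij_witness[of _ prod.swap prod.swap]) (auto simp: P_def)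
  also have "\<dots> = - (\<Sum>(v,u)\<in>P. T v u)" unfolding sum_negf[symmetric] using T by (intro sum.cong) auto
  finally have "lookup (\<Sum>(v,u)\<in>P. T v u) w = - lookup (\<Sum>(v,u)\<in>P. T v u) w" for w
    by (metis lookup_uminus)
  then show ?thesis unfolding X by (intro poly_mapping_eqI) (simp add: equal_neg_zero)
qed

lemma koszul_add: "koszul (\<lambda>\<tau>. c \<tau> + d \<tau>) \<sigma> = koszul c \<sigma> + koszul d \<sigma>"
  by (simp add: koszul_def var_mult_add sum.distrib)

lemma koszul_mult: "koszul (\<lambda>\<tau>. c \<tau> * p) \<sigma> = koszul c \<sigma> * p"
  by (simp add: koszul_def var_mult_mult sum_distrib_right)

lemma koszul_zero [simp]: "koszul (\<lambda>\<tau>. 0) \<sigma> = 0"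
  by (simp add: koszul_def)

lemma koszul_sum: "koszul (\<lambda>\<tau>. \<Sum>i\<in>A. c i \<tau>) \<sigma> = (\<Sum>i\<in>A. koszul (c i) \<sigma>)"
  by (induction A rule: infinite_finite_induct) (auto simp: koszul_add)

lemma koszul_uminus: "koszul (\<lambda>\<tau>. - c \<tau>) \<sigma> = - koszul c \<sigma>"
  using koszul_mult[of c "-1" \<sigma>] by simp

lemma koszul_diff: "koszul (\<lambda>\<tau>. c \<tau> - d \<tau>) \<sigma> = koszul c \<sigma> - koszul d \<sigma>"
  using koszul_add[of c "\<lambda>\<tau>. - d \<tau>" \<sigma>] by (simp add: koszul_uminus)

lemma lookup_koszul_zero: "lookup (koszul c \<sigma>) 0 = 0"
  by (simp add: koszul_def lookup_sum lookup_var_mult)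

lemma lookup_koszul:
  "lookup (koszul c \<sigma>) u =
    (\<Sum>v\<in>\<sigma>. if lookup u v > 0 then wedge_sign v \<sigma> * lookup (c (\<sigma> - {v})) (u - var_exp v) else 0)"
  by (simp add: koszul_def lookup_sum lookup_var_mult)

text \<open>
The Koszul complex splits into pieces on which the integer vector \<open>u - 1\<^sub>\<sigma>\<close> is constant.  A vertex
where this vector is not \<open>-1\<close> contracts its piece.  The choice depends only on the piece, and it
fails to exist only for \<open>\<sigma> = UNIV\<close> and \<open>u = 0\<close>.
\<close>
definition free_vertex :: "'v set \<Rightarrow> ('v \<Rightarrow>\<^sub>0 nat) \<Rightarrow> 'v" where
  "free_vertex \<sigma> u = (SOME v. v \<notin> \<sigma> \<or> lookup u v > 0)"

text \<open>
Contraction with the chosen vertex, together with division by its variable.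
\<close>
definition koszul_homotopy :: "('v::finite set \<Rightarrow> 'v mpoly) \<Rightarrow> 'v set \<Rightarrow> 'v mpoly" where
  "koszul_homotopy c \<sigma> = Abs_poly_mapping (\<lambda>u. let v = free_vertex \<sigma> u in
     if v \<in> \<sigma> then 0 else wedge_sign v (insert v \<sigma>) * lookup (c (insert v \<sigma>)) (u + var_exp v))"

lemma lookup_koszul_homotopy:
  "lookup (koszul_homotopy c \<sigma>) u = (let v = free_vertex \<sigma> u in
     if v \<in> \<sigma> then 0 else wedge_sign v (insert v \<sigma>) * lookup (c (insert v \<sigma>)) (u + var_exp v))"
proof -
  have "finite {u. (let v = free_vertex \<sigma> u in
     if v \<in> \<sigma> then 0 else wedge_sign v (insert v \<sigma>) * lookup (c (insert v \<sigma>)) (u + var_exp v)) \<noteq> 0}" (is "finite ?S")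
  proof (rule finite_subset)
    show "?S \<subseteq> (\<Union>v. (\<lambda>w. w - var_exp v) ` keys (c (insert v \<sigma>)))"
    proof
      fix u assume "u \<in> ?S"
      then have "u + var_exp (free_vertex \<sigma> u) \<in> keys (c (insert (free_vertex \<sigma> u) \<sigma>))"
        by (auto simp: Let_def in_keys_iff split: if_splits)
      then show "u \<in> (\<Union>v. (\<lambda>w. w - var_exp v) ` keys (c (insert v \<sigma>)))"
        by (intro UN_I[of "free_vertex \<sigma> u"] image_eqI[of _ _ "u + var_exp (free_vertex \<sigma> u)"]) auto
    qed
  qed auto
  then show ?thesis unfolding koszul_homotopy_def by simp
qed

text \<open>
For a cocycle, \<open>\<delta> h = 1\<close> away from the monomial \<open>1\<close> at the full vertex set, where the cochain
is assumed to vanish.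
\<close>
lemma koszul_exact:
  assumes cocycle: "\<And>\<sigma>. koszul c \<sigma> = 0" and top: "lookup (c UNIV) 0 = 0"
  shows "koszul (koszul_homotopy c) \<sigma> = c \<sigma>"
proof (rule poly_mapping_eqI)
  fix u
  show "lookup (koszul (koszul_homotopy c) \<sigma>) u = lookup (c \<sigma>) u"
  proof (cases "\<sigma> = UNIV \<and> u = 0")
    case True then show ?thesis using top by (simp add: lookup_koszul_zero)
  next
    case False
    then have "\<exists>v. v \<notin> \<sigma> \<or> lookup u v > 0" by (auto simp: poly_mapping_eq_iff fun_eq_iff)
    define v0 where "v0 = free_vertex \<sigma> u"
    have v0: "v0 \<notin> \<sigma> \<or> lookup u v0 > 0" unfolding v0_def free_vertex_def by (rule someI_ex) fact
    have free: "free_vertex (\<sigma> - {v}) (u - var_exp v) = v0" if "v \<in> \<sigma>" "lookup u v > 0" for v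
    proof -
      have "(w \<notin> \<sigma> - {v} \<or> lookup (u - var_exp v) w > 0) \<longleftrightarrow> (w \<notin> \<sigma> \<or> lookup u w > 0)" for w
        using that by (auto simp: lookup_minus lookup_var_exp)
      then show ?thesis unfolding v0_def free_vertex_def by simp
    qed
    have L: "lookup (koszul (koszul_homotopy c) \<sigma>) u =
      (\<Sum>v\<in>\<sigma>. if lookup u v > 0 then wedge_sign v \<sigma> * (if v0 \<in> \<sigma> - {v} then 0 else
         wedge_sign v0 (insert v0 (\<sigma> - {v})) * lookup (c (insert v0 (\<sigma> - {v}))) (u - var_exp v + var_exp v0)) else 0)"
      unfolding lookup_koszul lookup_koszul_homotopy using free by (intro sum.cong) (auto simp: Let_def)
    show ?thesis
    proof (cases "v0 \<in> \<sigma>")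
      case True
      then have u: "lookup u v0 > 0" using v0 by simp
      have "lookup (koszul (koszul_homotopy c) \<sigma>) u = (\<Sum>v\<in>\<sigma>. if v = v0 then lookup (c \<sigma>) u else 0)"
        unfolding L
      proof (intro sum.cong refl)
        fix v assume v: "v \<in> \<sigma>"
        show "(if lookup u v > 0 then wedge_sign v \<sigma> * (if v0 \<in> \<sigma> - {v} then 0 else
         wedge_sign v0 (insert v0 (\<sigma> - {v})) * lookup (c (insert v0 (\<sigma> - {v}))) (u - var_exp v + var_exp v0)) else 0) =
         (if v = v0 then lookup (c \<sigma>) u else 0)"
        proof (cases "v = v0")
          case True
          have "u - var_exp v0 + var_exp v0 = u" using var_exp_decomp[OF u] by (simp add: add.commute)
          then show ?thesis using True v u by (simp add: insert_absorb flip: mult.assoc)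
        next
          case False then show ?thesis using \<open>v0 \<in> \<sigma>\<close> by simp
        qed
      qed
      then show ?thesis using True by simp
    next
      case False
      define \<epsilon> where "\<epsilon> = wedge_sign v0 (insert v0 \<sigma>)"
      have u0: "lookup (u + var_exp v0) v0 > 0" by (simp add: lookup_add lookup_var_exp)
      have "0 = \<epsilon> * lookup (koszul c (insert v0 \<sigma>)) (u + var_exp v0)" using cocycle by simp
      also have "\<dots> = \<epsilon> * (\<epsilon> * lookup (c \<sigma>) u +
         (\<Sum>v\<in>\<sigma>. if lookup (u + var_exp v0) v > 0 then wedge_sign v (insert v0 \<sigma>) *
            lookup (c (insert v0 \<sigma> - {v})) (u + var_exp v0 - var_exp v) else 0))"
        unfolding lookup_koszul \<epsilon>_def using False u0 by (subst sum.insert) auto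
      also have "\<dots> = lookup (c \<sigma>) u +
         (\<Sum>v\<in>\<sigma>. if lookup (u + var_exp v0) v > 0 then \<epsilon> * wedge_sign v (insert v0 \<sigma>) *
            lookup (c (insert v0 \<sigma> - {v})) (u + var_exp v0 - var_exp v) else 0)"
        by (simp add: \<epsilon>_def distrib_left sum_distrib_left if_distrib[of "\<lambda>x. wedge_sign v0 (insert v0 \<sigma>) * x"] flip: mult.assoc cong: if_cong)
      also have "(\<Sum>v\<in>\<sigma>. if lookup (u + var_exp v0) v > 0 then \<epsilon> * wedge_sign v (insert v0 \<sigma>) *
            lookup (c (insert v0 \<sigma> - {v})) (u + var_exp v0 - var_exp v) else 0) =
         - lookup (koszul (koszul_homotopy c) \<sigma>) u"
        unfolding L sum_negf[symmetric]
      proof (intro sum.cong refl)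
        fix v assume v: "v \<in> \<sigma>"
        then have ne: "v \<noteq> v0" using False by auto
        have pos: "lookup (u + var_exp v0) v > 0 \<longleftrightarrow> lookup u v > 0" using ne by (simp add: lookup_add lookup_var_exp)
        have "wedge_sign v \<sigma> * wedge_sign v0 (insert v0 (\<sigma> - {v})) = - (\<epsilon> * wedge_sign v (insert v0 \<sigma>))"
          unfolding \<epsilon>_def by (rule wedge_sign_exchange[OF v False])
        moreover have "insert v0 \<sigma> - {v} = insert v0 (\<sigma> - {v})" using ne by auto
        moreover have "u + var_exp v0 - var_exp v = u - var_exp v + var_exp v0" if "lookup u v > 0"
          using that ne by (intro poly_mapping_eqI) (auto simp: lookup_add lookup_minus lookup_var_exp)
        ultimately show "(if lookup (u + var_exp v0) v > 0 then \<epsilon> * wedge_sign v (insert v0 \<sigma>) *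
            lookup (c (insert v0 \<sigma> - {v})) (u + var_exp v0 - var_exp v) else 0) =
           - (if lookup u v > 0 then wedge_sign v \<sigma> * (if v0 \<in> \<sigma> - {v} then 0 else
         wedge_sign v0 (insert v0 (\<sigma> - {v})) * lookup (c (insert v0 (\<sigma> - {v}))) (u - var_exp v + var_exp v0)) else 0)"
          unfolding pos using False by (simp flip: mult.assoc)
      qed
      finally show ?thesis by simp
    qed
  qed
qed

lemma koszul_homotopy_zero:
  assumes "\<And>v. v \<notin> \<sigma> \<Longrightarrow> c (insert v \<sigma>) = 0" shows "koszul_homotopy c \<sigma> = 0"
  using assms by (intro poly_mapping_eqI) (simp add: lookup_koszul_homotopy Let_def)

text \<open>
The degree of the value at \<open>\<sigma>\<close> of a cochain of total degree \<open>D\<close>, normalised so that it is \<open>D\<close> at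
the full vertex set.
\<close>
definition cochain_degree :: "'v divisor \<Rightarrow> 'v set \<Rightarrow> 'v divisor" where
  "cochain_degree D \<sigma> v = D v - 1 + (if v \<in> \<sigma> then 1 else 0)"

lemma homogeneous_koszul:
  assumes "\<And>\<tau>. homogeneous wt (\<lambda>v. cochain_degree D \<tau> v - g v) (c \<tau>)"
  shows "homogeneous wt (\<lambda>v. cochain_degree D \<sigma> v - g v) (koszul c \<sigma>)"
  unfolding koszul_def
proof (rule homogeneous_sum)
  fix v assume "v \<in> \<sigma>"
  then show "homogeneous wt (\<lambda>v. cochain_degree D \<sigma> v - g v) (var_mult (wedge_sign v \<sigma>) v (c (\<sigma> - {v})))"
    by (intro homogeneous_var_mult[OF assms]) (auto simp: cochain_degree_def)
qed

lemma homogeneous_koszul_homotopy: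
  assumes "\<And>\<tau>. homogeneous wt (\<lambda>v. cochain_degree D \<tau> v - g v) (c \<tau>)"
  shows "homogeneous wt (\<lambda>v. cochain_degree D \<sigma> v - g v) (koszul_homotopy c \<sigma>)"
  unfolding homogeneous_def
proof
  fix u assume u: "u \<in> keys (koszul_homotopy c \<sigma>)"
  define v where "v = free_vertex \<sigma> u"
  have v: "v \<notin> \<sigma>" "u + var_exp v \<in> keys (c (insert v \<sigma>))"
    using u unfolding v_def by (auto simp: in_keys_iff lookup_koszul_homotopy Let_def split: if_splits)
  then have "lin_equiv wt (exponent_div (u + var_exp v)) (\<lambda>w. cochain_degree D (insert v \<sigma>) w - g w)"
    using assms unfolding homogeneous_def by blast
  then show "lin_equiv wt (exponent_div u) (\<lambda>v. cochain_degree D \<sigma> v - g v)"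
    by (rule lin_equiv_transfer) (use v(1) in \<open>auto simp: exponent_div_add exponent_div_var_exp cochain_degree_def\<close>)
qed

section \<open>Comparing a resolution with the Koszul complex\<close>

lemma lookup_mult_irrelevant:
  fixes p q :: "'v mpoly"
  assumes "lookup q 0 = 0" shows "lookup (p * q) 0 = 0"
proof (rule ccontr)
  assume "lookup (p * q) 0 \<noteq> 0"
  then have "0 \<in> keys (p * q)" by (simp add: in_keys_iff)
  then obtain a b where "0 = a + b" "b \<in> keys q" using keys_mult[of p q] by blast
  then have "b = 0" by (metis add_is_0 lookup_add lookup_zero poly_mapping_eqI)
  then show False using \<open>b \<in> keys q\<close> assms by (simp add: in_keys_iff)
qed

definition matrix_map :: "(nat \<Rightarrow> nat) \<Rightarrow> (nat \<Rightarrow> nat \<Rightarrow> nat \<Rightarrow> 'v mpoly) \<Rightarrow> nat \<Rightarrow> (nat \<Rightarrow> 'v mpoly) \<Rightarrow> nat \<Rightarrow> 'v mpoly" where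
  "matrix_map rk M i f = (\<lambda>j. if j < rk i then \<Sum>k<rk (Suc i). f k * M i j k else 0)"

definition vkoszul :: "('v::finite set \<Rightarrow> nat \<Rightarrow> 'v mpoly) \<Rightarrow> 'v set \<Rightarrow> nat \<Rightarrow> 'v mpoly" where
  "vkoszul c \<sigma> k = koszul (\<lambda>\<tau>. c \<tau> k) \<sigma>"

lemma vkoszul_vkoszul: "vkoszul (vkoszul c) \<sigma> k = 0"
  unfolding vkoszul_def by (rule koszul_koszul)

text \<open>
A minimal graded free resolution, as matrices.  The resolved module does not occur: it is the cokernel
of the map into term \<open>0\<close>, so exactness starts at term \<open>1\<close>.
\<close>
locale minimal_exact_complex =
  fixes wt :: "'v::finite \<Rightarrow> 'v \<Rightarrow> nat" and rk :: "nat \<Rightarrow> nat" and gd :: "nat \<Rightarrow> nat \<Rightarrow> 'v divisor"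
    and M :: "nat \<Rightarrow> nat \<Rightarrow> nat \<Rightarrow> 'v mpoly"
  assumes mat_homogeneous: "\<lbrakk>j < rk i; k < rk (Suc i)\<rbrakk> \<Longrightarrow> homogeneous wt (\<lambda>v. gd (Suc i) k v - gd i j v) (M i j k)"
    and mat_irrelevant: "\<lbrakk>j < rk i; k < rk (Suc i)\<rbrakk> \<Longrightarrow> lookup (M i j k) 0 = 0"
    and exact: "\<lbrakk>f \<in> free_module (rk (Suc i)); matrix_map rk M i f = (\<lambda>_. 0)\<rbrakk> \<Longrightarrow>
        \<exists>g \<in> free_module (rk (Suc (Suc i))). f = matrix_map rk M (Suc i) g"
    and complex: "g \<in> free_module (rk (Suc (Suc i))) \<Longrightarrow> matrix_map rk M i (matrix_map rk M (Suc i) g) = (\<lambda>_. 0)"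
begin

abbreviation dif where "dif \<equiv> matrix_map rk M"

lemma dif_free: "dif i f \<in> free_module (rk i)"
  by (simp add: free_module_def matrix_map_def)

lemma dif_add: "dif i (\<lambda>k. f k + g k) j = dif i f j + dif i g j"
  by (simp add: matrix_map_def distrib_right sum.distrib)

lemma dif_diff: "dif i (\<lambda>k. f k - g k) j = dif i f j - dif i g j"
  by (simp add: matrix_map_def left_diff_distrib sum_subtractf)

lemma dif_zero [simp]: "dif i (\<lambda>_. 0) = (\<lambda>_. 0)"
  by (auto simp: matrix_map_def)

lemma dif_mult: "dif i (\<lambda>k. f k * p) j = dif i f j * p"
  by (simp add: matrix_map_def sum_distrib_left mult_ac)

lemma lookup_dif: "lookup (dif i f j) 0 = 0"
  by (auto simp: matrix_map_def lookup_sum intro!: sum.neutral lookup_mult_irrelevant mat_irrelevant)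

lemma vkoszul_dif: "vkoszul (\<lambda>\<tau>. dif i (c \<tau>)) \<sigma> = dif i (vkoszul c \<sigma>)"
  by (auto simp: vkoszul_def matrix_map_def koszul_sum koszul_mult fun_eq_iff)

lemma homogeneous_dif:
  assumes "\<And>k. homogeneous wt (\<lambda>v. T v - gd (Suc i) k v) (f k)"
  shows "homogeneous wt (\<lambda>v. T v - gd i j v) (dif i f j)"
  unfolding matrix_map_def
  by (auto intro!: homogeneous_sum homogeneous_mult[OF assms mat_homogeneous])

text \<open>
The differential preserves degrees, so discarding the parts of the wrong degree from a preimage does
not change its image.
\<close>
lemma homogeneous_lift:
  assumes hom: "\<And>j. homogeneous wt (\<lambda>v. T v - gd i j v) (dif i g j)" and g: "g \<in> free_module (rk (Suc i))"
  obtains g' where "g' \<in> free_module (rk (Suc i))" "dif i g' = dif i g"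
    "\<And>k. homogeneous wt (\<lambda>v. T v - gd (Suc i) k v) (g' k)"
proof
  define g' where "g' k = graded_part wt (\<lambda>v. T v - gd (Suc i) k v) (g k)" for k
  show "g' \<in> free_module (rk (Suc i))" using g by (simp add: g'_def free_module_def)
  show "homogeneous wt (\<lambda>v. T v - gd (Suc i) k v) (g' k)" for k
    unfolding g'_def by (rule homogeneous_graded_part)
  show "dif i g' = dif i g"
  proof
    fix j
    show "dif i g' j = dif i g j"
    proof (cases "j < rk i")
      case True
      have "graded_part wt (\<lambda>v. T v - gd i j v) (g k * M i j k) = g' k * M i j k" if "k < rk (Suc i)" for k
        unfolding g'_def by (rule graded_part_mult[OF mat_homogeneous[OF True that]]) simp
      then have "dif i g' j = graded_part wt (\<lambda>v. T v - gd i j v) (dif i g j)"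
        using True by (simp add: matrix_map_def graded_part_sum)
      then show ?thesis by (simp add: graded_part_homogeneous[OF hom])
    qed (simp add: matrix_map_def)
  qed
qed

text \<open>
Koszul cochains of degree \<open>q\<close> with values in term \<open>i\<close>, of total degree \<open>D\<close>.
\<close>
definition vcochain :: "nat \<Rightarrow> nat \<Rightarrow> 'v divisor \<Rightarrow> ('v set \<Rightarrow> nat \<Rightarrow> 'v mpoly) \<Rightarrow> bool" where
  "vcochain q i D c \<longleftrightarrow> (\<forall>\<sigma>. card \<sigma> \<noteq> q \<longrightarrow> c \<sigma> = (\<lambda>_. 0)) \<and> (\<forall>\<sigma>. c \<sigma> \<in> free_module (rk i)) \<and>
     (\<forall>\<sigma> k. homogeneous wt (\<lambda>v. cochain_degree D \<sigma> v - gd i k v) (c \<sigma> k))"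

text \<open>
One step of the staircase.  It sends a cocycle modulo the image of the differential in term \<open>i\<close> to
one in term \<open>Suc i\<close>, with the Koszul degree raised by one.
\<close>
definition link :: "nat \<Rightarrow> ('v set \<Rightarrow> nat \<Rightarrow> 'v mpoly) \<Rightarrow> ('v set \<Rightarrow> nat \<Rightarrow> 'v mpoly) \<Rightarrow> bool" where
  "link i c c' \<longleftrightarrow> (\<forall>\<sigma>. vkoszul c \<sigma> = dif i (c' \<sigma>))"

text \<open>
Coboundaries in the Koszul complex of the cokernel of the differential into term \<open>i\<close>.
\<close>
definition trivial :: "nat \<Rightarrow> ('v set \<Rightarrow> nat \<Rightarrow> 'v mpoly) \<Rightarrow> bool" where
  "trivial i c \<longleftrightarrow> (\<exists>b b'. (\<forall>\<sigma>. b \<sigma> \<in> free_module (rk i)) \<and> (\<forall>\<sigma>. b' \<sigma> \<in> free_module (rk (Suc i))) \<and>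
     (\<forall>\<sigma> k. c \<sigma> k = vkoszul b \<sigma> k + dif i (b' \<sigma>) k))"

lemma vkoszul_free: "(\<And>\<tau>. c \<tau> \<in> free_module n) \<Longrightarrow> vkoszul c \<sigma> \<in> free_module n"
  by (simp add: free_module_def vkoszul_def)

lemma vkoszul_support:
  assumes "\<And>\<tau>. card \<tau> \<noteq> q \<Longrightarrow> c \<tau> = (\<lambda>_. 0)" "card \<sigma> \<noteq> Suc q"
  shows "vkoszul c \<sigma> = (\<lambda>_. 0)"
proof
  fix k
  have "c (\<sigma> - {v}) = (\<lambda>_. 0)" if "v \<in> \<sigma>" for v
    using assms that by (metis card_Suc_Diff1 finite)
  then show "vkoszul c \<sigma> k = 0" by (simp add: vkoszul_def koszul_def)
qed

lemma vkoszul_homogeneous: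
  assumes "vcochain q i D c"
  shows "homogeneous wt (\<lambda>v. cochain_degree D \<sigma> v - gd i k v) (vkoszul c \<sigma> k)"
  unfolding vkoszul_def using assms by (intro homogeneous_koszul) (simp add: vcochain_def)

text \<open>
Values are lifted one vertex set at a time; the choice can respect the grading and the support.
\<close>
lemma lift_cochain:
  assumes c: "vcochain q i D c" and im: "\<And>\<sigma>. card \<sigma> = Suc q \<Longrightarrow> \<exists>g \<in> free_module (rk (Suc i)). vkoszul c \<sigma> = dif i g"
  shows "\<exists>c'. vcochain (Suc q) (Suc i) D c' \<and> link i c c'"
proof -
  have "\<exists>g. g \<in> free_module (rk (Suc i)) \<and> dif i g = vkoszul c \<sigma> \<and>
     (\<forall>k. homogeneous wt (\<lambda>v. cochain_degree D \<sigma> v - gd (Suc i) k v) (g k)) \<and> (card \<sigma> \<noteq> Suc q \<longrightarrow> g = (\<lambda>_. 0))" for \<sigma>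
  proof (cases "card \<sigma> = Suc q")
    case True
    then obtain g where g: "g \<in> free_module (rk (Suc i))" "vkoszul c \<sigma> = dif i g" using im by blast
    have "homogeneous wt (\<lambda>v. cochain_degree D \<sigma> v - gd i j v) (dif i g j)" for j
      using vkoszul_homogeneous[OF c, of \<sigma> j] g(2) by simp
    from homogeneous_lift[OF this g(1)] obtain g' where "g' \<in> free_module (rk (Suc i))" "dif i g' = dif i g"
      "\<And>k. homogeneous wt (\<lambda>v. cochain_degree D \<sigma> v - gd (Suc i) k v) (g' k)" by blast
    then show ?thesis using True g(2) by auto
  next
    case False
    then have "vkoszul c \<sigma> = (\<lambda>_. 0)" using c by (intro vkoszul_support) (auto simp: vcochain_def)
    then show ?thesis by (intro exI[of _ "\<lambda>_. 0"]) (simp add: free_module_def)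
  qed
  then obtain c' where c': "\<And>\<sigma>. c' \<sigma> \<in> free_module (rk (Suc i))" "\<And>\<sigma>. dif i (c' \<sigma>) = vkoszul c \<sigma>"
     "\<And>\<sigma> k. homogeneous wt (\<lambda>v. cochain_degree D \<sigma> v - gd (Suc i) k v) (c' \<sigma> k)"
     "\<And>\<sigma>. card \<sigma> \<noteq> Suc q \<longrightarrow> c' \<sigma> = (\<lambda>_. 0)" by metis
  then show ?thesis by (intro exI[of _ c']) (simp add: vcochain_def link_def)
qed

text \<open>
The Koszul differential of \<open>c'\<close> is killed by the differential of the complex, because the latter maps
it to \<open>\<delta> \<delta> c = 0\<close>.
\<close>
lemma link_up:
  assumes "link i c c'" "vcochain q (Suc i) D c'"
  shows "\<exists>c''. vcochain (Suc q) (Suc (Suc i)) D c'' \<and> link (Suc i) c' c''"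
proof (rule lift_cochain[OF assms(2)])
  fix \<sigma>
  have "vkoszul c = (\<lambda>\<tau>. dif i (c' \<tau>))" using assms(1) by (auto simp: link_def)
  then have "dif i (vkoszul c' \<sigma>) = vkoszul (vkoszul c) \<sigma>" by (simp add: vkoszul_dif)
  then have "dif i (vkoszul c' \<sigma>) = (\<lambda>_. 0)" by (auto simp: vkoszul_vkoszul)
  then show "\<exists>g\<in>free_module (rk (Suc (Suc i))). vkoszul c' \<sigma> = dif (Suc i) g"
    using assms(2) by (intro exact vkoszul_free) (auto simp: vcochain_def)
qed

definition vhomotopy :: "('v set \<Rightarrow> nat \<Rightarrow> 'v mpoly) \<Rightarrow> 'v set \<Rightarrow> nat \<Rightarrow> 'v mpoly" where
  "vhomotopy c \<sigma> k = koszul_homotopy (\<lambda>\<tau>. c \<tau> k) \<sigma>"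

lemma vkoszul_exact:
  assumes "\<And>\<sigma>. vkoszul c \<sigma> = (\<lambda>_. 0)" "\<And>k. lookup (c UNIV k) 0 = 0"
  shows "vkoszul (vhomotopy c) \<sigma> = c \<sigma>"
proof
  fix k
  have "koszul (\<lambda>\<tau>. c \<tau> k) \<sigma> = 0" for \<sigma> using assms(1)[of \<sigma>] by (metis vkoszul_def)
  then show "vkoszul (vhomotopy c) \<sigma> k = c \<sigma> k"
    unfolding vkoszul_def vhomotopy_def by (rule koszul_exact) (rule assms(2))
qed

lemma vhomotopy_free:
  assumes "\<And>\<tau>. c \<tau> \<in> free_module n" shows "vhomotopy c \<sigma> \<in> free_module n"
  using assms unfolding free_module_def vhomotopy_def by (auto intro!: koszul_homotopy_zero)

text \<open>
The image of \<open>c'\<close> under the differential of the complex is a Koszul cocycle without constant terms,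
by minimality, so it is a coboundary.
\<close>
lemma link_down:
  assumes c': "vcochain (Suc q) (Suc i) D c'" and z: "\<And>\<sigma>. dif i (vkoszul c' \<sigma>) = (\<lambda>_. 0)"
  shows "\<exists>c. vcochain q i D c \<and> link i c c'"
proof -
  define e where "e \<sigma> = dif i (c' \<sigma>)" for \<sigma>
  have "vkoszul e \<sigma> = (\<lambda>_. 0)" for \<sigma> using z unfolding e_def[abs_def] by (simp add: vkoszul_dif)
  moreover have "lookup (e UNIV k) 0 = 0" for k by (simp add: e_def lookup_dif)
  ultimately have e: "vkoszul (vhomotopy e) \<sigma> = e \<sigma>" for \<sigma> by (rule vkoszul_exact)
  have eh: "homogeneous wt (\<lambda>v. cochain_degree D \<sigma> v - gd i k v) (e \<sigma> k)" for \<sigma> k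
    unfolding e_def using c' by (intro homogeneous_dif) (simp add: vcochain_def)
  have e0: "e \<sigma> = (\<lambda>_. 0)" if "card \<sigma> \<noteq> Suc q" for \<sigma> using c' that by (simp add: vcochain_def e_def)
  have "vcochain q i D (vhomotopy e)" unfolding vcochain_def
  proof (intro conjI allI impI)
    fix \<sigma> :: "'v set" assume "card \<sigma> \<noteq> q"
    then have "e (insert v \<sigma>) = (\<lambda>_. 0)" if "v \<notin> \<sigma>" for v using that by (intro e0) simp
    then show "vhomotopy e \<sigma> = (\<lambda>_. 0)"
      unfolding vhomotopy_def by (intro ext koszul_homotopy_zero) simp
  next
    show "vhomotopy e \<sigma> \<in> free_module (rk i)" for \<sigma> by (rule vhomotopy_free) (simp add: e_def dif_free)
    show "homogeneous wt (\<lambda>v. cochain_degree D \<sigma> v - gd i k v) (vhomotopy e \<sigma> k)" for \<sigma> k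
      unfolding vhomotopy_def by (rule homogeneous_koszul_homotopy) (rule eh)
  qed
  moreover have "link i (vhomotopy e) c'" unfolding link_def using e by (simp add: e_def)
  ultimately show ?thesis by blast
qed

text \<open>
If \<open>c = \<delta> b + d b'\<close>, then \<open>c'\<close> and \<open>\<delta> b'\<close> have the same image in term \<open>i\<close>, so they differ by a
boundary.
\<close>
lemma trivial_up:
  assumes l: "link i c c'" and c': "\<And>\<sigma>. c' \<sigma> \<in> free_module (rk (Suc i))" and t: "trivial i c"
  shows "trivial (Suc i) c'"
proof -
  from t obtain b b' where b: "\<And>\<sigma>. b \<sigma> \<in> free_module (rk i)" "\<And>\<sigma>. b' \<sigma> \<in> free_module (rk (Suc i))"
     and cb: "\<And>\<sigma> k. c \<sigma> k = vkoszul b \<sigma> k + dif i (b' \<sigma>) k" unfolding trivial_def by blast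
  have ex: "\<exists>g\<in>free_module (rk (Suc (Suc i))). (\<lambda>k. c' \<sigma> k - vkoszul b' \<sigma> k) = dif (Suc i) g" for \<sigma>
  proof (rule exact)
    show "(\<lambda>k. c' \<sigma> k - vkoszul b' \<sigma> k) \<in> free_module (rk (Suc i))"
      using c' vkoszul_free[of b' _ \<sigma>, OF b(2)] by (simp add: free_module_def)
    have "c = (\<lambda>\<sigma> k. vkoszul b \<sigma> k + dif i (b' \<sigma>) k)" using cb by auto
    then have "vkoszul c \<sigma> k = vkoszul (vkoszul b) \<sigma> k + vkoszul (\<lambda>\<tau>. dif i (b' \<tau>)) \<sigma> k" for k
      by (simp add: vkoszul_def koszul_add)
    then have "dif i (c' \<sigma>) k = dif i (vkoszul b' \<sigma>) k" for k
      using l by (simp add: link_def vkoszul_vkoszul vkoszul_dif)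
    then show "dif i (\<lambda>k. c' \<sigma> k - vkoszul b' \<sigma> k) = (\<lambda>_. 0)" by (auto simp: dif_diff)
  qed
  have "\<exists>g. \<forall>\<sigma>. g \<sigma> \<in> free_module (rk (Suc (Suc i))) \<and> (\<lambda>k. c' \<sigma> k - vkoszul b' \<sigma> k) = dif (Suc i) (g \<sigma>)"
    by (intro choice allI) (use ex in blast)
  then obtain g where g: "\<And>\<sigma>. g \<sigma> \<in> free_module (rk (Suc (Suc i)))"
     "\<And>\<sigma>. (\<lambda>k. c' \<sigma> k - vkoszul b' \<sigma> k) = dif (Suc i) (g \<sigma>)" by blast
  have "c' \<sigma> k = vkoszul b' \<sigma> k + dif (Suc i) (g \<sigma>) k" for \<sigma> k
    using fun_cong[OF g(2)[of \<sigma>], of k] by (simp add: algebra_simps)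
  then show ?thesis unfolding trivial_def using b(2) g(1) by blast
qed

text \<open>
If \<open>c' = \<delta> b + d b'\<close>, then \<open>c - d b\<close> is a Koszul cocycle without constant term at the full vertex
set, so it is a coboundary.
\<close>
lemma trivial_down:
  assumes l: "link i c c'" and c: "\<And>\<sigma>. c \<sigma> \<in> free_module (rk i)" and c0: "\<And>k. lookup (c UNIV k) 0 = 0"
    and t: "trivial (Suc i) c'"
  shows "trivial i c"
proof -
  from t obtain b b' where b: "\<And>\<sigma>. b \<sigma> \<in> free_module (rk (Suc i))" "\<And>\<sigma>. b' \<sigma> \<in> free_module (rk (Suc (Suc i)))"
     and cb: "\<And>\<sigma> k. c' \<sigma> k = vkoszul b \<sigma> k + dif (Suc i) (b' \<sigma>) k" unfolding trivial_def by blast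
  define e where "e \<sigma> k = c \<sigma> k - dif i (b \<sigma>) k" for \<sigma> k
  have "vkoszul e \<sigma> k = 0" for \<sigma> k
  proof -
    have "c' \<sigma> = (\<lambda>k. vkoszul b \<sigma> k + dif (Suc i) (b' \<sigma>) k)" using cb by auto
    then have "dif i (c' \<sigma>) k = dif i (vkoszul b \<sigma>) k + dif i (dif (Suc i) (b' \<sigma>)) k"
      by (simp add: dif_add)
    then have "dif i (c' \<sigma>) k = vkoszul (\<lambda>\<tau>. dif i (b \<tau>)) \<sigma> k"
      by (simp add: complex[OF b(2)] vkoszul_dif)
    then show ?thesis using l unfolding link_def e_def[abs_def] vkoszul_def
      by (simp add: koszul_diff) (metis vkoszul_def)
  qed
  then have "vkoszul e \<sigma> = (\<lambda>_. 0)" for \<sigma> by auto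
  moreover have "lookup (e UNIV k) 0 = 0" for k by (simp add: e_def lookup_minus c0 lookup_dif)
  ultimately have e: "vkoszul (vhomotopy e) \<sigma> = e \<sigma>" for \<sigma> by (rule vkoszul_exact)
  have "c \<sigma> k = vkoszul (vhomotopy e) \<sigma> k + dif i (b \<sigma>) k" for \<sigma> k unfolding e by (simp add: e_def)
  moreover have "vhomotopy e \<sigma> \<in> free_module (rk i)" for \<sigma>
    using c dif_free by (intro vhomotopy_free) (simp add: e_def free_module_def)
  ultimately show ?thesis unfolding trivial_def using b(1) by blast
qed

text \<open>
At the full vertex set the image of either differential has no constant terms, and these are the only
obstruction.  This is where Betti numbers enter.
\<close>
lemma trivial_top_iff:
  assumes c: "\<And>\<sigma>. card \<sigma> \<noteq> card (UNIV :: 'v set) \<Longrightarrow> c \<sigma> = (\<lambda>_. 0)" and cf: "\<And>\<sigma>. c \<sigma> \<in> free_module (rk i)"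
  shows "trivial i c \<longleftrightarrow> (\<forall>k. lookup (c UNIV k) 0 = 0)"
proof
  assume "trivial i c"
  then obtain b b' where "\<And>\<sigma> k. c \<sigma> k = vkoszul b \<sigma> k + dif i (b' \<sigma>) k" unfolding trivial_def by blast
  then show "\<forall>k. lookup (c UNIV k) 0 = 0" by (simp add: lookup_add lookup_dif vkoszul_def lookup_koszul_zero)
next
  assume c0: "\<forall>k. lookup (c UNIV k) 0 = 0"
  have "vkoszul c \<sigma> = (\<lambda>_. 0)" for \<sigma>
  proof (rule vkoszul_support[OF c])
    show "card \<sigma> \<noteq> Suc (card (UNIV :: 'v set))" using card_mono[of UNIV \<sigma>] by simp
  qed
  then have "vkoszul (vhomotopy c) \<sigma> = c \<sigma>" for \<sigma> using c0 by (intro vkoszul_exact) auto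
  moreover have "vhomotopy c \<sigma> \<in> free_module (rk i)" for \<sigma> by (intro vhomotopy_free cf)
  moreover have "(\<lambda>_. 0) \<in> free_module (rk (Suc i))" by (simp add: free_module_def)
  ultimately show "trivial i c" unfolding trivial_def
    by (intro exI[of _ "vhomotopy c"] exI[of _ "\<lambda>_ _. 0"]) simp
qed

definition chain :: "nat \<Rightarrow> 'v divisor \<Rightarrow> nat \<Rightarrow> (nat \<Rightarrow> 'v set \<Rightarrow> nat \<Rightarrow> 'v mpoly) \<Rightarrow> bool" where
  "chain q D n C \<longleftrightarrow> (\<forall>i\<le>n. vcochain (q + i) i D (C i)) \<and> (\<forall>i<n. link i (C i) (C (Suc i)))"

text \<open>
The hypothesis on \<open>f\<close> says that it is a cocycle modulo the next term; the steps of \<open>link_down\<close> inherit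
it.
\<close>
lemma chain_down:
  assumes "vcochain (q + n) n D f" "\<And>i \<sigma>. n = Suc i \<Longrightarrow> dif i (vkoszul f \<sigma>) = (\<lambda>_. 0)"
  shows "\<exists>C. chain q D n C \<and> C n = f"
  using assms
proof (induction n arbitrary: f)
  case 0 then show ?case by (intro exI[of _ "\<lambda>_. f"]) (simp add: chain_def)
next
  case (Suc n)
  obtain c where c: "vcochain (q + n) n D c" "link n c f"
    using link_down[of "q + n" n D f] Suc.prems by auto
  have "dif i (vkoszul c \<sigma>) = (\<lambda>_. 0)" if "n = Suc i" for i \<sigma>
    using c(2) complex Suc.prems(1) that by (simp add: link_def vcochain_def)
  then obtain C where C: "chain q D n C" "C n = c" using Suc.IH[OF c(1)] by blast
  have "chain q D (Suc n) (C(Suc n := f))" unfolding chain_def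
  proof (intro conjI allI impI)
    fix i assume "i \<le> Suc n" then show "vcochain (q + i) i D ((C(Suc n := f)) i)"
      using C Suc.prems(1) by (cases "i = Suc n") (auto simp: chain_def)
  next
    fix i assume "i < Suc n" then show "link i ((C(Suc n := f)) i) ((C(Suc n := f)) (Suc i))"
      using C c(2) by (cases "i = n") (auto simp: chain_def)
  qed
  then show ?case by (intro exI[of _ "C(Suc n := f)"] conjI) (assumption, simp)
qed

lemma chain_up:
  assumes "vcochain q 0 D c" "vcochain (Suc q) (Suc 0) D c1" "link 0 c c1"
  shows "\<exists>C. chain q D n C \<and> C 0 = c \<and> C 1 = c1"
proof -
  have "\<exists>C. chain q D (Suc n) C \<and> C 0 = c \<and> C 1 = c1"
  proof (induction n)
    case 0
    show ?case using assms
      by (intro exI[of _ "\<lambda>i. if i = 0 then c else c1"]) (auto simp: chain_def le_Suc_eq)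
  next
    case (Suc n)
    then obtain C where C: "chain q D (Suc n) C" "C 0 = c" "C 1 = c1" by blast
    then have "link n (C n) (C (Suc n))" "vcochain (q + Suc n) (Suc n) D (C (Suc n))" by (auto simp: chain_def)
    from link_up[OF this] obtain f where f: "vcochain (Suc (q + Suc n)) (Suc (Suc n)) D f" "link (Suc n) (C (Suc n)) f" by blast
    have "chain q D (Suc (Suc n)) (C(Suc (Suc n) := f))" unfolding chain_def
    proof (intro conjI allI impI)
      fix i assume "i \<le> Suc (Suc n)" then show "vcochain (q + i) i D ((C(Suc (Suc n) := f)) i)"
        using C f(1) by (cases "i = Suc (Suc n)") (auto simp: chain_def)
    next
      fix i assume "i < Suc (Suc n)" then show "link i ((C(Suc (Suc n) := f)) i) ((C(Suc (Suc n) := f)) (Suc i))"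
        using C f(2) by (cases "i = Suc n") (auto simp: chain_def)
    qed
    then show ?case using C(2,3) by (intro exI[of _ "C(Suc (Suc n) := f)"] conjI) (assumption, simp, simp)
  qed
  then obtain C where "chain q D (Suc n) C" "C 0 = c" "C 1 = c1" by blast
  then show ?thesis by (intro exI[of _ C]) (simp add: chain_def)
qed

lemma chain_trivial_iff:
  assumes C: "chain q D n C" and card: "q + n = card (UNIV :: 'v set)"
  shows "trivial 0 (C 0) \<longleftrightarrow> trivial n (C n)"
proof -
  have "i \<le> n \<Longrightarrow> trivial 0 (C 0) \<longleftrightarrow> trivial i (C i)" for i
  proof (induction i)
    case (Suc i)
    then have l: "link i (C i) (C (Suc i))" and c: "vcochain (q + i) i D (C i)" and c': "vcochain (q + Suc i) (Suc i) D (C (Suc i))"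
      using C by (auto simp: chain_def)
    have "C i UNIV = (\<lambda>_. 0)" using c card Suc.prems by (simp add: vcochain_def)
    then have "trivial i (C i) \<longleftrightarrow> trivial (Suc i) (C (Suc i))"
      using trivial_up[OF l] trivial_down[OF l] c c' by (auto simp: vcochain_def)
    then show ?case using Suc by simp
  qed simp
  then show ?thesis by simp
qed

lemma chain_combine:
  assumes C: "chain q D n C" and C': "chain q D n C'"
  shows "chain q D n (\<lambda>i \<sigma> k. C i \<sigma> k * Poly_Mapping.single 0 a + C' i \<sigma> k * Poly_Mapping.single 0 b)"
proof -
  have hom: "homogeneous wt E (p * Poly_Mapping.single 0 a)" if "homogeneous wt E p" for E p a
    by (rule homogeneous_mult[OF that, of "\<lambda>_. 0"]) (auto simp: homogeneous_def exponent_div_zero)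
  show ?thesis unfolding chain_def
  proof (intro conjI allI impI)
    fix i assume "i \<le> n"
    then have "vcochain (q + i) i D (C i)" "vcochain (q + i) i D (C' i)" using C C' by (auto simp: chain_def)
    then show "vcochain (q + i) i D (\<lambda>\<sigma> k. C i \<sigma> k * Poly_Mapping.single 0 a + C' i \<sigma> k * Poly_Mapping.single 0 b)"
      unfolding vcochain_def free_module_def by (auto intro!: homogeneous_add hom)
  next
    fix i assume "i < n"
    then have "link i (C i) (C (Suc i))" "link i (C' i) (C' (Suc i))" using C C' by (auto simp: chain_def)
    then have l: "vkoszul (C i) \<sigma> j = dif i (C (Suc i) \<sigma>) j" "vkoszul (C' i) \<sigma> j = dif i (C' (Suc i) \<sigma>) j" for \<sigma> j
      by (simp_all add: link_def)
    have "vkoszul (\<lambda>\<sigma> k. C i \<sigma> k * Poly_Mapping.single 0 a + C' i \<sigma> k * Poly_Mapping.single 0 b) \<sigma> j =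
      vkoszul (C i) \<sigma> j * Poly_Mapping.single 0 a + vkoszul (C' i) \<sigma> j * Poly_Mapping.single 0 b" for \<sigma> j
      unfolding vkoszul_def koszul_add koszul_mult ..
    then have "vkoszul (\<lambda>\<sigma> k. C i \<sigma> k * Poly_Mapping.single 0 a + C' i \<sigma> k * Poly_Mapping.single 0 b) \<sigma> =
      dif i (\<lambda>k. C (Suc i) \<sigma> k * Poly_Mapping.single 0 a + C' (Suc i) \<sigma> k * Poly_Mapping.single 0 b)" for \<sigma>
      unfolding l by (intro ext) (simp only: dif_add dif_mult)
    then show "link i (\<lambda>\<sigma> k. C i \<sigma> k * Poly_Mapping.single 0 a + C' i \<sigma> k * Poly_Mapping.single 0 b)
       (\<lambda>\<sigma> k. C (Suc i) \<sigma> k * Poly_Mapping.single 0 a + C' (Suc i) \<sigma> k * Poly_Mapping.single 0 b)"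
      unfolding link_def by blast
  qed
qed

definition basis_cochain :: "nat \<Rightarrow> 'v set \<Rightarrow> nat \<Rightarrow> 'v mpoly" where
  "basis_cochain k \<sigma> l = (if \<sigma> = UNIV \<and> l = k then 1 else 0)"

lemma basis_chain:
  assumes k: "k < rk n" and D: "lin_equiv wt (gd n k) D" and card: "q + n = card (UNIV :: 'v set)"
  shows "\<exists>C. chain q D n C \<and> C n = basis_cochain k"
proof (rule chain_down)
  have "lin_equiv wt (exponent_div 0) (\<lambda>v. cochain_degree D UNIV v - gd n k v)"
    by (rule lin_equiv_transfer[OF D]) (simp add: exponent_div_zero cochain_degree_def)
  then have "homogeneous wt (\<lambda>v. cochain_degree D UNIV v - gd n k v) 1" by (simp add: homogeneous_def)
  then show "vcochain (q + n) n D (basis_cochain k)" unfolding vcochain_def card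
    using k by (auto simp: basis_cochain_def free_module_def)
  have "vkoszul (basis_cochain k) \<sigma> = (\<lambda>_. 0)" for \<sigma>
  proof (rule vkoszul_support)
    show "card \<sigma> \<noteq> Suc (card (UNIV :: 'v set))" using card_mono[of UNIV \<sigma>] by simp
    show "basis_cochain k \<tau> = (\<lambda>_. 0)" if "card \<tau> \<noteq> card (UNIV :: 'v set)" for \<tau> :: "'v set"
      using that by (auto simp: basis_cochain_def)
  qed
  then show "dif i (vkoszul (basis_cochain k) \<sigma>) = (\<lambda>_. 0)" for i \<sigma> by simp
qed

text \<open>
If term \<open>i\<close> is zero, every basis element of the next term is a cycle, hence a boundary, against
minimality.
\<close>
lemma rank_zero_Suc:
  assumes "rk i = 0" shows "rk (Suc i) = 0"
proof (rule ccontr)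
  assume "rk (Suc i) \<noteq> 0"
  define e where "e k = (if k = 0 then 1 else 0 :: 'v mpoly)" for k :: nat
  have "e \<in> free_module (rk (Suc i))" using \<open>rk (Suc i) \<noteq> 0\<close> by (auto simp: free_module_def e_def)
  moreover have "dif i e = (\<lambda>_. 0)" using assms by (simp add: matrix_map_def)
  ultimately obtain g where "e = dif (Suc i) g" using exact by blast
  then have "lookup (e 0) 0 = 0" by (simp add: lookup_dif)
  then show False by (simp add: e_def)
qed

end

section \<open>The toppling ideal\<close>

text \<open>
The sum of the coefficients in one degree.  As a linear form it cuts out the toppling ideal in that
degree.
\<close>
definition class_sum :: "('v::finite \<Rightarrow> 'v \<Rightarrow> nat) \<Rightarrow> 'v divisor \<Rightarrow> 'v mpoly \<Rightarrow> complex" where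
  "class_sum wt D p = (\<Sum>u\<in>keys p. if lin_equiv wt (exponent_div u) D then lookup p u else 0)"

lemma class_sum_superset:
  assumes "finite A" "keys p \<subseteq> A"
  shows "class_sum wt D p = (\<Sum>u\<in>A. if lin_equiv wt (exponent_div u) D then lookup p u else 0)"
  unfolding class_sum_def using assms by (intro sum.mono_neutral_left) (auto simp: in_keys_iff)

lemma class_sum_zero [simp]: "class_sum wt D 0 = 0"
  by (simp add: class_sum_def)

lemma class_sum_add: "class_sum wt D (p + q) = class_sum wt D p + class_sum wt D q"
proof -
  have A: "finite (keys p \<union> keys q)" by simp
  have "keys (p + q) \<subseteq> keys p \<union> keys q" by (rule keys_add)
  then have "class_sum wt D (p + q) = (\<Sum>u\<in>keys p \<union> keys q. if lin_equiv wt (exponent_div u) D then lookup (p + q) u else 0)"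
    by (rule class_sum_superset[OF A])
  moreover have "class_sum wt D p = (\<Sum>u\<in>keys p \<union> keys q. if lin_equiv wt (exponent_div u) D then lookup p u else 0)"
    by (rule class_sum_superset[OF A]) simp
  moreover have "class_sum wt D q = (\<Sum>u\<in>keys p \<union> keys q. if lin_equiv wt (exponent_div u) D then lookup q u else 0)"
    by (rule class_sum_superset[OF A]) simp
  moreover have "(\<Sum>u\<in>keys p \<union> keys q. if lin_equiv wt (exponent_div u) D then lookup (p + q) u else 0) =
      (\<Sum>u\<in>keys p \<union> keys q. if lin_equiv wt (exponent_div u) D then lookup p u else 0) +
      (\<Sum>u\<in>keys p \<union> keys q. if lin_equiv wt (exponent_div u) D then lookup q u else 0)"
    unfolding sum.distrib[symmetric] by (intro sum.cong refl) (simp add: lookup_add)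
  ultimately show ?thesis by (simp only:)
qed

lemma class_sum_single_mult:
  assumes "\<And>v. exponent_div t v + E v = D v"
  shows "class_sum wt D (Poly_Mapping.single t a * p) = a * class_sum wt E p"
proof -
  have "keys (Poly_Mapping.single t a * p) \<subseteq> (+) t ` keys p"
    using keys_mult[of "Poly_Mapping.single t a" p] by (auto split: if_splits)
  then have "class_sum wt D (Poly_Mapping.single t a * p) =
     (\<Sum>u\<in>(+) t ` keys p. if lin_equiv wt (exponent_div u) D then lookup (Poly_Mapping.single t a * p) u else 0)"
    by (intro class_sum_superset) auto
  also have "\<dots> = (\<Sum>w\<in>keys p. if lin_equiv wt (exponent_div (t + w)) D then a * lookup p w else 0)"
    by (subst sum.reindex) (auto simp: lookup_single_mult intro: sum.cong)
  also have "\<dots> = (\<Sum>w\<in>keys p. a * (if lin_equiv wt (exponent_div w) E then lookup p w else 0))"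
  proof (intro sum.cong refl)
    fix w
    have "lin_equiv wt (exponent_div (t + w)) D \<longleftrightarrow> lin_equiv wt (exponent_div w) E"
      using lin_equiv_transfer[of wt "exponent_div (t + w)" D "exponent_div w" E]
        lin_equiv_transfer[of wt "exponent_div w" E "exponent_div (t + w)" D]
      by (auto simp: exponent_div_add assms[symmetric])
    then show "(if lin_equiv wt (exponent_div (t + w)) D then a * lookup p w else 0) =
      a * (if lin_equiv wt (exponent_div w) E then lookup p w else 0)" by simp
  qed
  finally show ?thesis by (simp add: class_sum_def sum_distrib_left)
qed

lemma class_sum_var_mult:
  assumes "\<And>w. E w + (if w = v then 1 else 0) = D w"
  shows "class_sum wt D (var_mult a v p) = a * class_sum wt E p"
  unfolding var_mult_def by (rule class_sum_single_mult) (simp add: exponent_div_var_exp add.commute assms)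

lemma class_sum_const: "class_sum wt D (Poly_Mapping.single 0 a * p) = a * class_sum wt D p"
  by (rule class_sum_single_mult) (simp add: exponent_div_zero)

lemma class_sum_uminus: "class_sum wt D (- p) = - class_sum wt D p"
  using class_sum_const[of wt D "-1" p] by (simp add: single_uminus)

lemma class_sum_diff: "class_sum wt D (p - q) = class_sum wt D p - class_sum wt D q"
  using class_sum_add[of wt D p "- q"] by (simp add: class_sum_uminus)

lemma class_sum_single:
  "class_sum wt D (Poly_Mapping.single u a) = (if lin_equiv wt (exponent_div u) D then a else 0)"
  by (subst class_sum_superset[of "{u}"]) auto

lemma toppling_ideal_class_sum:
  assumes "p \<in> toppling_ideal wt" shows "class_sum wt D p = 0"
proof -
  interpret module scalar_mult by (rule module_scalar_mult)
  have "toppling_ideal wt \<subseteq> {p. class_sum wt D p = 0}" unfolding toppling_ideal_def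
  proof (rule span_minimal)
    show "subspace {p. class_sum wt D p = 0}"
      by (auto simp: subspace_def class_sum_add scalar_mult_def class_sum_const)
    show "{monomial u - monomial v |u v. (\<lambda>w. exponent_div u w - exponent_div v w) \<in> lattice_L wt} \<subseteq> {p. class_sum wt D p = 0}"
    proof clarify
      fix u v assume "(\<lambda>w. exponent_div u w - exponent_div v w) \<in> lattice_L wt"
      then have "lin_equiv wt (exponent_div u) (exponent_div v)" by (simp add: lin_equiv_def)
      then have "lin_equiv wt (exponent_div u) D \<longleftrightarrow> lin_equiv wt (exponent_div v) D"
        by (meson lin_equiv_sym lin_equiv_trans)
      then show "class_sum wt D (monomial u - monomial v) = 0"
        by (simp add: class_sum_diff monomial_def class_sum_single)
    qed
  qed
  then show ?thesis using assms by blast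
qed

text \<open>
Subtract from each monomial of \<open>p\<close> a fixed one of the same class.
\<close>
lemma toppling_idealI:
  assumes hom: "homogeneous wt D p" and cs: "class_sum wt D p = 0"
  shows "p \<in> toppling_ideal wt"
proof -
  interpret module scalar_mult by (rule module_scalar_mult)
  show ?thesis
  proof (cases "keys p = {}")
    case True
    then have "p = 0" by (metis empty_iff in_keys_iff lookup_zero poly_mapping_eqI)
    then show ?thesis unfolding toppling_ideal_def by (simp add: span_zero)
  next
    case False
    then obtain u0 where u0: "u0 \<in> keys p" by blast
    have "(\<Sum>u\<in>keys p. lookup p u) = 0"
      using cs hom unfolding class_sum_def homogeneous_def by simp
    have "p = (\<Sum>u\<in>keys p. scalar_mult (lookup p u) (monomial u - monomial u0))"
    proof (rule poly_mapping_eqI)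
      fix w
      have "lookup (scalar_mult (lookup p u) (monomial u - monomial u0)) w =
         (if u = w then lookup p u else 0) - (if u0 = w then 1 else 0) * lookup p u" for u
        using lookup_single_mult[of 0 "lookup p u" "monomial u - monomial u0" w]
        by (simp add: scalar_mult_def lookup_minus monomial_def lookup_single when_def)
      then have "lookup (\<Sum>u\<in>keys p. scalar_mult (lookup p u) (monomial u - monomial u0)) w =
         (\<Sum>u\<in>keys p. if u = w then lookup p u else 0) - (if u0 = w then 1 else 0) * (\<Sum>u\<in>keys p. lookup p u)"
        by (simp add: lookup_sum sum_subtractf sum_distrib_left)
      then show "lookup p w = lookup (\<Sum>u\<in>keys p. scalar_mult (lookup p u) (monomial u - monomial u0)) w"
        using \<open>(\<Sum>u\<in>keys p. lookup p u) = 0\<close> by (simp add: in_keys_iff)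
    qed
    moreover have "(\<Sum>u\<in>keys p. scalar_mult (lookup p u) (monomial u - monomial u0)) \<in> toppling_ideal wt"
      unfolding toppling_ideal_def
    proof (intro span_sum span_scale span_base)
      fix u assume "u \<in> keys p"
      then have "lin_equiv wt (exponent_div u) (exponent_div u0)"
        using hom u0 unfolding homogeneous_def by (meson lin_equiv_sym lin_equiv_trans)
      then show "monomial u - monomial u0 \<in> {monomial u - monomial v |u v.
          (\<lambda>w. exponent_div u w - exponent_div v w) \<in> lattice_L wt}"
        unfolding lin_equiv_def by blast
    qed
    ultimately show ?thesis by simp
  qed
qed

text \<open>
On a connected graph linear equivalence preserves the degree, so the monomial \<open>1\<close> is alone in its
class.
\<close>
lemma (in chip_firing) toppling_ideal_irrelevant:
  assumes "p \<in> toppling_ideal wt" shows "lookup p 0 = 0"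
proof -
  have "lin_equiv wt (exponent_div u) (\<lambda>_. 0) \<longleftrightarrow> u = 0" for u :: "'v \<Rightarrow>\<^sub>0 nat"
  proof
    assume "lin_equiv wt (exponent_div u) (\<lambda>_. 0)"
    then have "div_degree (exponent_div u) = div_degree (\<lambda>_::'v. 0)" by (rule div_degree_cong)
    then have "(\<Sum>v\<in>UNIV. lookup u v) = 0" by (simp add: div_degree_def exponent_div_def flip: of_nat_sum)
    then show "u = 0" by (intro poly_mapping_eqI) simp
  qed (simp add: exponent_div_zero)
  then have "class_sum wt (\<lambda>_. 0) p = (\<Sum>u\<in>keys p. if u = 0 then lookup p u else 0)"
    by (simp add: class_sum_def)
  also have "\<dots> = lookup p 0" by (simp add: in_keys_iff)
  finally show ?thesis using toppling_ideal_class_sum[OF assms] by simp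
qed

section \<open>The top Betti numbers of the toppling ideal\<close>

lemma wedge_sign_singleton [simp]: "wedge_sign v {v} = 1"
proof -
  have "{u \<in> {v}. vertex_index u < vertex_index v} = {}" by auto
  then show ?thesis by (simp only: wedge_sign_def) simp
qed

lemma wedge_sign_pair: "u \<noteq> v \<Longrightarrow> wedge_sign v {u, v} = - wedge_sign u {u, v}"
  using wedge_sign_swap[of u "{u, v}" v] by (auto simp: insert_Diff_if)

lemma unwinnable_class_sum:
  assumes "\<not> winnable wt D" shows "class_sum wt D p = 0"
proof -
  have "\<not> lin_equiv wt (exponent_div u) D" for u
    using assms unfolding winnable_def by (auto simp: exponent_div_def)
  then show ?thesis by (simp add: class_sum_def)
qed

lemma winnable_monomial:
  assumes "winnable wt D" obtains u where "lin_equiv wt (exponent_div u) D"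
proof -
  obtain E where E: "lin_equiv wt E D" "\<forall>v. 0 \<le> E v" using assms by (auto simp: winnable_def)
  have "exponent_div (Abs_poly_mapping (\<lambda>v. nat (E v))) = E" using E(2) by (simp add: exponent_div_def)
  then show thesis using that E(1) by metis
qed

text \<open>
The polynomial ring is prepended to the given resolution of the ideal, as term \<open>0\<close> with one basis
vector of degree \<open>0\<close>.  The augmented complex resolves the quotient by the ideal.
\<close>
locale toppling_resolution = chip_firing wt for wt :: "'v::finite \<Rightarrow> 'v \<Rightarrow> nat" +
  fixes R :: "'v free_complex"
  assumes res: "minimal_graded_free_resolution wt (toppling_ideal wt) R"
begin

definition rk :: "nat \<Rightarrow> nat" where "rk i = (if i = 0 then 1 else rnk R i)"
definition gd :: "nat \<Rightarrow> nat \<Rightarrow> 'v divisor" where "gd i k = (if i = 0 then (\<lambda>_. 0) else gdeg R i k)"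
definition mat :: "nat \<Rightarrow> nat \<Rightarrow> nat \<Rightarrow> 'v mpoly" where "mat i j k = (if i = 0 then gens R k else dmat R i j k)"

lemma matrix_map_0: "matrix_map rk mat 0 f = (\<lambda>j. if j = 0 then augmentation R f else 0)"
  by (auto simp: matrix_map_def augmentation_def rk_def mat_def)

lemma matrix_map_Suc: "matrix_map rk mat (Suc i) f = differential R (Suc i) f"
  by (simp add: matrix_map_def differential_def rk_def mat_def cong: if_cong)

lemma resolves: "resolves R (toppling_ideal wt)"
  using res by (simp add: minimal_graded_free_resolution_def)

lemma augmentation_image: "augmentation R ` free_module (rk 1) = toppling_ideal wt"
  using resolves by (simp add: resolves_def rk_def)

lemma kernel_0:
  "{f \<in> free_module (rk 1). augmentation R f = 0} = differential R 1 ` free_module (rk 2)"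
  using resolves unfolding resolves_def rk_def by simp

lemma kernel_Suc:
  "{f \<in> free_module (rk (Suc (Suc i))). differential R (Suc i) f = (\<lambda>_. 0)}
     = differential R (Suc (Suc i)) ` free_module (rk (Suc (Suc (Suc i))))"
  using resolves unfolding resolves_def rk_def by simp

lemma gens_irrelevant:
  assumes "k < rnk R 1" shows "lookup (gens R k) 0 = 0"
proof -
  define e where "e l = (if l = k then 1 else 0 :: 'v mpoly)" for l
  have "e \<in> free_module (rk 1)" using assms by (auto simp: free_module_def e_def rk_def)
  then have "augmentation R e \<in> toppling_ideal wt" using augmentation_image by blast
  moreover have "augmentation R e = (\<Sum>l<rnk R 1. if l = k then gens R l else 0)"
    unfolding augmentation_def e_def by (intro sum.cong) auto
  then have "augmentation R e = gens R k" using assms by simp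
  ultimately show ?thesis using toppling_ideal_irrelevant by simp
qed

sublocale minimal_exact_complex wt rk gd mat
proof
  fix i j k assume j: "j < rk i" and k: "k < rk (Suc i)"
  have graded: "graded_complex wt R" and irr: "\<forall>i \<ge> 1. \<forall>j < rnk R i. \<forall>k < rnk R (Suc i). dmat R i j k \<in> irrelevant_ideal"
    using res by (simp_all add: minimal_graded_free_resolution_def)
  show "homogeneous wt (\<lambda>v. gd (Suc i) k v - gd i j v) (mat i j k)"
    using graded j k unfolding graded_complex_def by (cases i) (simp_all add: rk_def gd_def mat_def)
  show "lookup (mat i j k) 0 = 0"
    using irr j k gens_irrelevant[of k] by (cases i) (simp_all add: rk_def mat_def irrelevant_ideal_def)
next
  fix f i assume f: "f \<in> free_module (rk (Suc i))" "matrix_map rk mat i f = (\<lambda>_. 0)"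
  show "\<exists>g\<in>free_module (rk (Suc (Suc i))). f = matrix_map rk mat (Suc i) g"
  proof (cases i)
    case 0
    then have "augmentation R f = 0" using fun_cong[OF f(2), of 0] by (simp add: matrix_map_0)
    then have "f \<in> differential R 1 ` free_module (rk 2)" using f(1) 0 unfolding kernel_0[symmetric] by simp
    then show ?thesis using 0 by (auto simp: matrix_map_Suc numeral_2_eq_2)
  next
    case (Suc i')
    then have "f \<in> {f \<in> free_module (rk (Suc (Suc i'))). differential R (Suc i') f = (\<lambda>_. 0)}"
      using f by (simp add: matrix_map_Suc)
    then show ?thesis unfolding kernel_Suc using Suc by (auto simp: matrix_map_Suc)
  qed
next
  fix g :: "nat \<Rightarrow> 'v mpoly" and i assume g: "g \<in> free_module (rk (Suc (Suc i)))"
  show "matrix_map rk mat i (matrix_map rk mat (Suc i) g) = (\<lambda>_. 0)"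
  proof (cases i)
    case 0
    then have "differential R 1 g \<in> differential R 1 ` free_module (rk 2)" using g by (simp add: numeral_2_eq_2)
    then have "augmentation R (differential R 1 g) = 0" unfolding kernel_0[symmetric] by simp
    then show ?thesis using 0 by (auto simp: matrix_map_0 matrix_map_Suc)
  next
    case (Suc i')
    then have "differential R (Suc (Suc i')) g \<in> differential R (Suc (Suc i')) ` free_module (rk (Suc (Suc (Suc i'))))"
      using g by simp
    then show ?thesis unfolding kernel_Suc[symmetric] using Suc by (simp add: matrix_map_Suc)
  qed
qed

lemma ideal_lift:
  assumes "p \<in> toppling_ideal wt"
  obtains g where "g \<in> free_module (rk (Suc 0))" "dif 0 g = (\<lambda>j. if j = 0 then p else 0)"
  using assms unfolding augmentation_image[symmetric] matrix_map_0 by auto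

lemma dif_0_ideal:
  assumes "g \<in> free_module (rk (Suc 0))" shows "dif 0 g 0 \<in> toppling_ideal wt"
  using assms unfolding augmentation_image[symmetric] matrix_map_0 by simp

lemma free_rank_1: "f \<in> free_module (rk 0) \<Longrightarrow> f = (\<lambda>j. if j = 0 then f 0 else 0)"
  by (auto simp: free_module_def rk_def)

text \<open>
With \<open>b0\<close> as value at the empty set, the given cochain and the coboundary of \<open>b0\<close> differ by homogeneous
polynomials of coefficient sum \<open>0\<close>, which lie in the ideal.
\<close>
lemma trivial_bottomI:
  assumes c: "vcochain 1 0 D c" and b0: "homogeneous wt (\<lambda>v. D v - 1) b0"
    and cs: "\<And>v. class_sum wt (cochain_degree D {v}) (c {v} 0) = class_sum wt (\<lambda>v. D v - 1) b0"
  shows "trivial 0 c"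
proof -
  define b where "b \<sigma> k = (if \<sigma> = {} \<and> k = 0 then b0 else 0)" for \<sigma> :: "'v set" and k :: nat
  have b: "b \<sigma> \<in> free_module (rk 0)" for \<sigma> by (simp add: b_def free_module_def rk_def)
  have supp: "vkoszul b \<sigma> = (\<lambda>_. 0)" if "card \<sigma> \<noteq> 1" for \<sigma>
    by (rule vkoszul_support[of 0]) (use that in \<open>auto simp: b_def\<close>)
  have "\<exists>g. g \<in> free_module (rk (Suc 0)) \<and> (\<forall>k. c \<sigma> k = vkoszul b \<sigma> k + dif 0 g k)" for \<sigma>
  proof (cases "card \<sigma> = 1")
    case False
    then show ?thesis using c supp by (intro exI[of _ "\<lambda>_. 0"]) (simp add: vcochain_def free_module_def)
  next
    case True
    then obtain v where v: "\<sigma> = {v}" by (auto simp: card_1_singleton_iff)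
    have vb: "vkoszul b {v} k = (if k = 0 then var_mult 1 v b0 else 0)" for k
      by (simp add: vkoszul_def koszul_def b_def)
    define p where "p = c {v} 0 - var_mult 1 v b0"
    have deg: "D w - 1 + (if w = v then 1 else 0) = cochain_degree D {v} w" for w by (simp add: cochain_degree_def)
    have "homogeneous wt (\<lambda>w. cochain_degree D {v} w - gd 0 0 w) (c {v} 0)" using c unfolding vcochain_def by blast
    then have "homogeneous wt (cochain_degree D {v}) (c {v} 0)" by (simp add: gd_def)
    then have "homogeneous wt (cochain_degree D {v}) p" unfolding p_def
      by (rule homogeneous_diff) (rule homogeneous_var_mult[OF b0 deg])
    moreover have "class_sum wt (cochain_degree D {v}) p = 0"
      unfolding p_def class_sum_diff class_sum_var_mult[of "\<lambda>v. D v - 1", OF deg] cs by simp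
    ultimately have "p \<in> toppling_ideal wt" by (rule toppling_idealI)
    then obtain g where g: "g \<in> free_module (rk (Suc 0))" "dif 0 g = (\<lambda>j. if j = 0 then p else 0)" by (rule ideal_lift)
    have "c {v} k = 0" if "k \<noteq> 0" for k using c that by (simp add: vcochain_def free_module_def rk_def)
    then show ?thesis using g by (intro exI[of _ g]) (simp add: v vb p_def)
  qed
  then have "\<exists>b'. \<forall>\<sigma>. b' \<sigma> \<in> free_module (rk (Suc 0)) \<and> (\<forall>k. c \<sigma> k = vkoszul b \<sigma> k + dif 0 (b' \<sigma>) k)"
    by (intro choice allI)
  then show ?thesis unfolding trivial_def using b by blast
qed

text \<open>
If \<open>D - \<one>\<close> is not winnable, there are no monomials of that degree, and coboundaries have coefficient
sum \<open>0\<close>.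
\<close>
lemma trivial_bottomD:
  assumes t: "trivial 0 c" and un: "\<not> winnable wt (\<lambda>v. D v - 1)"
  shows "class_sum wt (cochain_degree D {v}) (c {v} 0) = 0"
proof -
  obtain b b' where b': "\<And>\<sigma>. b' \<sigma> \<in> free_module (rk (Suc 0))"
    and c: "\<And>\<sigma> k. c \<sigma> k = vkoszul b \<sigma> k + dif 0 (b' \<sigma>) k" using t unfolding trivial_def by blast
  have deg: "D w - 1 + (if w = v then 1 else 0) = cochain_degree D {v} w" for w by (simp add: cochain_degree_def)
  have "vkoszul b {v} 0 = var_mult 1 v (b {} 0)" by (simp add: vkoszul_def koszul_def)
  then show ?thesis unfolding c class_sum_add toppling_ideal_class_sum[OF dif_0_ideal[OF b']]
    by (simp add: class_sum_var_mult[of "\<lambda>v. D v - 1", OF deg] unwinnable_class_sum[OF un])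
qed

text \<open>
The coboundary at \<open>{u, v}\<close> is \<open>x\<^sub>u c\<^sub>v - x\<^sub>v c\<^sub>u\<close> up to sign, and variables do not change
coefficient sums.
\<close>
lemma class_sum_pair:
  assumes "u \<noteq> v"
  shows "class_sum wt (cochain_degree D {u, v}) (vkoszul c {u, v} 0) = wedge_sign u {u, v} *
    (class_sum wt (cochain_degree D {v}) (c {v} 0) - class_sum wt (cochain_degree D {u}) (c {u} 0))"
proof -
  have d1: "cochain_degree D {v} w + (if w = u then 1 else 0) = cochain_degree D {u, v} w"
   and d2: "cochain_degree D {u} w + (if w = v then 1 else 0) = cochain_degree D {u, v} w" for w
    using assms by (auto simp: cochain_degree_def)
  have "{u, v} - {u} = {v}" "{u, v} - {v} = {u}" using assms by auto
  then have "vkoszul c {u, v} 0 = var_mult (wedge_sign u {u, v}) u (c {v} 0) + var_mult (wedge_sign v {u, v}) v (c {u} 0)"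
    using assms by (simp add: vkoszul_def koszul_def)
  then show ?thesis
    by (simp add: class_sum_add class_sum_var_mult[OF d1] class_sum_var_mult[OF d2] wedge_sign_pair[OF assms] algebra_simps)
qed

lemma chain_class_sum_eq:
  assumes "chain 1 D n C" "n > 0"
  shows "class_sum wt (cochain_degree D {u}) (C 0 {u} 0) = class_sum wt (cochain_degree D {v}) (C 0 {v} 0)"
proof (cases "u = v")
  case False
  have "link 0 (C 0) (C 1)" "1 \<le> n" "\<forall>i\<le>n. vcochain (1 + i) i D (C i)" using assms by (auto simp: chain_def)
  moreover from this have "vcochain (1 + 1) 1 D (C 1)" by blast
  ultimately have "vkoszul (C 0) {u, v} 0 \<in> toppling_ideal wt" using dif_0_ideal by (simp add: link_def vcochain_def)
  then have "wedge_sign u {u, v} *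
    (class_sum wt (cochain_degree D {v}) (C 0 {v} 0) - class_sum wt (cochain_degree D {u}) (C 0 {u} 0)) = 0"
    using toppling_ideal_class_sum by (metis class_sum_pair[OF False])
  moreover have "wedge_sign u {u, v} \<noteq> 0" by (simp add: wedge_sign_def)
  ultimately show ?thesis by simp
qed simp

lemma basis_cochain_nontrivial:
  assumes "k < rk n" shows "\<not> trivial n (basis_cochain k)"
proof
  assume "trivial n (basis_cochain k)"
  moreover have "trivial n (basis_cochain k) \<longleftrightarrow> (\<forall>l. lookup (basis_cochain k (UNIV :: 'v set) l) 0 = 0)"
    using assms by (intro trivial_top_iff) (auto simp: basis_cochain_def free_module_def)
  ultimately have "lookup (basis_cochain k (UNIV :: 'v set) k) 0 = 0" by blast
  then show False by (simp add: basis_cochain_def)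
qed

text \<open>
A basis vector in term \<open>n + 1\<close> would lead down to a polynomial \<open>m\<close> whose products with the variables
lie in the ideal.  But then \<open>m\<close> has coefficient sum \<open>0\<close> and lies in the ideal itself, so the basis
vector is trivial, against minimality.
\<close>
lemma rank_vanishes:
  assumes "i \<ge> card (UNIV :: 'v set)" shows "rk i = 0"
  using assms
proof (induction i rule: dec_induct)
  case base
  define n where "n = card (UNIV :: 'v set)"
  have n0: "n > 0" by (simp add: n_def card_gt_0_iff)
  have "rk n = 0"
  proof (rule ccontr)
    assume "rk n \<noteq> 0"
    then have k: "0 < rk n" by simp
    define D where "D = gd n 0"
    obtain C where C: "chain 0 D n C" "C n = basis_cochain 0"
      using basis_chain[OF k, of D 0] by (auto simp: n_def D_def)
    have l: "link 0 (C 0) (C 1)" and c0: "vcochain 0 0 D (C 0)" and c1: "vcochain 1 1 D (C 1)"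
      using C(1) n0 by (auto simp: chain_def Suc_le_eq dest: spec[of _ 0] spec[of _ 1])
    define m where "m = C 0 {} 0"
    obtain v :: 'v where True by simp
    have deg: "D w - 1 + (if w = v then 1 else 0) = cochain_degree D {v} w" for w by (simp add: cochain_degree_def)
    have "vkoszul (C 0) {v} 0 \<in> toppling_ideal wt" using l c1 dif_0_ideal by (simp add: link_def vcochain_def)
    moreover have "vkoszul (C 0) {v} 0 = var_mult 1 v m" by (simp add: vkoszul_def koszul_def m_def)
    ultimately have "class_sum wt (\<lambda>v. D v - 1) m = 0"
      using toppling_ideal_class_sum[of "var_mult 1 v m" wt "cochain_degree D {v}"] class_sum_var_mult[of "\<lambda>v. D v - 1", OF deg, of wt 1 m] by simp
    moreover have "homogeneous wt (\<lambda>v. cochain_degree D {} v - gd 0 0 v) m"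
      using c0 unfolding m_def vcochain_def by blast
    then have "homogeneous wt (\<lambda>v. D v - 1) m" by (simp add: gd_def cochain_degree_def)
    ultimately have "m \<in> toppling_ideal wt" by (intro toppling_idealI)
    then obtain g where g: "g \<in> free_module (rk (Suc 0))" "dif 0 g = (\<lambda>j. if j = 0 then m else 0)" by (rule ideal_lift)
    have "C 0 \<sigma> k = dif 0 (if \<sigma> = {} then g else (\<lambda>_. 0)) k" for \<sigma> k
      using c0 g(2) by (auto simp: m_def vcochain_def free_module_def rk_def)
    then have "trivial 0 (C 0)" unfolding trivial_def
      using g(1) by (intro exI[of _ "\<lambda>_ _. 0"] exI[of _ "\<lambda>\<sigma>. if \<sigma> = {} then g else (\<lambda>_. 0)"])
        (auto simp: vkoszul_def free_module_def)
    then show False using chain_trivial_iff[OF C(1)] basis_cochain_nontrivial[OF k] C(2) by (simp add: n_def)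
  qed
  then show ?case by (simp add: n_def)
next
  case (step i) then show ?case by (intro rank_zero_Suc)
qed

context
  fixes n assumes n: "Suc n = card (UNIV :: 'v set)" and n0: "n > 0"
begin

text \<open>
The staircase from a basis vector of degree \<open>D\<close> ends in a cocycle that is not a coboundary.  So no
monomial has degree \<open>D - \<one>\<close>, and the coefficient sum is not \<open>0\<close>, whence every degree \<open>D - \<one> + v\<close>
contains a monomial.
\<close>
lemma basis_degree_extreme:
  assumes k: "k < rk n" and D: "lin_equiv wt (gd n k) D"
  obtains C where "chain 1 D n C" "C n = basis_cochain k" "\<And>v. class_sum wt (cochain_degree D {v}) (C 0 {v} 0) \<noteq> 0"
    "extreme wt (\<lambda>v. D v - 1)"
proof -
  obtain C where C: "chain 1 D n C" "C n = basis_cochain k" using basis_chain[OF k D, of 1] n by auto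
  have nt: "\<not> trivial 0 (C 0)" using chain_trivial_iff[OF C(1)] basis_cochain_nontrivial[OF k] C(2) n by simp
  have c0: "vcochain 1 0 D (C 0)" using C(1) by (auto simp: chain_def dest: spec[of _ 0])
  define ls where "ls v = class_sum wt (cochain_degree D {v}) (C 0 {v} 0)" for v
  have eq: "ls u = ls v" for u v unfolding ls_def by (rule chain_class_sum_eq[OF C(1) n0])
  have nz: "ls v \<noteq> 0" for v
  proof
    assume "ls v = 0"
    then have "ls w = 0" for w using eq[of w v] by simp
    then have "trivial 0 (C 0)" by (intro trivial_bottomI[OF c0, of 0]) (auto simp: ls_def)
    with nt show False ..
  qed
  have un: "\<not> winnable wt (\<lambda>v. D v - 1)"
  proof
    assume "winnable wt (\<lambda>v. D v - 1)"
    then obtain u where u: "lin_equiv wt (exponent_div u) (\<lambda>v. D v - 1)" by (rule winnable_monomial)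
    obtain v0 :: 'v where True by simp
    have "trivial 0 (C 0)"
    proof (rule trivial_bottomI[OF c0, of "Poly_Mapping.single u (ls v0)"])
      show "homogeneous wt (\<lambda>v. D v - 1) (Poly_Mapping.single u (ls v0))" using u by (simp add: homogeneous_def)
      show "class_sum wt (cochain_degree D {v}) (C 0 {v} 0) = class_sum wt (\<lambda>v. D v - 1) (Poly_Mapping.single u (ls v0))" for v
        using u eq[of v v0] by (simp add: class_sum_single ls_def)
    qed
    with nt show False ..
  qed
  have "winnable wt ((\<lambda>v. D v - 1)(v := D v - 1 + 1))" for v
  proof (rule ccontr)
    have "(\<lambda>v. D v - 1)(v := D v - 1 + 1) = cochain_degree D {v}" by (auto simp: cochain_degree_def)
    moreover assume "\<not> winnable wt ((\<lambda>v. D v - 1)(v := D v - 1 + 1))"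
    ultimately show False using nz[of v] unwinnable_class_sum by (metis ls_def)
  qed
  then have "extreme wt (\<lambda>v. D v - 1)" using un by (simp add: extreme_def)
  then show thesis using that C nz unfolding ls_def by blast
qed

text \<open>
The staircases of two basis vectors of the same degree have a combination with coefficient sum \<open>0\<close>
at the bottom; at the top it would be a nontrivial combination of basis vectors that is trivial.
\<close>
lemma basis_degree_unique:
  assumes k: "k < rk n" "lin_equiv wt (gd n k) D" and l: "l < rk n" "lin_equiv wt (gd n l) D"
  shows "k = l"
proof (rule ccontr)
  assume "k \<noteq> l"
  obtain C where C: "chain 1 D n C" "C n = basis_cochain k" 
    by (rule basis_degree_extreme[OF k])
  obtain C' where C': "chain 1 D n C'" "C' n = basis_cochain l" "\<And>v. class_sum wt (cochain_degree D {v}) (C' 0 {v} 0) \<noteq> 0"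
    by (rule basis_degree_extreme[OF l]) blast
  obtain v0 :: 'v where True by simp
  define a where "a = class_sum wt (cochain_degree D {v0}) (C' 0 {v0} 0)"
  define b where "b = - class_sum wt (cochain_degree D {v0}) (C 0 {v0} 0)"
  define B where "B i \<sigma> m = C i \<sigma> m * Poly_Mapping.single 0 a + C' i \<sigma> m * Poly_Mapping.single 0 b" for i \<sigma> m
  have B: "chain 1 D n B" unfolding B_def[abs_def] by (rule chain_combine[OF C(1) C'(1)])
  have "class_sum wt (cochain_degree D {v0}) (B 0 {v0} 0) = 0"
    unfolding B_def class_sum_add mult.commute[of _ "Poly_Mapping.single 0 a"] mult.commute[of _ "Poly_Mapping.single 0 b"] class_sum_const
    by (simp add: a_def b_def)
  then have "class_sum wt (cochain_degree D {v}) (B 0 {v} 0) = 0" for v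
    using chain_class_sum_eq[OF B n0, of v v0] by simp
  moreover have "vcochain 1 0 D (B 0)" using B by (auto simp: chain_def dest: spec[of _ 0])
  ultimately have "trivial 0 (B 0)" by (intro trivial_bottomI[of D _ 0]) auto
  then have "trivial n (B n)" using chain_trivial_iff[OF B] n by simp
  moreover have "vcochain (1 + n) n D (B n)" using B by (auto simp: chain_def)
  then have "trivial n (B n) \<longleftrightarrow> (\<forall>m. lookup (B n UNIV m) 0 = 0)" using n by (intro trivial_top_iff) (auto simp: vcochain_def)
  ultimately have "lookup (B n UNIV k) 0 = 0" by blast
  then have "a = 0" using \<open>k \<noteq> l\<close> by (simp add: B_def C(2) C'(2) basis_cochain_def)
  then show False using C'(3) by (simp add: a_def)
qed

text \<open>
One monomial in each degree \<open>D - \<one> + v\<close> gives a cocycle that is not a coboundary.  The staircase takes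
it to an element of term \<open>n\<close> with a nonzero constant term, whose position is a basis vector of
degree \<open>D\<close>.
\<close>
lemma basis_degree_exists:
  assumes ext: "extreme wt (\<lambda>v. D v - 1)"
  shows "\<exists>k<rk n. lin_equiv wt (gd n k) D"
proof (rule ccontr)
  assume none: "\<not> (\<exists>k<rk n. lin_equiv wt (gd n k) D)"
  have "\<exists>u. lin_equiv wt (exponent_div u) (cochain_degree D {v})" for v
  proof -
    have "(\<lambda>v. D v - 1)(v := D v - 1 + 1) = cochain_degree D {v}" by (auto simp: cochain_degree_def)
    then have "winnable wt (cochain_degree D {v})" using ext unfolding extreme_def by metis
    then show ?thesis using winnable_monomial by blast
  qed
  then obtain u where u: "\<And>v. lin_equiv wt (exponent_div (u v)) (cochain_degree D {v})" by metis
  define c where "c \<sigma> k = (if card \<sigma> = 1 \<and> k = 0 then monomial (u (the_elem \<sigma>)) else 0)" for \<sigma> :: "'v set" and k :: nat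
  have c1: "c {v} 0 = monomial (u v)" for v by (simp add: c_def)
  have c: "vcochain 1 0 D c" unfolding vcochain_def
  proof (intro conjI allI impI)
    show "c \<sigma> = (\<lambda>_. 0)" if "card \<sigma> \<noteq> 1" for \<sigma> using that by (auto simp: c_def)
    show "c \<sigma> \<in> free_module (rk 0)" for \<sigma> by (simp add: c_def free_module_def rk_def)
    show "homogeneous wt (\<lambda>v. cochain_degree D \<sigma> v - gd 0 k v) (c \<sigma> k)" for \<sigma> k
      using u by (auto simp: c_def gd_def homogeneous_def monomial_def card_1_singleton_iff)
  qed
  have cs: "class_sum wt (cochain_degree D {v}) (c {v} 0) = 1" for v
    using u by (simp add: c1 monomial_def class_sum_single)
  have "\<exists>c'. vcochain (Suc 1) (Suc 0) D c' \<and> link 0 c c'"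
  proof (rule lift_cochain[OF c])
    fix \<sigma> :: "'v set" assume "card \<sigma> = Suc 1"
    then obtain x y where xy: "\<sigma> = {x, y}" "x \<noteq> y" by (auto simp: card_2_iff numeral_2_eq_2[symmetric])
    have "homogeneous wt (\<lambda>v. cochain_degree D \<sigma> v - gd 0 0 v) (vkoszul c \<sigma> 0)" by (rule vkoszul_homogeneous[OF c])
    then have "homogeneous wt (cochain_degree D \<sigma>) (vkoszul c \<sigma> 0)" by (simp add: gd_def)
    moreover have "class_sum wt (cochain_degree D \<sigma>) (vkoszul c \<sigma> 0) = 0" unfolding xy(1) class_sum_pair[OF xy(2)] cs by simp
    ultimately have "vkoszul c \<sigma> 0 \<in> toppling_ideal wt" by (rule toppling_idealI)
    then obtain g where g: "g \<in> free_module (rk (Suc 0))" "dif 0 g = (\<lambda>j. if j = 0 then vkoszul c \<sigma> 0 else 0)" by (rule ideal_lift)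
    have "vkoszul c \<sigma> = (\<lambda>j. if j = 0 then vkoszul c \<sigma> 0 else 0)"
      by (rule free_rank_1, rule vkoszul_free) (use c in \<open>simp add: vcochain_def\<close>)
    then show "\<exists>g\<in>free_module (rk (Suc 0)). vkoszul c \<sigma> = dif 0 g" using g by (intro bexI[of _ g]) simp_all
  qed
  then obtain c' where "vcochain (Suc 1) (Suc 0) D c'" "link 0 c c'" by blast
  from chain_up[OF c this] obtain C where C: "chain 1 D n C" "C 0 = c" by blast
  have top: "vcochain (1 + n) n D (C n)" using C(1) by (auto simp: chain_def)
  have "lookup (C n UNIV k) 0 = 0" for k
  proof (rule ccontr)
    assume nz: "lookup (C n UNIV k) 0 \<noteq> 0"
    have "C n UNIV \<in> free_module (rk n)" and hom: "homogeneous wt (\<lambda>v. cochain_degree D UNIV v - gd n k v) (C n UNIV k)"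
      using top unfolding vcochain_def by blast+
    then have k: "k < rk n" using nz by (cases "k < rk n") (auto simp: free_module_def)
    have "lin_equiv wt (exponent_div 0) (\<lambda>v. cochain_degree D UNIV v - gd n k v)"
      using hom nz unfolding homogeneous_def by (simp add: in_keys_iff)
    then have "lin_equiv wt (gd n k) D"
      by (rule lin_equiv_transfer) (simp add: exponent_div_zero cochain_degree_def)
    then show False using none k by blast
  qed
  then have "trivial n (C n)" using top n by (subst trivial_top_iff) (auto simp: vcochain_def)
  then have "trivial 0 c" using chain_trivial_iff[OF C(1)] C(2) n by simp
  then have "class_sum wt (cochain_degree D {v}) (c {v} 0) = 0" for v
    using ext by (intro trivial_bottomD) (simp_all add: extreme_def)
  then show False using cs by simp
qed

lemma top_betti:
  "betti wt R n (div_class wt D) = (if extreme wt (\<lambda>v. D v - 1) then 1 else 0)"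
proof -
  define K where "K = {k. k < rk n \<and> lin_equiv wt (gd n k) D}"
  have K: "betti wt R n (div_class wt D) = card K"
    using n0 by (simp add: betti_def K_def rk_def gd_def div_class_eq_iff)
  show ?thesis
  proof (cases "extreme wt (\<lambda>v. D v - 1)")
    case True
    then obtain k where k: "k \<in> K" using basis_degree_exists by (auto simp: K_def)
    have "K = {k}" using k basis_degree_unique[of k D] unfolding K_def by blast
    then show ?thesis using True K by simp
  next
    case False
    then have "k \<notin> K" for k unfolding K_def mem_Collect_eq by (metis basis_degree_extreme)
    then have "K = {}" by blast
    then show ?thesis using False K by simp
  qed
qed

text \<open>
Each class counted on the left contributes \<open>1\<close>, and subtracting \<open>\<one>\<close> maps these classes bijectively to
the extreme ones.
\<close>
lemma total_top_betti: "total_betti wt R n = card (div_class wt ` {N. extreme wt N})"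
proof -
  define A where "A = div_class wt ` {D. extreme wt (\<lambda>v. D v - 1)}"
  define sh where "sh E = (\<lambda>v. E v - 1)" for E :: "'v divisor"
  have inj: "inj sh" unfolding sh_def by (rule injI) (auto simp: fun_eq_iff)
  have "{C \<in> class_group wt. betti wt R n C \<noteq> 0} = A"
    by (auto simp: class_group_def A_def top_betti split: if_splits)
  moreover have "betti wt R n C = 1" if "C \<in> A" for C using that by (auto simp: A_def top_betti)
  ultimately have "total_betti wt R n = card A" by (simp add: total_betti_def)
  also have "\<dots> = card ((`) sh ` A)"
    by (rule card_image[symmetric]) (use inj in \<open>auto simp: inj_on_def inj_image_eq_iff\<close>)
  also have "(`) sh ` A = div_class wt ` {N. extreme wt N}"
  proof -
    have cl: "sh ` div_class wt D = div_class wt (sh D)" for D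
    proof (intro subset_antisym subsetI)
      fix E assume "E \<in> sh ` div_class wt D"
      then obtain F where F: "E = sh F" "lin_equiv wt F D" by (auto simp: div_class_def)
      have "lin_equiv wt (sh F) (sh D)" by (rule lin_equiv_transfer[OF F(2)]) (simp add: sh_def)
      then show "E \<in> div_class wt (sh D)" by (simp add: div_class_def F(1))
    next
      fix E assume "E \<in> div_class wt (sh D)"
      then have E: "lin_equiv wt E (sh D)" by (simp add: div_class_def)
      have "lin_equiv wt (\<lambda>v. E v + 1) D" by (rule lin_equiv_transfer[OF E]) (simp add: sh_def)
      then show "E \<in> sh ` div_class wt D" by (intro image_eqI[of _ _ "\<lambda>v. E v + 1"]) (simp_all add: sh_def div_class_def)
    qed
    have "sh ` {D. extreme wt (sh D)} = {N. extreme wt N}"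
    proof (intro subset_antisym subsetI)
      fix N assume "N \<in> {N. extreme wt N}"
      then show "N \<in> sh ` {D. extreme wt (sh D)}" by (intro image_eqI[of _ _ "\<lambda>v. N v + 1"]) (simp_all add: sh_def)
    qed auto
    moreover have "(`) sh ` A = div_class wt ` (sh ` {D. extreme wt (sh D)})"
      unfolding A_def sh_def[symmetric] image_image cl ..
    ultimately show ?thesis by simp
  qed
  finally show ?thesis .
qed

end

end

theorem theorem7p7:
  fixes wt :: "'v::finite \<Rightarrow> 'v \<Rightarrow> nat"
    and s :: 'v
    and R :: "'v free_complex"
    and r :: nat
  assumes "connected_multigraph wt"
    and "card (UNIV :: 'v set) \<ge> 2"
    and "r = card (UNIV :: 'v set) - 1"
    and "minimal_graded_free_resolution wt (toppling_ideal wt) R"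
  shows "total_betti wt R r \<noteq> 0 \<and> (\<forall>i > r. total_betti wt R i = 0) \<and>
    total_betti wt R r = card {c. minimal_recurrent wt s c} \<and>
    ((\<forall>v. wt v v = 0) \<longrightarrow>
       (\<forall>D. betti wt R r (div_class wt D) \<noteq> 0 \<longleftrightarrow> minimally_alive wt D)) \<and>
    (\<forall>D. minimally_alive wt D \<longrightarrow> div_degree D = int (num_edges wt))"
proof -
  interpret toppling_resolution wt R
    using assms(1,4) by unfold_locales
  have r: "Suc r = card (UNIV :: 'v set)" "r > 0" using assms(2,3) by auto
  have total: "total_betti wt R r = card {c. minimal_recurrent wt s c}"
    unfolding total_top_betti[OF r] by (rule bij_betw_same_card[OF bij_minimal_recurrent_extreme, symmetric])
  have "total_betti wt R r \<noteq> 0"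
  proof -
    obtain N where "extreme wt N" using extreme_exists by blast
    then have "extreme wt (\<lambda>v. (N v + 1) - 1)" by simp
    then have C: "div_class wt (\<lambda>v. N v + 1) \<in> class_group wt" "betti wt R r (div_class wt (\<lambda>v. N v + 1)) \<noteq> 0"
      using top_betti[OF r, of "\<lambda>v. N v + 1"] by (simp_all add: class_group_def)
    have "{C \<in> class_group wt. betti wt R r C \<noteq> 0} \<subseteq> (\<lambda>k. div_class wt (gdeg R r k)) ` {..<rnk R r}"
    proof clarify
      fix C assume "betti wt R r C > 0"
      then have "{k. k < rnk R r \<and> div_class wt (gdeg R r k) = C} \<noteq> {}" unfolding betti_def by (metis card.empty less_irrefl)
      then show "C \<in> (\<lambda>k. div_class wt (gdeg R r k)) ` {..<rnk R r}" by blast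
    qed
    then have "finite {C \<in> class_group wt. betti wt R r C \<noteq> 0}" by (rule finite_subset) simp
    then show ?thesis using C unfolding total_betti_def by (subst sum_eq_0_iff) auto
  qed
  moreover have "total_betti wt R i = 0" if "i > r" for i
    using rank_vanishes[of i] that r by (simp add: total_betti_def betti_def rk_def)
  moreover have "betti wt R r (div_class wt D) \<noteq> 0 \<longleftrightarrow> minimally_alive wt D" if "\<forall>v. wt v v = 0" for D
    using minimally_alive_loopless[OF assms(2) that] top_betti[OF r] by simp
  ultimately show ?thesis using total minimally_alive_degree by blast
qed

end
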